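(* Let $F\subset \mathrm{Sym}^2(\mathbb R^n)$ be an ST-invariant cone subequation with finite Riesz characteristic $p=p_F$. If $F$ is convex or if $p_F<2$, then tangents always exist: for every $F$-subharmonic function $u$ defined in a neighborhood of $0\in\mathbb R^n$, the set $T_0(u)$ of tangents to $u$ at $0$ is non-empty.
   Context: Fix $n\ge 2$. $\mathrm{Sym}^2(\mathbb R^n)$ is the space of real symmetric $n\times n$ matrices and $\mathcal P=\{A: A\ge 0\}$. A subequation is a nonempty proper closed subset $F\subset \mathrm{Sym}^2(\mathbb R^n)$ with $F+\mathcal P\subset F$. It is a cone if $tF\subset F$ for all $t\ge 0$. It is ST-invariant if there is a subgroup $G\subset O(n)$ acting transitively on $S^{n-1}$ such that $F$ is invariant under $A\mapsto gAg^t$ for all $g\in G$. For a unit vector $e$, $P_e$ and $P_{e^\perp}=I-P_e$ are the orthogonal projections onto the line $\mathbb R e$ and onto the hyperplane $e^\perp$. The Riesz characteristic of an ST-invariant cone subequation $F$ is $p_F=\sup\{\bar p: P_{e^\perp}-(\bar p-1)P_e\in F\}\in[1,\infty]$ (independent of $e$). An upper semi-continuous function $u:X\to[-\infty,\infty)$ on an open set $X\subset\mathbb R^n$, not identically $-\infty$ on any connected component of $X$, is $F$-subharmonic if whenever $x_0\in X$ and $\varphi$ is a $C^2$ function near $x_0$ with $u\le\varphi$ near $x_0$ and $u(x_0)=\varphi(x_0)$, one has $D^2\varphi(x_0)\in F$. Tangential $p$-flow: for $u$ $F$-subharmonic near $0$ and $r>0$, $u_r(x)=r^{p-2}u(rx)$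 if $p>2$; $u_r(x)=r^{p-2}(u(rx)-u(0))$ if $1\le p<2$; $u_r(x)=u(rx)-M(u,r)$ with $M(u,r)=\sup_{|x|\le r}u$ if $p=2$. (If $u$ is defined on the ball of radius $\rho$, $u_r$ is defined on the ball of radius $\rho/r$.) Tangents: $U\in T_0(u)$ if there is a sequence $r_j\downarrow 0$ with $u_{r_j}\to U$, where convergence is in $L^1_{\rm loc}(\mathbb R^n)$ when $F$ is convex, with $U$ taken to be the upper semi-continuous representative $U(x)=\lim_{r\to0}\operatorname{ess\,sup}_{B_r(x)}\overline U$ of the $L^1_{\rm loc}$ limit $\overline U$; when $1\le p<2$ (with $F$ not necessarily convex), convergence is uniform convergence on compact subsets of $\mathbb R^n$. *)

theory Defs
  imports
    "HOL-Analysis.Analysis"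
    "HOL-Probability.Essential_Supremum"
    "HOL-Algebra.Group"
begin

section \<open>Subequations\<close>

definition symmetric_matrices :: "(real^'n^'n) set" where
  "symmetric_matrices = {A. transpose A = A}"

definition psd_matrices :: "(real^'n^'n) set" where
  "psd_matrices = {A \<in> symmetric_matrices. \<forall>x. x \<bullet> (A *v x) \<ge> 0}"

text \<open>Since the symmetric matrices form a closed subspace, being closed among all matrices is
  the same as being closed among the symmetric ones.\<close>

definition subequation :: "(real^'n^'n) set \<Rightarrow> bool" where
  "subequation F \<longleftrightarrow>
     F \<noteq> {} \<and> F \<subset> symmetric_matrices \<and> closed F \<and>
     (\<forall>A\<in>F. \<forall>B\<in>psd_matrices. A + B \<in> F)"

definition orthogonal_group :: "(real^'n^'n) monoid" where
  "orthogonal_group = \<lparr>carrier = {g. orthogonal_matrix g}, mult = (**), one = mat 1\<rparr>"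

definition transitive_on_sphere :: "(real^'n^'n) set \<Rightarrow> bool" where
  "transitive_on_sphere G \<longleftrightarrow> (\<forall>x\<in>sphere 0 1. \<forall>y\<in>sphere 0 1. \<exists>g\<in>G. g *v x = y)"

definition ST_invariant :: "(real^'n^'n) set \<Rightarrow> bool" where
  "ST_invariant F \<longleftrightarrow>
     (\<exists>G. subgroup G orthogonal_group \<and> transitive_on_sphere G \<and>
          (\<forall>g\<in>G. \<forall>A\<in>F. g ** A ** transpose g \<in> F))"


section \<open>The Riesz characteristic\<close>

definition proj_line :: "real^'n \<Rightarrow> real^'n^'n" where
  "proj_line e = matrix (\<lambda>x. (x \<bullet> e) *\<^sub>R e)"

definition proj_perp :: "real^'n \<Rightarrow> real^'n^'n" where
  "proj_perp e = mat 1 - proj_line e"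

text \<open>The unit vector \<open>e\<close> is kept as a parameter; for ST-invariant \<open>F\<close> the value does not depend
  on it, see \<open>riesz_characteristic_independent\<close> below.\<close>

definition riesz_characteristic :: "(real^'n^'n) set \<Rightarrow> real^'n \<Rightarrow> ereal" where
  "riesz_characteristic F e =
     Sup (ereal ` {p. proj_perp e - (p - 1) *\<^sub>R proj_line e \<in> F})"


section \<open>Subharmonic functions\<close>

definition upper_semicontinuous_on :: "'a::topological_space set \<Rightarrow> ('a \<Rightarrow> ereal) \<Rightarrow> bool" where
  "upper_semicontinuous_on X u \<longleftrightarrow> (\<forall>c. openin (top_of_set X) {x\<in>X. u x < c})"

text \<open>\<open>\<phi>\<close> is of class \<open>C\<^sup>2\<close> on \<open>S\<close>, with gradient \<open>g\<close> and Hessian matrix \<open>H\<close>.\<close>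

definition C2_on ::
  "(real^'n) set \<Rightarrow> (real^'n \<Rightarrow> real) \<Rightarrow> (real^'n \<Rightarrow> real^'n) \<Rightarrow> (real^'n \<Rightarrow> real^'n^'n) \<Rightarrow> bool" where
  "C2_on S \<phi> g H \<longleftrightarrow>
     (\<forall>x\<in>S. (\<phi> has_derivative (\<lambda>h. g x \<bullet> h)) (at x)) \<and>
     (\<forall>x\<in>S. (g has_derivative (\<lambda>h. H x *v h)) (at x)) \<and>
     continuous_on S H"

text \<open>Functions with values in \<open>[-\<infinity>, \<infinity>)\<close> on \<open>X\<close> are total functions into \<^typ>\<open>ereal\<close> whose values
  outside \<open>X\<close> are irrelevant. There is no test function at points where \<open>u = -\<infinity>\<close>.\<close>

definition subharmonic_on ::
  "(real^'n^'n) set \<Rightarrow> (real^'n) set \<Rightarrow> (real^'n \<Rightarrow> ereal) \<Rightarrow> bool" where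
  "subharmonic_on F X u \<longleftrightarrow>
     upper_semicontinuous_on X u \<and>
     (\<forall>x\<in>X. u x < \<infinity>) \<and>
     (\<forall>C\<in>components X. \<exists>x\<in>C. u x \<noteq> -\<infinity>) \<and>
     (\<forall>x0\<in>X. \<forall>\<phi> g H S.
        open S \<and> x0 \<in> S \<and> S \<subseteq> X \<and> C2_on S \<phi> g H \<and>
        (\<forall>x\<in>S. u x \<le> ereal (\<phi> x)) \<and> u x0 = ereal (\<phi> x0)
        \<longrightarrow> H x0 \<in> F)"


section \<open>Tangents\<close>

text \<open>For \<open>u\<close> given on a neighbourhood of \<open>0\<close>, the values of \<open>tangential_flow p u r\<close> on a fixed
  bounded set involve only values of \<open>u\<close> on that neighbourhood once \<open>r\<close> is small; everything below
  depends only on small \<open>r\<close>.\<close>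

definition tangential_flow :: "real \<Rightarrow> (real^'n \<Rightarrow> ereal) \<Rightarrow> real \<Rightarrow> real^'n \<Rightarrow> ereal" where
  "tangential_flow p u r x =
     (if p > 2 then ereal (r powr (p - 2)) * u (r *\<^sub>R x)
      else if p < 2 then ereal (r powr (p - 2)) * (u (r *\<^sub>R x) - u 0)
      else u (r *\<^sub>R x) - (SUP y\<in>cball 0 r. u y))"

text \<open>Convergence in \<open>L\<^sup>1\<^sub>l\<^sub>o\<^sub>c\<close> of extended-real functions to a real function. If \<open>f j = -\<infinity>\<close> on a
  set of positive measure in \<open>K\<close>, the integral over \<open>K\<close> is infinite.\<close>

definition tendsto_L1_loc ::
  "(nat \<Rightarrow> 'a::euclidean_space \<Rightarrow> ereal) \<Rightarrow> ('a \<Rightarrow> real) \<Rightarrow> bool" where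
  "tendsto_L1_loc f V \<longleftrightarrow>
     (\<forall>K. compact K \<longrightarrow>
        set_integrable lborel K V \<and>
        (\<lambda>j. set_nn_integral lborel K (\<lambda>x. e2ennreal \<bar>f j x - ereal (V x)\<bar>)) \<longlonglongrightarrow> 0)"

definition usc_representative :: "('a::euclidean_space \<Rightarrow> real) \<Rightarrow> ('a \<Rightarrow> ereal) \<Rightarrow> bool" where
  "usc_representative V U \<longleftrightarrow>
     (\<forall>x. ((\<lambda>s. esssup (restrict_space lborel (ball x s)) (\<lambda>y. ereal (V y))) \<longlongrightarrow> U x)
            (at_right 0))"

definition tendsto_locally_uniformly ::
  "(nat \<Rightarrow> 'a::euclidean_space \<Rightarrow> ereal) \<Rightarrow> ('a \<Rightarrow> real) \<Rightarrow> bool" where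
  "tendsto_locally_uniformly f V \<longleftrightarrow>
     (\<forall>K. compact K \<longrightarrow>
        (\<forall>\<^sub>F j in sequentially. \<forall>x\<in>K. \<bar>f j x\<bar> \<noteq> \<infinity>) \<and>
        uniform_limit K (\<lambda>j x. real_of_ereal (f j x)) V sequentially)"

text \<open>For convex \<open>F\<close> convergence is meant in \<open>L\<^sup>1\<^sub>l\<^sub>o\<^sub>c\<close>, for \<open>p < 2\<close> it is meant locally uniformly;
  when both apply, both are required. For \<open>F\<close> not convex and \<open>p \<ge> 2\<close> tangents are not considered
  and the set is empty by convention.\<close>

definition tangents ::
  "(real^'n^'n) set \<Rightarrow> real \<Rightarrow> (real^'n \<Rightarrow> ereal) \<Rightarrow> (real^'n \<Rightarrow> ereal) set" where
  "tangents F p u =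
     {U. (convex F \<or> p < 2) \<and>
         (\<exists>r. (\<forall>j. r j > 0) \<and> decseq r \<and> r \<longlonglongrightarrow> 0 \<and>
           (convex F \<longrightarrow>
             (\<exists>V. tendsto_L1_loc (\<lambda>j. tangential_flow p u (r j)) V \<and> usc_representative V U)) \<and>
           (p < 2 \<longrightarrow>
             (\<exists>V. tendsto_locally_uniformly (\<lambda>j. tangential_flow p u (r j)) V \<and>
                  U = (\<lambda>x. ereal (V x)))))}"


section \<open>Consistency of the definitions\<close>

lemma group_orthogonal_group: "group (orthogonal_group :: (real^'n^'n) monoid)"
proof (rule groupI)
  fix x :: "real^'n^'n" assume "x \<in> carrier orthogonal_group"
  then have "orthogonal_matrix x" by (simp add: orthogonal_group_def)
  then show "\<exists>y\<in>carrier orthogonal_group. y \<otimes>\<^bsub>orthogonal_group\<^esub> x = \<one>\<^bsub>orthogonal_group\<^esub>"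
    by (intro bexI[of _ "transpose x"])
       (auto simp: orthogonal_group_def orthogonal_matrix_def)
qed (auto simp: orthogonal_group_def orthogonal_matrix_mul orthogonal_matrix_id matrix_mul_assoc)

lemma proj_line_nth: "proj_line e $ i $ j = e $ i * e $ j"
  by (simp add: proj_line_def matrix_def inner_axis' mult.commute)

lemma proj_line_mult_vec: "proj_line e *v x = (x \<bullet> e) *\<^sub>R e"
  by (simp add: vec_eq_iff matrix_vector_mult_def proj_line_nth inner_vec_def sum_distrib_left
        sum_distrib_right mult_ac)

lemma proj_line_conj:
  assumes "orthogonal_matrix g"
  shows "g ** proj_line e ** transpose g = proj_line (g *v e)"
  unfolding matrix_eq
  by (simp add: matrix_vector_mul_assoc[symmetric] proj_line_mult_vec
        matrix_vector_mult_scaleR dot_lmul_matrix[symmetric] vector_transpose_matrix inner_commute)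

lemma riesz_characteristic_independent:
  fixes F :: "(real^'n^'n) set"
  assumes F: "ST_invariant F" and e: "norm e = 1" and e': "norm e' = 1"
  shows "riesz_characteristic F e = riesz_characteristic F e'"
proof -
  have sub: "proj_perp b - c *\<^sub>R proj_line b \<in> F"
    if h: "proj_perp a - c *\<^sub>R proj_line a \<in> F" "norm a = 1" "norm b = 1" for a b :: "real^'n" and c
  proof -
    obtain G where G: "subgroup G orthogonal_group" "transitive_on_sphere G"
        "\<And>g A. g \<in> G \<Longrightarrow> A \<in> F \<Longrightarrow> g ** A ** transpose g \<in> F"
      using F unfolding ST_invariant_def by blast
    obtain g where g: "g \<in> G" "g *v a = b"
      using G(2) h(2,3) unfolding transitive_on_sphere_def by (metis mem_sphere_0)
    have og: "orthogonal_matrix g"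
      using subgroup.mem_carrier[OF G(1) g(1)] by (simp add: orthogonal_group_def)
    have lin: "g ** (A - d *\<^sub>R B) ** transpose g
               = g ** A ** transpose g - d *\<^sub>R (g ** B ** transpose g)" for A B :: "real^'n^'n" and d
      by (simp add: matrix_eq matrix_vector_mul_assoc[symmetric] matrix_vector_mult_diff_rdistrib
            matrix_vector_mult_diff_distrib scaleR_matrix_vector_assoc[symmetric]
            matrix_vector_mult_scaleR)
    have perp: "g ** proj_perp a ** transpose g = proj_perp b"
      using lin[of "mat 1" 1 "proj_line a"] proj_line_conj[OF og, of a] og g(2)
      by (simp add: proj_perp_def orthogonal_matrix_def)
    show ?thesis
      using G(3)[OF g(1) h(1)] lin perp proj_line_conj[OF og, of a] g(2) by simp
  qed
  then show ?thesis
    unfolding riesz_characteristic_def using e e' by (metis (mono_tags, lifting))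
qed

end

theory Submission
  imports Defs "HOL-Complex_Analysis.Great_Picard" "HOL-Probability.Distributions"
    "HOL-Real_Asymp.Real_Asymp"
begin

text \<open>
The Riesz kernel \<open>K\<^sub>p\<close>, with \<open>K\<^sub>p'(t) = t powr (1 - p)\<close>,
has at \<open>x \<noteq> 0\<close> a Hessian that is a positive multiple of
\<open>P\<^sub>\<perp> - (p - 1) P\<close>, where \<open>P\<close> projects onto the line
through \<open>x\<close>. For \<open>p\<close> the Riesz characteristic this matrix leaves
\<open>F\<close> as soon as a positive multiple of the identity is subtracted
(\<open>riesz_kernel_hessian_strict\<close>). So away from the origin no function \<open>a + c
K\<^sub>p - \<epsilon> \<bar>x\<bar>\<^sup>2\<close> with \<open>c, \<epsilon> > 0\<close>
touches an \<open>F\<close>-subharmonic function \<open>u\<close> from above, and on an annulus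
\<open>u\<close> stays below every \<open>a + c K\<^sub>p\<close> with \<open>c \<ge> 0\<close>
that dominates it on the two boundary spheres (\<open>annulus_comparison\<close>). All growth
estimates follow from this comparison, and their homogeneity is that of
\<open>K\<^sub>p\<close>, which is also that of the tangential flow.

If \<open>p < 2\<close>, the kernel is finite at the origin and the inner sphere may shrink to a
point. Comparison then says that \<open>u\<close> is Hoelder continuous with exponent \<open>2 -
p\<close> (\<open>holder_of_lt_2\<close>). The flow preserves the Hoelder constant, so the
functions \<open>u\<^sub>r\<close> are equicontinuous and the Arzela-Ascoli argument yields a
locally uniform limit (\<open>tangent_exists_of_lt_2\<close>). The limit is continuous, hence it
is also an \<open>L\<^sup>1\<^sub>l\<^sub>o\<^sub>c\<close> limit and equal to its own
semicontinuous representative.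

If \<open>p \<ge> 2\<close>, then \<open>F\<close> is convex by hypothesis, and its symmetry
under a transitive group shows that every matrix in \<open>F\<close> has nonnegative trace
(\<open>trace_nonneg_of_convex_ST_invariant\<close>): \<open>u\<close> is subharmonic for the
Laplacian, in the viscosity sense. Comparison makes the maximum of \<open>u\<close> over balls a
convex function of \<open>K\<^sub>p\<close> of the radius, so the functions
\<open>u\<^sub>r\<close> are locally bounded above and their maxima over the unit ball are
bounded below. It remains to see that such a family of viscosity subharmonic functions is
precompact in \<open>L\<^sup>1\<^sub>l\<^sub>o\<^sub>c\<close>
(\<open>viscosity_subharmonic_compactness\<close>).

The compactness rests on one inequality between \<open>v = -u \<ge> 0\<close> and the heat flow.
If \<open>0 \<le> f \<le> v\<close> and \<open>f\<close> is Lipschitz with support in a small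
ball, then the heat flow of \<open>f\<close> starts below \<open>v\<close> and cannot cross it
inside a larger ball: at a first crossing the flow would touch \<open>v\<close> from below,
where the viscosity inequality makes its Laplacian nonpositive, but this is its time derivative,
which has to be positive there after a small tilt in time (\<open>heat_comparison\<close>). The
error caused by the boundary of the larger ball is a value of the heat kernel at positive
distance. Letting \<open>f\<close> increase to \<open>v\<close> gives for fixed time the weak
Harnack inequality \<open>\<integral> v \<le> C v(x)\<close>, which bounds the
\<open>L\<^sup>1\<close> norms, and for time tending to \<open>0\<close> it gives that
\<open>v\<close> is almost above its heat average. Since a nonnegative function is controlled in
\<open>L\<^sup>1\<close> by its integral, and the heat flow almost preserves the integral of
\<open>v\<close> against a Lipschitz cutoff, \<open>v\<close> is close in
\<open>L\<^sup>1\<close> to its heat average, uniformly over the family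
(\<open>smoothing_estimate\<close>). The averages at a fixed time are equicontinuous, so the
family is totally bounded in \<open>L\<^sup>1\<^sub>l\<^sub>o\<^sub>c\<close>.
\<close>

section \<open>Upper semicontinuous functions\<close>

text \<open>If no point were a maximum, the sets \<open>{f < f y}\<close> would cover \<open>S\<close>; the largest of the finitely many
levels of a subcover is then attained at a point that the subcover misses.\<close>

lemma usc_attains_max:
  fixes f :: "'a::topological_space \<Rightarrow> ereal"
  assumes S: "compact S" "S \<noteq> {}" and usc: "upper_semicontinuous_on S f"
  shows "\<exists>x\<in>S. \<forall>y\<in>S. f y \<le> f x"
proof (rule ccontr)
  assume no: "\<not> (\<exists>x\<in>S. \<forall>y\<in>S. f y \<le> f x)"
  have "\<exists>T. open T \<and> {x\<in>S. f x < c} = S \<inter> T" for c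
    using usc by (auto simp: upper_semicontinuous_on_def openin_open)
  then obtain T where T: "\<And>c. open (T c)" "\<And>c. {x\<in>S. f x < c} = S \<inter> T c" by metis
  have cov: "S \<subseteq> (\<Union>y\<in>S. T (f y))"
  proof
    fix x assume x: "x \<in> S"
    then obtain y where "y \<in> S" "f x < f y" using no by (metis not_le)
    then show "x \<in> (\<Union>y\<in>S. T (f y))" using T(2)[of "f y"] x by blast
  qed
  obtain D where D: "D \<subseteq> S" "finite D" "S \<subseteq> (\<Union>y\<in>D. T (f y))"
    using compactE_image[OF S(1) _ cov] T(1) by metis
  have ne: "D \<noteq> {}" using D(3) S(2) by auto
  obtain m where m: "m \<in> D" "\<forall>y\<in>D. f y \<le> f m"
  proof -
    have "Max (f ` D) \<in> f ` D" using D(2) ne by (intro Max_in) auto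
    moreover have "f y \<le> Max (f ` D)" if "y \<in> D" for y using D(2) that by (intro Max_ge) auto
    ultimately show ?thesis using that by auto
  qed
  have "m \<in> S" using m D by auto
  then obtain y where y: "y \<in> D" "m \<in> T (f y)" using D(3) by blast
  then have "f m < f y" using T(2)[of "f y"] \<open>m \<in> S\<close> by blast
  then show False using m(2) y(1) by (simp add: leD)
qed

lemma usc_subset:
  assumes "upper_semicontinuous_on X u" "S \<subseteq> X"
  shows "upper_semicontinuous_on S u"
  unfolding upper_semicontinuous_on_def
proof
  fix c
  obtain T where T: "open T" "{x\<in>X. u x < c} = X \<inter> T"
    using assms(1) by (auto simp: upper_semicontinuous_on_def openin_open)
  have "{x\<in>S. u x < c} = S \<inter> T" using T(2) assms(2) by blast
  then show "openin (top_of_set S) {x\<in>S. u x < c}" using T(1) by (auto simp: openin_open)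
qed

lemma usc_compose:
  assumes "upper_semicontinuous_on X u" "continuous_on S h" "h ` S \<subseteq> X"
  shows "upper_semicontinuous_on S (\<lambda>x. u (h x))"
  unfolding upper_semicontinuous_on_def
proof
  fix c
  obtain T where T: "open T" "{x\<in>X. u x < c} = X \<inter> T"
    using assms(1) by (auto simp: upper_semicontinuous_on_def openin_open)
  have "{x\<in>S. u (h x) < c} = S \<inter> h -` T" using T(2) assms(3) by blast
  then show "openin (top_of_set S) {x\<in>S. u (h x) < c}"
    using continuous_openin_preimage_gen[OF assms(2) T(1)] by simp
qed

lemma ereal_add_real_less_iff: "a + ereal b < ereal c \<longleftrightarrow> a < ereal (c - b)"
  by (cases a) auto

lemma usc_add_continuous:
  assumes u: "upper_semicontinuous_on S u" and lt: "\<And>x. x \<in> S \<Longrightarrow> u x < \<infinity>"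
    and w: "continuous_on S w"
  shows "upper_semicontinuous_on S (\<lambda>x. u x + ereal (w x))"
  unfolding upper_semicontinuous_on_def
proof
  fix c :: ereal
  show "openin (top_of_set S) {x \<in> S. u x + ereal (w x) < c}"
  proof (cases c)
    case PInf
    have "u x + ereal (w x) < \<infinity>" if "x \<in> S" for x using lt[OF that] by (cases "u x") auto
    then have "{x \<in> S. u x + ereal (w x) < c} = S" using PInf by auto
    then show ?thesis by simp
  next
    case MInf then show ?thesis by simp
  next
    case (real r)
    have "u x < ereal (r - w x) \<longleftrightarrow> (\<exists>q. u x < ereal q \<and> w x < r - q)" for x
    proof
      assume "u x < ereal (r - w x)"
      then obtain q where "u x < ereal q" "ereal q < ereal (r - w x)" using ereal_dense2 by blast
      then show "\<exists>q. u x < ereal q \<and> w x < r - q" by (intro exI[of _ q]) auto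
    next
      assume "\<exists>q. u x < ereal q \<and> w x < r - q"
      then obtain q where "u x < ereal q" "w x < r - q" by blast
      then show "u x < ereal (r - w x)" by (cases "u x") auto
    qed
    then have "{x \<in> S. u x + ereal (w x) < c} = (\<Union>q. {x\<in>S. u x < ereal q} \<inter> {x\<in>S. w x < r - q})"
      using real by (auto simp: ereal_add_real_less_iff)
    moreover have "openin (top_of_set S) ({x\<in>S. u x < ereal q} \<inter> {x\<in>S. w x < r - q})" for q
    proof (rule openin_Int)
      show "openin (top_of_set S) {x\<in>S. u x < ereal q}" using u by (simp add: upper_semicontinuous_on_def)
      have "{x\<in>S. w x < r - q} = S \<inter> w -` {..<r-q}" by auto
      then show "openin (top_of_set S) {x\<in>S. w x < r - q}"
        using continuous_openin_preimage_gen[OF w open_lessThan, of "r-q"] by simp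
    qed
    ultimately show ?thesis by auto
  qed
qed

section \<open>Convex ST-invariant cones and the trace\<close>

lemma inner_transpose_mult_vec:
  fixes g :: "real^'n^'n"
  shows "x \<bullet> (transpose g *v y) = (g *v x) \<bullet> y"
  using dot_lmul_matrix[of x "transpose g" y] by (simp add: vector_transpose_matrix)

lemma inner_conj_mult_vec:
  fixes g :: "real^'n^'n"
  shows "x \<bullet> ((transpose g ** A ** g) *v x) = (g *v x) \<bullet> (A *v (g *v x))"
  by (simp add: matrix_vector_mul_assoc[symmetric] inner_transpose_mult_vec del: transpose_matrix_vector)

lemma norm_mult_transpose_orthogonal:
  fixes g B :: "real^'n^'n"
  assumes "orthogonal_matrix g"
  shows "norm (B ** transpose g) = norm B"
proof -
  have row: "(B ** transpose g) $ i = g *v (B $ i)" for i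
    by (simp add: vec_eq_iff matrix_matrix_mult_def matrix_vector_mult_def transpose_def mult.commute)
  have "norm (g *v x) = norm x" for x
    using inner_transpose_mult_vec[of x g "g *v x"] assms
    by (simp add: norm_eq matrix_vector_mul_assoc orthogonal_matrix_def)
  then show ?thesis by (simp add: norm_vec_def row L2_set_def)
qed

lemma norm_transpose_matrix: "norm (transpose (B::real^'n^'n)) = norm B"
proof -
  have "(norm (transpose B))\<^sup>2 = (norm B)\<^sup>2"
    unfolding power2_norm_eq_inner inner_vec_def transpose_def
    by (simp, rule sum.swap)
  then show ?thesis by simp
qed

lemma norm_orthogonal_conj:
  fixes g B :: "real^'n^'n"
  assumes "orthogonal_matrix g"
  shows "norm (g ** B ** transpose g) = norm B"
proof -
  have "norm (g ** B ** transpose g) = norm (g ** B)"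
    by (rule norm_mult_transpose_orthogonal[OF assms])
  also have "\<dots> = norm (transpose (transpose B ** transpose g))"
    by (simp add: matrix_transpose_mul)
  also have "\<dots> = norm B" by (simp only: norm_transpose_matrix norm_mult_transpose_orthogonal[OF assms])
  finally show ?thesis .
qed

text \<open>A multiple of a negative definite form lies below any given symmetric form. This is what makes a
subequation with a negative multiple of the identity degenerate.\<close>

lemma symmetric_shift_psd:
  fixes A B :: "real^'n^'n"
  assumes A: "A \<in> symmetric_matrices" and B: "B \<in> symmetric_matrices"
    and c: "c < 0" "\<And>x. x \<bullet> (B *v x) = c * (norm x)^2"
  obtains t where "t \<ge> 0" "A - t *\<^sub>R B \<in> psd_matrices"
proof -
  obtain K where K: "K > 0" "\<And>x. norm (A *v x) \<le> norm x * K"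
    using bounded_linear.pos_bounded[OF matrix_vector_mul_bounded_linear[of A]] by blast
  define t where "t = K / (-c)"
  have t: "t \<ge> 0" "t * c = - K" using c K by (auto simp: t_def divide_simps)
  have "x \<bullet> ((A - t *\<^sub>R B) *v x) \<ge> 0" for x
  proof -
    have "\<bar>x \<bullet> (A *v x)\<bar> \<le> norm x * (norm x * K)"
      using Cauchy_Schwarz_ineq2[of x "A *v x"] K(2)[of x] by (meson mult_left_mono norm_ge_zero order_trans)
    moreover have "x \<bullet> ((A - t *\<^sub>R B) *v x) = x \<bullet> (A *v x) - (t * c) * (norm x)^2"
      by (simp add: matrix_vector_mult_diff_rdistrib scaleR_matrix_vector_assoc[symmetric] inner_diff_right c(2))
    ultimately show ?thesis unfolding t(2) by (simp add: power2_eq_square abs_le_iff mult_ac)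
  qed
  moreover have "A - t *\<^sub>R B \<in> symmetric_matrices"
    using A B by (auto simp: symmetric_matrices_def transpose_def vec_eq_iff)
  ultimately have "A - t *\<^sub>R B \<in> psd_matrices" by (simp add: psd_matrices_def)
  then show ?thesis using that t by blast
qed

lemma subequation_add:
  "subequation F \<Longrightarrow> A \<in> F \<Longrightarrow> B \<in> psd_matrices \<Longrightarrow> A + B \<in> F"
  by (simp add: subequation_def)

text \<open>The elements of \<open>F\<close> with the same trace as \<open>A\<close> form a closed convex set that is invariant under the
group. Its element \<open>B\<close> of least Frobenius norm is unique, hence fixed by the group; this replaces an
average over the group. By transitivity the quadratic form of \<open>B\<close> is constant on the unit sphere, so
it is \<open>c \<bar>x\<bar>\<^sup>2\<close> with \<open>CARD('n) * c = trace A\<close>. If \<open>c\<close> were negative, adding positive semidefinite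
matrices to multiples of \<open>B\<close> would produce every symmetric matrix.\<close>

lemma trace_nonneg_of_convex_ST_invariant:
  fixes F :: "(real^'n^'n) set"
  assumes sub: "subequation F" and cone: "cone F" and ST: "ST_invariant F" and conv: "convex F"
    and A: "A \<in> F"
  shows "trace A \<ge> 0"
proof (rule ccontr)
  assume neg: "\<not> trace A \<ge> 0"
  obtain G where G: "subgroup G orthogonal_group" "transitive_on_sphere G"
      "\<And>g A. g \<in> G \<Longrightarrow> A \<in> F \<Longrightarrow> g ** A ** transpose g \<in> F"
    using ST unfolding ST_invariant_def by blast
  have og: "orthogonal_matrix g" if "g \<in> G" for g
    using subgroup.mem_carrier[OF G(1) that] by (simp add: orthogonal_group_def)
  define S where "S = F \<inter> {B. trace B = trace A}"
  have lin: "linear (trace :: real^'n^'n \<Rightarrow> real)"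
    by (rule linearI) (auto simp: trace_def sum.distrib sum_distrib_left)
  have contr: "continuous_on UNIV (trace :: real^'n^'n \<Rightarrow> real)"
    using lin by (simp add: linear_continuous_on linear_conv_bounded_linear)
  have closedS: "closed S" unfolding S_def
    using sub by (intro closed_Int closed_Collect_eq contr continuous_on_const) (auto simp: subequation_def)
  have convS: "convex S"
  proof -
    have "{B :: real^'n^'n. trace B = trace A} = trace -` {trace A}" by auto
    then show ?thesis unfolding S_def
      using convex_linear_vimage[OF lin, of "{trace A}"] conv by (simp add: convex_Int)
  qed
  have neS: "S \<noteq> {}" using A by (auto simp: S_def)
  define B where "B = closest_point S 0"
  have BS: "B \<in> S" unfolding B_def by (rule closest_point_in_set[OF closedS neS])
  have BF: "B \<in> F" and trB: "trace B = trace A" using BS by (auto simp: S_def)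
  have symF: "F \<subset> symmetric_matrices" using sub by (simp add: subequation_def)
  have inv: "g ** B ** transpose g = B" if g: "g \<in> G" for g
  proof -
    have "trace (g ** B ** transpose g) = trace (transpose g ** (g ** B))"
      by (rule trace_mul_sym)
    also have "\<dots> = trace B" using og[OF g] by (simp add: matrix_mul_assoc orthogonal_matrix_def)
    finally have "g ** B ** transpose g \<in> S" using G(3)[OF g BF] trB by (simp add: S_def)
    moreover have "dist 0 (g ** B ** transpose g) \<le> dist 0 z" if "z \<in> S" for z
      using closest_point_le[OF closedS that, of 0] norm_orthogonal_conj[OF og[OF g], of B]
      by (simp add: B_def dist_norm)
    ultimately show ?thesis
      using closest_point_unique[OF convS closedS, of "g ** B ** transpose g" 0] B_def by blast
  qed
  have inv': "transpose g ** B ** g = B" if g: "g \<in> G" for g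
  proof -
    have "transpose g ** (g ** B ** transpose g) ** g = (transpose g ** g) ** B ** (transpose g ** g)"
      by (simp add: matrix_mul_assoc)
    then show ?thesis using inv[OF g] og[OF g] by (simp add: orthogonal_matrix_def)
  qed
  define i0 :: 'n where "i0 = undefined"
  define c where "c = axis i0 1 \<bullet> (B *v axis i0 1)"
  have unit: "x \<bullet> (B *v x) = c" if "norm x = 1" for x
  proof -
    have "axis i0 1 \<in> sphere (0::real^'n) 1" "x \<in> sphere 0 1" using that by simp_all
    then obtain g where g: "g \<in> G" "g *v axis i0 1 = x"
      using G(2) unfolding transitive_on_sphere_def by blast
    show ?thesis using inner_conj_mult_vec[of "axis i0 1" g B] inv'[OF g(1)] g(2)
      by (simp add: c_def)
  qed
  have quad: "x \<bullet> (B *v x) = c * (norm x)^2" for x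
  proof (cases "x = 0")
    case False
    define y where "y = x /\<^sub>R norm x"
    have "norm y = 1" and x: "x = norm x *\<^sub>R y" using False by (auto simp: y_def)
    have "x \<bullet> (B *v x) = (norm x)^2 * (y \<bullet> (B *v y))"
      by (subst (1 2) x) (simp add: matrix_vector_mult_scaleR power2_eq_square)
    then show ?thesis using unit[OF \<open>norm y = 1\<close>] by simp
  qed simp
  have diag: "B $ i $ i = c" for i
    using unit[of "axis i 1"] by (simp add: matrix_vector_mul_component inner_axis' inner_axis norm_axis_1)
  have "trace B = CARD('n) * c" by (simp add: trace_def diag)
  then have c: "c < 0" using neg trB by (simp add: not_le mult_less_0_iff)
  have "symmetric_matrices \<subseteq> F"
  proof
    fix A' :: "real^'n^'n" assume A': "A' \<in> symmetric_matrices"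
    obtain t where t: "t \<ge> 0" "A' - t *\<^sub>R B \<in> psd_matrices"
      using symmetric_shift_psd[OF A' _ c quad] symF BF by blast
    have "t *\<^sub>R B \<in> F" using cone BF t(1) by (simp add: cone_def)
    then have "t *\<^sub>R B + (A' - t *\<^sub>R B) \<in> F" using subequation_add[OF sub _ t(2)] by blast
    then show "A' \<in> F" by simp
  qed
  then show False using symF by blast
qed

section \<open>Riesz kernels as strict barriers\<close>

lemma proj_line_scaleR: "proj_line (c *\<^sub>R y) = c^2 *\<^sub>R proj_line y"
  by (simp add: vec_eq_iff proj_line_nth power2_eq_square)

lemma proj_perp_psd:
  assumes "norm b = 1"
  shows "proj_perp b \<in> psd_matrices"
proof -
  have "x \<bullet> (proj_perp b *v x) \<ge> 0" for x
  proof -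
    have "(x \<bullet> b)^2 \<le> (x \<bullet> x) * (b \<bullet> b)" by (rule Cauchy_Schwarz_ineq)
    moreover have "x \<bullet> (proj_perp b *v x) = x \<bullet> x - (x \<bullet> b)^2"
      by (simp add: proj_perp_def matrix_vector_mult_diff_rdistrib proj_line_mult_vec
          inner_diff_right power2_eq_square)
    moreover have "b \<bullet> b = 1" using assms by (simp add: norm_eq_1)
    ultimately show ?thesis by simp
  qed
  moreover have "proj_perp b \<in> symmetric_matrices"
    by (simp add: symmetric_matrices_def vec_eq_iff transpose_def proj_perp_def proj_line_nth mat_def mult.commute)
  ultimately show ?thesis by (simp add: psd_matrices_def)
qed

lemma psd_scaleR:
  assumes "B \<in> psd_matrices" "c \<ge> 0"
  shows "c *\<^sub>R B \<in> psd_matrices"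
  using assms by (auto simp: psd_matrices_def symmetric_matrices_def transpose_def vec_eq_iff
      scaleR_matrix_vector_assoc[symmetric])

text \<open>With \<open>b = y / \<bar>y\<bar>\<close> the matrix \<open>mat 1 - p P\<^sub>b\<close> is \<open>P\<^sub>\<perp> - (p - 1) P\<^sub>b\<close>. If \<open>\<epsilon>\<close> times the identity could be
subtracted inside \<open>F\<close>, adding back \<open>\<epsilon> P\<^sub>\<perp>\<close> would leave the same matrix for the exponent \<open>p + \<epsilon>\<close>,
which is beyond the supremum that defines the Riesz characteristic.\<close>

lemma riesz_kernel_hessian_strict:
  fixes F :: "(real^'n^'n) set"
  assumes sub: "subequation F" and cone: "cone F" and ST: "ST_invariant F"
    and e: "norm e = 1" and p: "riesz_characteristic F e = ereal p"
    and y: "y \<noteq> 0" and c: "c > 0" and eps: "\<epsilon> > 0"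
  shows "c *\<^sub>R (mat 1 - (p / (y \<bullet> y)) *\<^sub>R proj_line y) - \<epsilon> *\<^sub>R mat 1 \<notin> F"
proof
  assume in_F: "c *\<^sub>R (mat 1 - (p / (y \<bullet> y)) *\<^sub>R proj_line y) - \<epsilon> *\<^sub>R mat 1 \<in> F"
  define b where "b = y /\<^sub>R norm y"
  define d where "d = \<epsilon> / c"
  have b: "norm b = 1" using y by (simp add: b_def)
  have d: "d > 0" using c eps by (simp add: d_def)
  have Pb: "proj_line y = (y \<bullet> y) *\<^sub>R proj_line b"
    using y by (simp add: b_def proj_line_scaleR power2_norm_eq_inner power_inverse)
  have "(1/c) *\<^sub>R (c *\<^sub>R (mat 1 - (p / (y \<bullet> y)) *\<^sub>R proj_line y) - \<epsilon> *\<^sub>R mat 1) \<in> F"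
    using mem_cone[OF cone in_F, of "1/c"] c by simp
  moreover have "(1/c) *\<^sub>R (c *\<^sub>R (mat 1 - (p / (y \<bullet> y)) *\<^sub>R proj_line y) - \<epsilon> *\<^sub>R mat 1)
      = mat 1 - p *\<^sub>R proj_line b - d *\<^sub>R mat 1"
    using c y by (simp add: Pb scaleR_diff_right d_def)
  ultimately have "mat 1 - p *\<^sub>R proj_line b - d *\<^sub>R mat 1 \<in> F" by simp
  moreover have "d *\<^sub>R proj_perp b \<in> psd_matrices" using proj_perp_psd[OF b] d by (simp add: psd_scaleR)
  ultimately have "(mat 1 - p *\<^sub>R proj_line b - d *\<^sub>R mat 1) + d *\<^sub>R proj_perp b \<in> F"
    by (rule subequation_add[OF sub])
  moreover have "(mat 1 - p *\<^sub>R proj_line b - d *\<^sub>R mat 1) + d *\<^sub>R proj_perp b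
      = proj_perp b - ((p + d) - 1) *\<^sub>R proj_line b"
    by (simp add: proj_perp_def algebra_simps)
  ultimately have "ereal (p + d) \<in> ereal ` {p. proj_perp b - (p - 1) *\<^sub>R proj_line b \<in> F}" by auto
  then have "ereal (p + d) \<le> riesz_characteristic F b" unfolding riesz_characteristic_def by (rule Sup_upper)
  moreover have "riesz_characteristic F b = ereal p"
    using riesz_characteristic_independent[OF ST e b] p by simp
  ultimately show False using d by simp
qed

lemma continuous_on_proj_line:
  assumes "continuous_on S f"
  shows "continuous_on S (\<lambda>x. proj_line (f x))"
proof -
  have "(\<lambda>x. proj_line (f x)) = (\<lambda>x. \<chi> i j. f x $ i * f x $ j)"
    by (simp add: vec_eq_iff proj_line_nth fun_eq_iff)
  moreover have "continuous_on S (\<lambda>x. \<chi> i j. f x $ i * f x $ j)"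
    using assms by (intro continuous_on_vec_lambda continuous_intros)
  ultimately show ?thesis by (simp only:)
qed

text \<open>Radial functions are written as functions of the squared distance, because then the chain rule
involves polynomials only; both the Riesz kernels and the heat kernel are used in this form.\<close>

lemma C2_on_radial:
  fixes x0 :: "real^'n"
  assumes h: "\<And>s. s \<in> T \<Longrightarrow> (h has_real_derivative h1 s) (at s)"
    and h1: "\<And>s. s \<in> T \<Longrightarrow> (h1 has_real_derivative h2 s) (at s)"
    and h2: "continuous_on T h2"
    and ST: "\<And>x. x \<in> S \<Longrightarrow> (x - x0) \<bullet> (x - x0) \<in> T"
  shows "C2_on S (\<lambda>x. h ((x - x0) \<bullet> (x - x0)))
           (\<lambda>x. (2 * h1 ((x - x0) \<bullet> (x - x0))) *\<^sub>R (x - x0))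
           (\<lambda>x. (2 * h1 ((x - x0) \<bullet> (x - x0))) *\<^sub>R mat 1
                 + (4 * h2 ((x - x0) \<bullet> (x - x0))) *\<^sub>R proj_line (x - x0))"
proof -
  have ds: "((\<lambda>x. (x - x0) \<bullet> (x - x0)) has_derivative (\<lambda>d. 2 * ((x - x0) \<bullet> d))) (at x)" for x
    by (auto intro!: derivative_eq_intros simp: inner_commute)
  have comp: "((\<lambda>x. k ((x - x0) \<bullet> (x - x0))) has_derivative (\<lambda>d. 2 * ((x - x0) \<bullet> d) * k')) (at x)"
    if "(k has_real_derivative k') (at ((x - x0) \<bullet> (x - x0)))" for k k' x
    using has_derivative_compose[OF ds, of k "\<lambda>d. d * k'" x] that
    by (simp add: has_field_derivative_def mult_commute_abs)
  have ch1: "continuous_on T h1"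
    using h1 by (meson DERIV_continuous continuous_at_imp_continuous_on)
  show ?thesis unfolding C2_on_def
  proof (intro conjI ballI)
    fix x assume x: "x \<in> S"
    show "((\<lambda>x. h ((x - x0) \<bullet> (x - x0))) has_derivative
        (\<bullet>) ((2 * h1 ((x - x0) \<bullet> (x - x0))) *\<^sub>R (x - x0))) (at x)"
    proof -
      have "(\<lambda>d. 2 * ((x - x0) \<bullet> d) * h1 ((x - x0) \<bullet> (x - x0)))
          = (\<bullet>) ((2 * h1 ((x - x0) \<bullet> (x - x0))) *\<^sub>R (x - x0))"
        by (simp add: fun_eq_iff)
      then show ?thesis using comp[OF h[OF ST[OF x]]] by metis
    qed
    have "((\<lambda>x. (2 * h1 ((x - x0) \<bullet> (x - x0))) *\<^sub>R (x - x0)) has_derivative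
        (\<lambda>d. (2 * h1 ((x - x0) \<bullet> (x - x0))) *\<^sub>R d
            + (2 * (2 * ((x - x0) \<bullet> d) * h2 ((x - x0) \<bullet> (x - x0)))) *\<^sub>R (x - x0))) (at x)"
      by (rule derivative_eq_intros comp[OF h1[OF ST[OF x]]] refl | simp)+
    moreover have "(\<lambda>d. (2 * h1 ((x - x0) \<bullet> (x - x0))) *\<^sub>R d
            + (2 * (2 * ((x - x0) \<bullet> d) * h2 ((x - x0) \<bullet> (x - x0)))) *\<^sub>R (x - x0))
       = (*v) ((2 * h1 ((x - x0) \<bullet> (x - x0))) *\<^sub>R mat 1
                 + (4 * h2 ((x - x0) \<bullet> (x - x0))) *\<^sub>R proj_line (x - x0))"
      by (simp add: fun_eq_iff matrix_vector_mult_add_rdistrib scaleR_matrix_vector_assoc[symmetric]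
          proj_line_mult_vec inner_commute mult_ac)
    ultimately show "((\<lambda>x. (2 * h1 ((x - x0) \<bullet> (x - x0))) *\<^sub>R (x - x0)) has_derivative
        (*v) ((2 * h1 ((x - x0) \<bullet> (x - x0))) *\<^sub>R mat 1
                 + (4 * h2 ((x - x0) \<bullet> (x - x0))) *\<^sub>R proj_line (x - x0))) (at x)" by simp
  next
    have "continuous_on S (\<lambda>x. k ((x - x0) \<bullet> (x - x0)))" if "continuous_on T k" for k :: "real \<Rightarrow> real"
      by (rule continuous_on_compose2[OF that]) (use ST in \<open>auto intro!: continuous_intros\<close>)
    from this[OF ch1] this[OF h2]
    show "continuous_on S (\<lambda>x. (2 * h1 ((x - x0) \<bullet> (x - x0))) *\<^sub>R mat 1
                 + (4 * h2 ((x - x0) \<bullet> (x - x0))) *\<^sub>R proj_line (x - x0))"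
      by (intro continuous_intros continuous_on_proj_line)
  qed
qed

text \<open>The profile \<open>K\<^sub>p\<close> with derivative \<open>t powr (1 - p)\<close>: the Hessian of \<open>K\<^sub>p \<bar>x\<bar>\<close> is
\<open>\<bar>x\<bar> powr (- p)\<close> times \<open>mat 1 - p P\<close>. With this sign and constant it increases for all \<open>p\<close>. At \<open>0\<close>
the value is the correct limit \<open>0\<close> for \<open>p < 2\<close>.\<close>

definition riesz_kernel :: "real \<Rightarrow> real \<Rightarrow> real" where
  "riesz_kernel p t = (if p = 2 then ln t else t powr (2 - p) / (2 - p))"

lemma riesz_kernel_strict_mono:
  assumes "0 \<le> s" "s < t" "s = 0 \<Longrightarrow> p < 2"
  shows "riesz_kernel p s < riesz_kernel p t"
proof (cases "p = 2")
  case True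
  then have "0 < s" using assms by (cases "s = 0") auto
  then show ?thesis using assms True by (simp add: riesz_kernel_def)
next
  case False
  show ?thesis
  proof (cases "p < 2")
    case True
    then have "s powr (2 - p) < t powr (2 - p)" using assms by (intro powr_less_mono2) auto
    then show ?thesis using True by (simp add: riesz_kernel_def divide_strict_right_mono)
  next
    case p: False
    then have "0 < s" using assms by (cases "s = 0") auto
    then have "t powr (2 - p) < s powr (2 - p)" using False p assms by (intro powr_less_mono2_neg) auto
    then show ?thesis using False p by (simp add: riesz_kernel_def divide_strict_right_mono_neg)
  qed
qed

lemma riesz_kernel_norm:
  fixes x :: "'a::real_inner"
  assumes "x \<noteq> 0 \<or> p < 2"
  shows "riesz_kernel p (norm x) = (if p = 2 then ln (x \<bullet> x) / 2 else (x \<bullet> x) powr (1 - p/2) / (2 - p))"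
proof (cases "x = 0")
  case True then show ?thesis using assms by (simp add: riesz_kernel_def)
next
  case False
  then have "x \<bullet> x = norm x powr 2" by (simp add: power2_norm_eq_inner powr_realpow)
  moreover have "2 * (1 - p / 2) = 2 - p" by simp
  ultimately show ?thesis using False
    by (simp only: riesz_kernel_def powr_powr ln_powr) (simp add: ln_powr del: powr_numeral)
qed

lemma continuous_on_riesz_kernel:
  assumes "\<And>x. x \<in> S \<Longrightarrow> 0 < x \<or> 0 \<le> x \<and> p < 2"
  shows "continuous_on S (riesz_kernel p)"
proof (cases "p < 2")
  case True
  have "continuous_on S (\<lambda>t. t powr (2 - p))"
    by (rule continuous_on_powr') (use assms True in \<open>force intro!: continuous_intros\<close>)+
  then show ?thesis using True unfolding riesz_kernel_def by (auto intro!: continuous_intros)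
next
  case False
  then have ne: "\<forall>x\<in>S. x \<noteq> 0" using assms by force
  have "continuous_on S ln" "continuous_on S (\<lambda>t. t powr (2 - p) / (2 - p))" if "p \<noteq> 2"
    using ne that by (intro continuous_intros; simp)+
  moreover have "continuous_on S ln" using ne by (intro continuous_intros) simp
  ultimately show ?thesis unfolding riesz_kernel_def[abs_def] by (cases "p = 2") simp_all
qed

text \<open>A maximum of the difference between \<open>u\<close> and the barrier at which \<open>u\<close> is larger lies in the open
annulus. A translate of the barrier then touches \<open>u\<close> from above there, although its Hessian is not in
\<open>F\<close>. The term \<open>\<epsilon> (R\<^sup>2 - \<bar>x - x0\<bar>\<^sup>2)\<close> provides the multiple of the identity that makes the barrier
strict, and it is nonnegative on the annulus.\<close>

lemma annulus_comparison_strict: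
  fixes F :: "(real^'n^'n) set"
  assumes sub: "subequation F" and cone: "cone F" and ST: "ST_invariant F"
    and e: "norm e = 1" and p: "riesz_characteristic F e = ereal p"
    and u: "subharmonic_on F X u" and X: "cball x0 R \<subseteq> X"
    and s: "0 \<le> s" "s < R" "s = 0 \<Longrightarrow> p < 2"
    and inner: "\<And>x. dist x0 x = s \<Longrightarrow> u x \<le> ereal a"
    and outer: "\<And>x. dist x0 x = R \<Longrightarrow> u x \<le> ereal (a + m * (riesz_kernel p R - riesz_kernel p s))"
    and m: "m > 0" and eps: "\<epsilon> > 0"
    and x: "s \<le> dist x0 x" "dist x0 x \<le> R"
  shows "u x \<le> ereal (a + m * (riesz_kernel p (dist x0 x) - riesz_kernel p s) + \<epsilon> * (R^2 - (dist x0 x)^2))"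
proof -
  define \<psi> where "\<psi> y = a + m * (riesz_kernel p (dist x0 y) - riesz_kernel p s) + \<epsilon> * (R^2 - (dist x0 y)^2)" for y
  define S where "S = {y. s \<le> dist x0 y \<and> dist x0 y \<le> R}"
  have S: "S = cball x0 R - ball x0 s" by (auto simp: S_def)
  have "compact S" unfolding S by (intro compact_diff) auto
  have SX: "S \<subseteq> X" using X S by blast
  have fin: "u y < \<infinity>" if "y \<in> X" for y using u that by (simp add: subharmonic_on_def)
  have "continuous_on S \<psi>" unfolding \<psi>_def
    by (intro continuous_intros continuous_on_compose2[OF continuous_on_riesz_kernel[of "{s..}" p]])
       (use s in \<open>force simp: S_def\<close>)+
  then have usc: "upper_semicontinuous_on S (\<lambda>y. u y + ereal (- \<psi> y))"
    using fin SX u by (intro usc_add_continuous usc_subset[of X u S] continuous_intros)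
       (auto simp: subharmonic_on_def)
  have "x \<in> S" using x by (simp add: S_def)
  then obtain z where z: "z \<in> S" "\<And>y. y \<in> S \<Longrightarrow> u y + ereal (- \<psi> y) \<le> u z + ereal (- \<psi> z)"
    using usc_attains_max[OF \<open>compact S\<close> _ usc] by blast
  have "u z \<le> ereal (\<psi> z)"
  proof (rule ccontr)
    assume "\<not> u z \<le> ereal (\<psi> z)"
    then obtain w where w: "u z = ereal w" "w > \<psi> z" using fin z(1) SX by (cases "u z") auto
    have "dist x0 z \<noteq> s"
    proof
      assume "dist x0 z = s"
      then have "w \<le> a" "\<psi> z = a + \<epsilon> * (R^2 - s^2)" using inner[of z] w by (auto simp: \<psi>_def)
      moreover have "s^2 \<le> R^2" using s by (intro power_mono) auto
      ultimately show False using w eps by (smt (verit) mult_nonneg_nonneg)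
    qed
    moreover have "dist x0 z \<noteq> R"
    proof
      assume "dist x0 z = R"
      then show False using outer[of z] w by (auto simp: \<psi>_def)
    qed
    ultimately have zs: "s < dist x0 z" "dist x0 z < R" using z(1) by (auto simp: S_def)
    \<comment> \<open>The Riesz kernel as a function of the squared distance.\<close>
    define h where "h r = (if p = 2 then ln r / 2 else r powr (1 - p/2) / (2 - p))" for r
    define k where "k r = m * h r - \<epsilon> * r + (a - m * riesz_kernel p s + \<epsilon> * R^2 + (w - \<psi> z))" for r
    define k1 where "k1 r = m * r powr (-p/2) / 2 - \<epsilon>" for r :: real
    define k2 where "k2 r = - m * (p/4) * r powr (-p/2 - 1)" for r :: real
    define D where "D = {y. s < dist x0 y \<and> dist x0 y < R}"
    have "D = ball x0 R - cball x0 s" by (auto simp: D_def)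
    then have "open D" by auto
    have dist: "dist x0 y = norm (y - x0)" for y by (simp add: dist_norm norm_minus_commute)
    have k: "k ((y - x0) \<bullet> (y - x0)) = \<psi> y + (w - \<psi> z)" if "y \<in> D" for y
    proof -
      have "y \<noteq> x0" using that s by (auto simp: D_def)
      then have "riesz_kernel p (dist x0 y) = h ((y - x0) \<bullet> (y - x0))"
        using riesz_kernel_norm[of "y - x0" p] by (simp add: h_def dist)
      then show ?thesis by (simp add: k_def \<psi>_def dist power2_norm_eq_inner algebra_simps)
    qed
    have dh: "(h has_real_derivative r powr (-p/2) / 2) (at r)" if "r > 0" for r
    proof (cases "p = 2")
      case True
      then show ?thesis using that unfolding h_def
        by (auto intro!: derivative_eq_intros simp: powr_minus powr_one divide_simps)
    next
      case False
      then show ?thesis using that unfolding h_def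
        by (auto intro!: derivative_eq_intros simp: divide_simps)
    qed
    have "C2_on D (\<lambda>y. k ((y - x0) \<bullet> (y - x0)))
           (\<lambda>y. (2 * k1 ((y - x0) \<bullet> (y - x0))) *\<^sub>R (y - x0))
           (\<lambda>y. (2 * k1 ((y - x0) \<bullet> (y - x0))) *\<^sub>R mat 1
                 + (4 * k2 ((y - x0) \<bullet> (y - x0))) *\<^sub>R proj_line (y - x0))"
    proof (rule C2_on_radial[where T="{0<..}"])
      fix r :: real assume "r \<in> {0<..}"
      then have r: "r > 0" by simp
      show "(k has_real_derivative k1 r) (at r)" unfolding k_def k1_def
        using dh[OF r] by (auto intro!: derivative_eq_intros)
      show "(k1 has_real_derivative k2 r) (at r)" unfolding k1_def k2_def using r
        by (auto intro!: derivative_eq_intros)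
    next
      show "continuous_on {0<..} k2" unfolding k2_def by (auto intro!: continuous_intros)
      fix y assume "y \<in> D"
      then show "(y - x0) \<bullet> (y - x0) \<in> {0<..}" using s by (auto simp: D_def)
    qed
    moreover have "u y \<le> ereal (k ((y - x0) \<bullet> (y - x0)))" if "y \<in> D" for y
      using z(2)[of y] that w(1) unfolding k[OF that] by (cases "u y") (auto simp: S_def D_def)
    moreover have "z \<in> D" using zs by (simp add: D_def)
    moreover have "u z = ereal (k ((z - x0) \<bullet> (z - x0)))" using k[OF \<open>z \<in> D\<close>] w by simp
    moreover have "D \<subseteq> X" using SX by (auto simp: S_def D_def)
    ultimately have HF: "(2 * k1 ((z - x0) \<bullet> (z - x0))) *\<^sub>R mat 1
                 + (4 * k2 ((z - x0) \<bullet> (z - x0))) *\<^sub>R proj_line (z - x0) \<in> F"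
      using u \<open>open D\<close> unfolding subharmonic_on_def by blast
    define y where "y = z - x0"
    have y0: "y \<noteq> 0" using zs s by (auto simp: y_def)
    define c where "c = m * (y \<bullet> y) powr (-p/2)"
    have "(y \<bullet> y) powr (-p/2 - 1) = (y \<bullet> y) powr (-p/2) / (y \<bullet> y)"
      using y0 by (simp add: powr_diff)
    then have "(2 * k1 (y \<bullet> y)) *\<^sub>R mat 1 + (4 * k2 (y \<bullet> y)) *\<^sub>R proj_line y
       = c *\<^sub>R (mat 1 - (p / (y \<bullet> y)) *\<^sub>R proj_line y) - (2 * \<epsilon>) *\<^sub>R mat 1"
      by (simp add: k1_def k2_def c_def algebra_simps)
    moreover have "c > 0" using m y0 by (simp add: c_def)
    ultimately show False
      using riesz_kernel_hessian_strict[OF sub cone ST e p y0 _ , of c "2 * \<epsilon>"] eps HF by (simp add: y_def)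
  qed
  then have "u z + ereal (- \<psi> z) \<le> 0" by (cases "u z") auto
  then have "u x + ereal (- \<psi> x) \<le> 0" using z(2)[OF \<open>x \<in> S\<close>] by (rule order_trans[rotated])
  then show ?thesis unfolding \<psi>_def by (cases "u x") auto
qed

text \<open>The radius \<open>s = 0\<close> is allowed for \<open>p < 2\<close>; the inner sphere is then the centre itself.\<close>

lemma annulus_comparison:
  fixes F :: "(real^'n^'n) set"
  assumes sub: "subequation F" and cone: "cone F" and ST: "ST_invariant F"
    and e: "norm e = 1" and p: "riesz_characteristic F e = ereal p"
    and u: "subharmonic_on F X u" and X: "cball x0 R \<subseteq> X"
    and s: "0 \<le> s" "s < R" "s = 0 \<Longrightarrow> p < 2"
    and inner: "\<And>x. dist x0 x = s \<Longrightarrow> u x \<le> ereal a"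
    and outer: "\<And>x. dist x0 x = R \<Longrightarrow> u x \<le> ereal b" and ab: "a \<le> b"
    and x: "s \<le> dist x0 x" "dist x0 x \<le> R"
  shows "u x \<le> ereal (a + (b - a) * ((riesz_kernel p (dist x0 x) - riesz_kernel p s)
                                / (riesz_kernel p R - riesz_kernel p s)))"
proof -
  define K where "K = riesz_kernel p"
  have KR: "K R - K s > 0" using riesz_kernel_strict_mono[of s R p] s by (simp add: K_def)
  define m where "m = (b - a) / (K R - K s)"
  have m: "m \<ge> 0" using ab KR by (simp add: m_def)
  define C where "C = (K (dist x0 x) - K s) + (R^2 - (dist x0 x)^2)"
  have main: "u x \<le> ereal (a + m * (K (dist x0 x) - K s) + \<epsilon> * C)" if eps: "\<epsilon> > 0" for \<epsilon>
  proof -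
    have "u y \<le> ereal (a + (m + \<epsilon>) * (K R - K s))" if "dist x0 y = R" for y
    proof (rule order_trans[OF outer[OF that]])
      have "b = a + m * (K R - K s)" using KR by (simp add: m_def)
      also have "\<dots> \<le> a + (m + \<epsilon>) * (K R - K s)" using eps KR by simp
      finally show "ereal b \<le> ereal (a + (m + \<epsilon>) * (K R - K s))" by simp
    qed
    then have "u x \<le> ereal (a + (m + \<epsilon>) * (K (dist x0 x) - K s) + \<epsilon> * (R^2 - (dist x0 x)^2))"
      unfolding K_def
      by (intro annulus_comparison_strict[OF sub cone ST e p u X s inner _ _ eps x]) (use m eps in auto)
    then show ?thesis by (simp add: C_def algebra_simps)
  qed
  have "u x \<le> ereal (a + m * (K (dist x0 x) - K s))"
  proof (cases "u x")
    case (real w)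
    have "w \<le> a + m * (K (dist x0 x) - K s) + d" if "d > 0" for d
    proof -
      define \<epsilon> where "\<epsilon> = d / (1 + \<bar>C\<bar>)"
      have "\<epsilon> > 0" using that by (simp add: \<epsilon>_def)
      have "\<epsilon> * C \<le> \<epsilon> * (1 + \<bar>C\<bar>)" using \<open>\<epsilon> > 0\<close> by (intro mult_left_mono) auto
      also have "\<dots> = d" by (simp add: \<epsilon>_def)
      finally show ?thesis using main[OF \<open>\<epsilon> > 0\<close>] real by simp
    qed
    then show ?thesis using real field_le_epsilon by auto
  qed (use main[of 1] in auto)
  then show ?thesis by (simp add: m_def K_def)
qed

section \<open>Growth of a subharmonic function near a point\<close>

lemma usc_bounded_above:
  assumes u: "upper_semicontinuous_on X u" "\<And>x. x \<in> X \<Longrightarrow> u x < \<infinity>" and S: "compact S" "S \<subseteq> X"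
  obtains b where "b \<ge> b0" "\<And>x. x \<in> S \<Longrightarrow> u x \<le> ereal b"
proof (cases "S = {}")
  case False
  obtain z where z: "z \<in> S" "\<forall>y\<in>S. u y \<le> u z"
    using usc_attains_max[OF S(1) False usc_subset[OF u(1) S(2)]] by blast
  have "u z < \<infinity>" using u(2) z(1) S(2) by auto
  then obtain b where "u z \<le> ereal b" by (cases "u z") auto
  then show ?thesis using z(2) that[of "max b b0"] by (meson ereal_less_eq(3) max.cobounded1 max.cobounded2 order_trans)
qed (use that in auto)

text \<open>The data of one subharmonic function to which the comparison is applied repeatedly.\<close>

locale riesz_subharmonic =
  fixes F :: "(real^'n^'n) set" and e :: "real^'n" and p :: real
    and X :: "(real^'n) set" and u :: "real^'n \<Rightarrow> ereal"
  assumes sub: "subequation F" and cone: "cone F" and ST: "ST_invariant F"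
    and e: "norm e = 1" and p: "riesz_characteristic F e = ereal p"
    and openX: "open X" and u: "subharmonic_on F X u"
begin

lemma usc: "upper_semicontinuous_on X u"
  and lt_infty: "x \<in> X \<Longrightarrow> u x < \<infinity>"
  using u by (auto simp: subharmonic_on_def)

text \<open>The bound on the inner sphere may be taken to be any number \<open>a\<close>, and in the conclusion of the
comparison \<open>a\<close> has a positive coefficient strictly inside the outer sphere. Let \<open>a\<close> tend to \<open>-\<infinity>\<close>.\<close>

lemma minus_infinity_spreads:
  assumes X: "cball x0 R \<subseteq> X" and s: "0 \<le> s" "s < R" "s = 0 \<Longrightarrow> p < 2"
    and inf: "\<And>x. dist x0 x \<le> s \<Longrightarrow> u x = -\<infinity>" and x: "dist x0 x < R"
  shows "u x = -\<infinity>"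
proof (cases "dist x0 x \<le> s")
  case False
  obtain b where b: "b \<ge> 0" "\<And>x. x \<in> cball x0 R \<Longrightarrow> u x \<le> ereal b"
    using usc_bounded_above[OF usc lt_infty compact_cball X] by blast
  define l where "l = (riesz_kernel p (dist x0 x) - riesz_kernel p s) / (riesz_kernel p R - riesz_kernel p s)"
  have "riesz_kernel p s < riesz_kernel p (dist x0 x)" "riesz_kernel p (dist x0 x) < riesz_kernel p R"
    using riesz_kernel_strict_mono False x s by auto
  then have l: "l < 1" by (simp add: l_def)
  have le: "u x \<le> ereal (b - t * (1 - l))" if "t \<ge> 0" for t
  proof -
    have "u x \<le> ereal ((b - t) + (b - (b - t)) * l)" unfolding l_def
      using False x that
      by (intro annulus_comparison[OF sub cone ST e p u X s]) (auto simp: inf b(2))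
    then show ?thesis by (simp add: algebra_simps)
  qed
  show ?thesis
  proof (rule ccontr)
    assume "u x \<noteq> -\<infinity>"
    then obtain w where w: "u x = ereal w" using lt_infty[of x] X x by (cases "u x") (auto simp: subset_iff)
    define t where "t = (\<bar>b - w\<bar> + 1) / (1 - l)"
    have "t \<ge> 0" "t * (1 - l) = \<bar>b - w\<bar> + 1" using l by (auto simp: t_def)
    then show False using le[of t] w by simp
  qed
qed (use inf in auto)

text \<open>The interior \<open>Z\<close> of \<open>{u = -\<infinity>}\<close> is relatively closed in \<open>X\<close>, since a ball around a point of \<open>Z\<close>
close to a limit point reaches the limit point. A nonempty \<open>Z\<close> would therefore contain a component.\<close>

lemma not_locally_minus_infinity:
  assumes x: "x \<in> X" and s: "s > 0"
  shows "\<exists>y\<in>ball x s. u y \<noteq> -\<infinity>"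
proof (rule ccontr)
  assume no: "\<not> ?thesis"
  define Z where "Z = interior {y\<in>X. u y = -\<infinity>}"
  define C where "C = connected_component_set X x"
  have C: "C \<in> components X" "connected C" "open C" "C \<subseteq> X" "x \<in> C"
    using x openX by (auto simp: C_def components_def open_connected_component connected_component_subset
        connected_connected_component connected_component_refl)
  have "x \<in> Z"
  proof -
    have "open (ball x s \<inter> X)" using openX by auto
    moreover have "ball x s \<inter> X \<subseteq> {y\<in>X. u y = -\<infinity>}" using no by auto
    ultimately have "ball x s \<inter> X \<subseteq> Z" unfolding Z_def by (intro interior_maximal)
    then show ?thesis using x s by auto
  qed
  have clos: "y \<in> Z" if y: "y \<in> X" "y \<in> closure Z" for y
  proof -
    obtain R where R: "R > 0" "cball y (2 * R) \<subseteq> X"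
    proof -
      obtain r where "r > 0" "cball y r \<subseteq> X" using open_contains_cball openX y(1) by metis
      then show ?thesis using that[of "r/2"] by simp
    qed
    obtain z where z: "z \<in> Z" "dist z y < R" using y(2) R(1) closure_approachable by blast
    obtain q where q: "q > 0" "ball z q \<subseteq> Z" using z(1) open_interior open_contains_ball unfolding Z_def by blast
    \<comment> \<open>A closed ball on which to start, smaller than the ball to be reached.\<close>
    define q' where "q' = min (q/2) (R/2)"
    have q': "0 < q'" "q' < q" "q' < R" using q R by (auto simp: q'_def)
    have Z: "u w = -\<infinity>" if "dist z w \<le> q'" for w
    proof -
      have "w \<in> Z" using that q' q(2) by auto
      then show ?thesis using interior_subset unfolding Z_def by blast
    qed
    have "cball z R \<subseteq> cball y (2*R)"
      using z(2) by (simp add: cball_subset_cball_iff)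
    then have zX: "cball z R \<subseteq> X" using R by blast
    have "u w = -\<infinity>" if "w \<in> ball z R" for w
      using minus_infinity_spreads[OF zX _ q'(3) _ Z] q' that by auto
    then have "ball z R \<subseteq> {y\<in>X. u y = -\<infinity>}" using zX by (auto simp: subset_iff)
    then have "ball z R \<subseteq> Z" unfolding Z_def by (intro interior_maximal) auto
    then show ?thesis using z(2) by auto
  qed
  have "open Z" by (simp add: Z_def)
  have "C \<subseteq> Z"
  proof (rule ccontr)
    assume "\<not> C \<subseteq> Z"
    then have "\<exists>y. y \<in> C \<and> y \<in> - closure Z" using clos C(4) by blast
    moreover have "C \<subseteq> Z \<union> - closure Z" using clos C(4) by blast
    moreover have "Z \<inter> (- closure Z) \<inter> C = {}" using closure_subset by blast
    ultimately show False
      using connectedD[OF C(2) \<open>open Z\<close>, of "- closure Z"] \<open>x \<in> Z\<close> C(5) by blast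
  qed
  moreover obtain y where "y \<in> C" "u y \<noteq> -\<infinity>" using u C(1) unfolding subharmonic_on_def by blast
  ultimately show False using interior_subset unfolding Z_def by blast
qed

lemma finite_of_lt_2:
  assumes "p < 2" "x \<in> X"
  shows "\<bar>u x\<bar> \<noteq> \<infinity>"
proof
  assume "\<bar>u x\<bar> = \<infinity>"
  then have inf: "u x = -\<infinity>" using lt_infty[OF assms(2)] by (cases "u x") auto
  obtain R where R: "R > 0" "cball x R \<subseteq> X" using open_contains_cball openX assms(2) by metis
  have "u y = -\<infinity>" if "y \<in> ball x R" for y
    using minus_infinity_spreads[OF R(2), of 0] R assms(1) inf that by auto
  then show False using not_locally_minus_infinity[OF assms(2) R(1)] by blast
qed

text \<open>With a point as inner sphere the comparison reads
\<open>u x \<le> u y + (b - u y) * (\<bar>x - y\<bar> / R) powr (2 - p)\<close> whenever \<open>u \<le> b\<close> on the ball of radius \<open>R\<close>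
around \<open>y\<close>. For \<open>x = 0\<close> this bounds \<open>u y\<close> from below for all \<open>y\<close> near \<open>0\<close>, and so it bounds the
coefficient \<open>b - u y\<close> uniformly.\<close>

lemma holder_of_lt_2:
  assumes p2: "p < 2" and X0: "0 \<in> X"
  obtains \<rho> C where "\<rho> > 0" "C \<ge> 0" "cball 0 \<rho> \<subseteq> X"
    "\<And>x y. x \<in> cball 0 \<rho> \<Longrightarrow> y \<in> cball 0 \<rho> \<Longrightarrow>
       \<bar>real_of_ereal (u x) - real_of_ereal (u y)\<bar> \<le> C * dist x y powr (2 - p)"
proof -
  define U where "U x = real_of_ereal (u x)" for x
  have uU: "u x = ereal (U x)" if "x \<in> X" for x
    using finite_of_lt_2[OF p2 that] by (simp add: U_def ereal_real)
  obtain r where r: "r > 0" "cball 0 r \<subseteq> X" using open_contains_cball openX X0 by metis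
  define \<rho> where "\<rho> = r / 3"
  have \<rho>: "\<rho> > 0" "cball 0 (3 * \<rho>) \<subseteq> X" using r by (auto simp: \<rho>_def)
  obtain b where b: "b \<ge> 0" "\<And>x. x \<in> cball 0 (3 * \<rho>) \<Longrightarrow> u x \<le> ereal b"
    using usc_bounded_above[OF usc lt_infty compact_cball \<rho>(2)] by blast
  have est: "U x \<le> U y + (b - U y) * (dist y x / (2 * \<rho>)) powr (2 - p)"
    if y: "y \<in> cball 0 \<rho>" and x: "dist y x \<le> 2 * \<rho>" for x y
  proof -
    have sub3: "cball y (2 * \<rho>) \<subseteq> cball 0 (3 * \<rho>)" using y by (simp add: cball_subset_cball_iff)
    then have X: "cball y (2 * \<rho>) \<subseteq> X" using \<rho> by blast
    have b': "u z \<le> ereal b" if "dist y z \<le> 2 * \<rho>" for z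
      using b(2)[of z] sub3 that by (simp add: subset_iff)
    have yX: "y \<in> X" "x \<in> X" using X x \<rho>(1) by (auto simp: subset_iff)
    have "U y \<le> b" using b'[of y] uU[OF yX(1)] \<rho>(1) by simp
    then have "u x \<le> ereal (U y + (b - U y) * ((riesz_kernel p (dist y x) - riesz_kernel p 0)
                                / (riesz_kernel p (2 * \<rho>) - riesz_kernel p 0)))"
      using x b' \<rho>(1) p2 uU[OF yX(1)]
      by (intro annulus_comparison[OF sub cone ST e p u X]) auto
    moreover have "(riesz_kernel p (dist y x) - riesz_kernel p 0)
                                / (riesz_kernel p (2 * \<rho>) - riesz_kernel p 0) = (dist y x / (2 * \<rho>)) powr (2 - p)"
      using p2 \<rho>(1) by (simp add: riesz_kernel_def powr_divide)
    ultimately show ?thesis using uU[OF yX(2)] by simp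
  qed
  \<comment> \<open>The origin is at distance at most \<open>\<rho>\<close>, half the radius of comparison, from \<open>y\<close>.\<close>
  define q where "q = (1/2) powr (2 - p)"
  have q: "q < 1" using p2 powr_less_mono2[of "2 - p" "1/2" 1] by (simp add: q_def)
  define B where "B = (b - U 0) / (1 - q)"
  have U0b: "U 0 \<le> b" using b(2)[of 0] uU[OF X0] \<rho>(1) by simp
  have low: "b - U y \<le> B" if y: "y \<in> cball 0 \<rho>" for y
  proof -
    have yb: "U y \<le> b"
    proof -
      have "y \<in> cball 0 (3 * \<rho>)" using y \<rho>(1) by simp
      then show ?thesis using b(2)[of y] uU[of y] \<rho>(2) by auto
    qed
    have "(dist y 0 / (2 * \<rho>)) powr (2 - p) \<le> q" unfolding q_def
      using y \<rho>(1) p2 by (intro powr_mono2) (auto simp: divide_simps)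
    then have "(b - U y) * (dist y 0 / (2 * \<rho>)) powr (2 - p) \<le> (b - U y) * q"
      using yb by (intro mult_left_mono) auto
    then have "U 0 \<le> U y + (b - U y) * q" using est[OF y, of 0] y \<rho>(1) by simp
    then have "(b - U y) * (1 - q) \<le> b - U 0" by (simp add: algebra_simps)
    then show ?thesis using q by (simp add: B_def pos_le_divide_eq)
  qed
  define C where "C = B / (2 * \<rho>) powr (2 - p)"
  have one: "U x - U y \<le> C * dist x y powr (2 - p)" if x: "x \<in> cball 0 \<rho>" and y: "y \<in> cball 0 \<rho>" for x y
  proof -
    have "dist y x \<le> 2 * \<rho>" using dist_triangle[of y x 0] x y by (simp add: dist_commute)
    then have "U x - U y \<le> (b - U y) * (dist y x / (2 * \<rho>)) powr (2 - p)" using est[OF y, of x] by linarith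
    also have "\<dots> \<le> B * (dist y x / (2 * \<rho>)) powr (2 - p)" by (intro mult_right_mono low[OF y]) simp
    also have "\<dots> = C * dist x y powr (2 - p)" using \<rho>(1) by (simp add: C_def powr_divide dist_commute)
    finally show ?thesis .
  qed
  show ?thesis
  proof (rule that[of \<rho> C])
    show "C \<ge> 0" using U0b q by (simp add: C_def B_def)
    show "cball 0 \<rho> \<subseteq> X" using \<rho> by (auto simp: subset_iff)
    show "\<bar>real_of_ereal (u x) - real_of_ereal (u y)\<bar> \<le> C * dist x y powr (2 - p)"
      if "x \<in> cball 0 \<rho>" "y \<in> cball 0 \<rho>" for x y
      using one[OF that] one[OF that(2,1)] by (simp add: U_def abs_le_iff dist_commute)
  qed (rule \<rho>(1))
qed

definition max_on_cball :: "real \<Rightarrow> real" where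
  "max_on_cball s = real_of_ereal (SUP y\<in>cball 0 s. u y)"

lemma max_on_cball:
  assumes s: "s > 0" "cball 0 s \<subseteq> X"
  shows SUP_eq_max_on_cball: "(SUP y\<in>cball 0 s. u y) = ereal (max_on_cball s)"
    and le_max_on_cball: "\<And>y. y \<in> cball 0 s \<Longrightarrow> u y \<le> ereal (max_on_cball s)"
    and max_on_cball_attained: "\<exists>y\<in>cball 0 s. u y = ereal (max_on_cball s)"
proof -
  obtain z where z: "z \<in> cball 0 s" "\<forall>y\<in>cball 0 s. u y \<le> u z"
    using usc_attains_max[OF compact_cball _ usc_subset[OF usc s(2)]] s(1) by auto
  have eq: "(SUP y\<in>cball 0 s. u y) = u z"
    using z by (intro antisym SUP_least SUP_upper) auto
  have "0 \<in> X" using s by (auto simp: subset_iff)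
  then obtain y where y: "y \<in> ball 0 s" "u y \<noteq> -\<infinity>" using not_locally_minus_infinity s(1) by blast
  then have "u y \<le> u z" using z(2) by auto
  then have "u z \<noteq> -\<infinity>" using y(2) by auto
  moreover have "u z \<noteq> \<infinity>" using lt_infty[of z] z(1) s(2) by auto
  ultimately have uz: "u z = ereal (max_on_cball s)" by (cases "u z") (simp_all add: max_on_cball_def eq)
  then show "(SUP y\<in>cball 0 s. u y) = ereal (max_on_cball s)" using eq by simp
  show "\<And>y. y \<in> cball 0 s \<Longrightarrow> u y \<le> ereal (max_on_cball s)" using z(2) uz by auto
  show "\<exists>y\<in>cball 0 s. u y = ereal (max_on_cball s)" using z(1) uz by auto
qed

lemma max_on_cball_mono:
  assumes "0 < s" "s \<le> t" "cball 0 t \<subseteq> X"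
  shows "max_on_cball s \<le> max_on_cball t"
proof -
  have "cball 0 s \<subseteq> X" using assms by (auto simp: subset_iff)
  then obtain y where y: "y \<in> cball 0 s" "u y = ereal (max_on_cball s)"
    using max_on_cball_attained[OF assms(1)] by blast
  then have "y \<in> cball 0 t" using assms by auto
  then show ?thesis using le_max_on_cball[of t y] y assms by simp
qed

text \<open>The maximum over balls is a convex function of the Riesz kernel of the radius, stated as monotonicity
of the slopes towards \<open>R\<close>. Balls replace spheres, so that the maximum is increasing by definition and
the comparison applies with \<open>a \<le> b\<close>.\<close>

lemma max_on_cball_convex:
  assumes s: "0 < s" "s < t" "t < R" and X: "cball 0 R \<subseteq> X"
  shows "(max_on_cball R - max_on_cball s) * (riesz_kernel p R - riesz_kernel p t)
       \<le> (max_on_cball R - max_on_cball t) * (riesz_kernel p R - riesz_kernel p s)"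
proof -
  let ?M = max_on_cball and ?K = "riesz_kernel p"
  have Xs: "cball 0 s \<subseteq> X" "cball 0 t \<subseteq> X" using s X by (auto simp: subset_iff)
  have K: "?K s < ?K t" "?K t < ?K R" using riesz_kernel_strict_mono s by auto
  have sR: "?M s \<le> ?M R" using max_on_cball_mono[of s R] s X by simp
  obtain y where y: "y \<in> cball 0 t" "u y = ereal (?M t)"
    using max_on_cball_attained[of t] s Xs by auto
  have main: "?M t \<le> ?M s + (?M R - ?M s) * ((?K t - ?K s) / (?K R - ?K s))"
  proof (cases "norm y \<le> s")
    case True
    then have "?M t \<le> ?M s" using le_max_on_cball[of s y] s Xs y by simp
    moreover have "0 \<le> (?M R - ?M s) * ((?K t - ?K s) / (?K R - ?K s))" using sR K by auto
    ultimately show ?thesis by simp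
  next
    case False
    have "u y \<le> ereal (?M s + (?M R - ?M s) * ((?K (dist 0 y) - ?K s) / (?K R - ?K s)))"
      using False y s sR Xs X by (intro annulus_comparison[OF sub cone ST e p u X] le_max_on_cball) auto
    then have "?M t \<le> ?M s + (?M R - ?M s) * ((?K (norm y) - ?K s) / (?K R - ?K s))" using y by simp
    also have "\<dots> \<le> ?M s + (?M R - ?M s) * ((?K t - ?K s) / (?K R - ?K s))"
    proof -
      have "?K (norm y) \<le> ?K t"
        using riesz_kernel_strict_mono[of "norm y" t p] y(1) False s by (cases "norm y = t") force+
      then show ?thesis using sR K by (intro add_left_mono mult_left_mono divide_right_mono) auto
    qed
    finally show ?thesis .
  qed
  have "(?M R - ?M s) * (?K R - ?K t) = (?M R - (?M s + (?M R - ?M s) * ((?K t - ?K s) / (?K R - ?K s)))) * (?K R - ?K s)"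
    using K by (simp add: field_simps)
  also have "\<dots> \<le> (?M R - ?M t) * (?K R - ?K s)" using main K by (intro mult_right_mono) auto
  finally show ?thesis .
qed

text \<open>Slopes of a convex function increase, so all slopes at small radii are bounded by the slope \<open>D\<close>
between the radii \<open>R / 2\<close> and \<open>R\<close>.\<close>

lemma max_on_cball_growth:
  assumes R: "R > 0" "cball 0 R \<subseteq> X"
  obtains D where "D \<ge> 0"
    "\<And>s. 0 < s \<Longrightarrow> s < R / 2 \<Longrightarrow> max_on_cball R - max_on_cball s \<le> D * (riesz_kernel p R - riesz_kernel p s)"
    "\<And>s t. 0 < s \<Longrightarrow> s < R / 2 \<Longrightarrow> s < t \<Longrightarrow> t < R \<Longrightarrow>
        max_on_cball t - max_on_cball s \<le> D * (riesz_kernel p t - riesz_kernel p s)"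
proof -
  let ?M = max_on_cball and ?K = "riesz_kernel p"
  define D where "D = (?M R - ?M (R/2)) / (?K R - ?K (R/2))"
  have K2: "?K (R/2) < ?K R" using riesz_kernel_strict_mono[of "R/2" R p] R by simp
  have D: "D \<ge> 0" using K2 max_on_cball_mono[of "R/2" R] R by (simp add: D_def)
  have one: "?M R - ?M s \<le> D * (?K R - ?K s)" if s: "0 < s" "s < R/2" for s
    using max_on_cball_convex[OF s _ R(2)] K2 R(1) by (simp add: D_def field_simps)
  show ?thesis
  proof (rule that[OF D one])
    fix s t assume s: "0 < s" "s < R/2" "s < t" "t < R"
    have K: "?K s < ?K t" "?K t < ?K R" using riesz_kernel_strict_mono s by auto
    have "(?M t - ?M s) * (?K R - ?K s) \<le> (?M R - ?M s) * (?K t - ?K s)"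
      using max_on_cball_convex[OF s(1,3,4) R(2)] by (simp add: algebra_simps)
    also have "\<dots> \<le> (D * (?K R - ?K s)) * (?K t - ?K s)"
      using one[OF s(1,2)] K by (intro mult_right_mono) auto
    finally have "(?M t - ?M s) * (?K R - ?K s) \<le> (D * (?K t - ?K s)) * (?K R - ?K s)"
      by (simp add: mult_ac)
    then show "?M t - ?M s \<le> D * (?K t - ?K s)" using K by (simp add: mult_right_le_imp_le)
  qed
qed

end

section \<open>Equicontinuous families\<close>

text \<open>A subsequence that converges on a countable dense set, for all indices \<open>i\<close> at once, converges
uniformly on compact sets by equicontinuity. The modulus of continuity may depend on the index, so
that smoothings at different scales can share one subsequence.\<close>

lemma diagonal_uniform_subsequence:
  fixes f :: "nat \<Rightarrow> 'i::countable \<Rightarrow> 'a::euclidean_space \<Rightarrow> real"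
  assumes equi: "\<And>i \<epsilon>. \<epsilon> > 0 \<Longrightarrow> \<exists>d>0. \<forall>j x y. dist x y < d \<longrightarrow> \<bar>f j i x - f j i y\<bar> < \<epsilon>"
    and bdd: "\<And>i x. \<exists>B. \<forall>j. \<bar>f j i x\<bar> \<le> B"
  obtains k V where "strict_mono (k :: nat \<Rightarrow> nat)"
    "\<And>i K. compact K \<Longrightarrow> uniform_limit K (\<lambda>j. f (k j) i) (V i) sequentially"
proof -
  obtain D :: "'a set" where D: "countable D" "\<And>S. open S \<Longrightarrow> S \<noteq> {} \<Longrightarrow> \<exists>d\<in>D. d \<in> S"
    using countable_dense_setE by blast
  define B where "B i x = (SOME b. \<forall>j. \<bar>f j i x\<bar> \<le> b)" for i x
  have B: "\<bar>f j i x\<bar> \<le> B i x" for i x j using someI_ex[OF bdd[of i x]] by (auto simp: B_def)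
  \<comment> \<open>The values are normalised to be bounded uniformly in the index and the point.\<close>
  define h where "h j z = f j (fst z) (snd z) / (1 + B (fst z) (snd z))" for j z
  have Bpos: "1 + B i x > 0" for i x using B[of 0 i x] by linarith
  have "norm (h j z) \<le> 1" for j z
    using B[of j "fst z" "snd z"] Bpos[of "fst z" "snd z"] by (simp add: h_def field_simps)
  moreover have "countable ((UNIV :: 'i set) \<times> D)" using D(1) by auto
  ultimately obtain k where k: "strict_mono (k :: nat \<Rightarrow> nat)"
      "\<And>z. z \<in> UNIV \<times> D \<Longrightarrow> \<exists>l. (\<lambda>n. h (k n) z) \<longlonglongrightarrow> l"
    using function_convergent_subsequence[of "UNIV \<times> D" h 1] by blast
  have convD: "convergent (\<lambda>n. f (k n) i d)" if "d \<in> D" for i d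
  proof -
    obtain l where "(\<lambda>n. h (k n) (i, d)) \<longlonglongrightarrow> l" using k(2)[of "(i, d)"] \<open>d \<in> D\<close> by auto
    then have "(\<lambda>n. (1 + B i d) * h (k n) (i, d)) \<longlonglongrightarrow> (1 + B i d) * l" by (intro tendsto_intros)
    moreover have "(1 + B i d) * h (k n) (i, d) = f (k n) i d" for n using Bpos[of i d] by (simp add: h_def)
    ultimately show ?thesis by (auto simp: convergent_def)
  qed
  have ucauchy: "uniformly_convergent_on K (\<lambda>j. f (k j) i)" if K: "compact K" for K i
  proof -
    have "uniformly_Cauchy_on K (\<lambda>j. f (k j) i)"
    proof (rule uniformly_Cauchy_onI)
      fix \<epsilon> :: real assume eps: "\<epsilon> > 0"
      obtain d where d: "d > 0" "\<And>j x y. dist x y < d \<Longrightarrow> \<bar>f j i x - f j i y\<bar> < \<epsilon>/3"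
        using equi[of "\<epsilon>/3" i] eps by auto
      have "K \<subseteq> (\<Union>x\<in>D. ball x d)"
      proof
        fix x assume "x \<in> K"
        obtain q where "q \<in> D" "q \<in> ball x d" using D(2)[of "ball x d"] d(1) by auto
        then show "x \<in> (\<Union>x\<in>D. ball x d)" by (auto simp: dist_commute)
      qed
      then obtain E where E: "E \<subseteq> D" "finite E" "K \<subseteq> (\<Union>x\<in>E. ball x d)"
        using compactE_image[OF K, of D "\<lambda>x. ball x d"] by auto
      have "\<exists>N. \<forall>m\<ge>N. \<forall>n\<ge>N. \<bar>f (k m) i q - f (k n) i q\<bar> < \<epsilon>/3" if "q \<in> D" for q
      proof -
        have "\<epsilon>/3 > 0" using eps by simp
        then show ?thesis using convergent_Cauchy[OF convD[OF that], of i] unfolding Cauchy_def dist_real_def by blast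
      qed
      then obtain N where N: "\<And>q m n. q \<in> D \<Longrightarrow> m \<ge> N q \<Longrightarrow> n \<ge> N q \<Longrightarrow> \<bar>f (k m) i q - f (k n) i q\<bar> < \<epsilon>/3"
        by metis
      define M where "M = Max (insert 0 (N ` E))"
      have M: "N q \<le> M" if "q \<in> E" for q using that E(2) by (simp add: M_def)
      show "\<exists>M. \<forall>x\<in>K. \<forall>m\<ge>M. \<forall>n\<ge>M. dist (f (k m) i x) (f (k n) i x) < \<epsilon>"
      proof (intro exI ballI allI impI)
        fix x m n assume x: "x \<in> K" and mn: "M \<le> m" "M \<le> n"
        obtain q where q: "q \<in> E" "dist x q < d" using E(3) x by (auto simp: dist_commute)
        have "\<bar>f (k m) i q - f (k n) i q\<bar> < \<epsilon>/3" using N[of q m n] q(1) E(1) M[OF q(1)] mn by auto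
        moreover have "\<bar>f (k m) i x - f (k m) i q\<bar> < \<epsilon>/3" "\<bar>f (k n) i x - f (k n) i q\<bar> < \<epsilon>/3"
          using d(2)[OF q(2)] by auto
        ultimately show "dist (f (k m) i x) (f (k n) i x) < \<epsilon>" unfolding dist_real_def by linarith
      qed
    qed
    then show ?thesis by (simp add: Cauchy_uniformly_convergent)
  qed
  define V where "V i x = lim (\<lambda>j. f (k j) i x)" for i x
  have "uniform_limit K (\<lambda>j. f (k j) i) (V i) sequentially" if K: "compact K" for K i
    using ucauchy[OF K] unfolding uniformly_convergent_uniform_limit_iff V_def .
  then show ?thesis using that k(1) by blast
qed

section \<open>Semicontinuous representatives\<close>

lemma ennreal_tendsto_0I:
  assumes "\<And>\<epsilon>::real. \<epsilon> > 0 \<Longrightarrow> eventually (\<lambda>j. f j \<le> ennreal \<epsilon>) G"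
  shows "(f \<longlongrightarrow> 0) G"
proof (rule order_tendstoI)
  fix a :: ennreal assume "0 < a"
  then obtain b where b: "0 < b" "b < a" using dense by blast
  then obtain \<epsilon> where eps: "\<epsilon> > 0" "b = ennreal \<epsilon>" by (cases b) auto
  then show "eventually (\<lambda>j. f j < a) G" using assms[OF eps(1)] b by (auto elim: eventually_mono)
qed simp

lemma esssup_ball_eq:
  assumes "V \<in> borel_measurable lborel"
  shows "esssup (restrict_space lborel (ball x s)) (\<lambda>y. ereal (V y))
       = Inf {z. AE y in lborel. y \<in> ball x s \<longrightarrow> ereal (V y) \<le> z}"
proof -
  have "(\<lambda>y. ereal (V y)) \<in> borel_measurable (restrict_space lborel (ball x s))"
    using assms by (intro measurable_restrict_space1) simp
  then show ?thesis by (simp add: esssup_eq_AE AE_restrict_space_iff)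
qed

text \<open>The essential supremum over the ball of radius \<open>s\<close> decreases with \<open>s\<close>, so it has a limit as
\<open>s\<close> tends to \<open>0\<close>.\<close>

lemma usc_representative_exists:
  fixes V :: "'a::euclidean_space \<Rightarrow> real"
  assumes V: "V \<in> borel_measurable lborel"
  shows "\<exists>U. usc_representative V U"
proof -
  define E where "E x s = esssup (restrict_space lborel (ball x s)) (\<lambda>y. ereal (V y))" for x s
  have mono: "E x s \<le> E x t" if "s \<le> t" for x s t
  proof -
    have "(AE y in lborel. y \<in> ball x t \<longrightarrow> ereal (V y) \<le> z) \<Longrightarrow>
        (AE y in lborel. y \<in> ball x s \<longrightarrow> ereal (V y) \<le> z)" for z
      by (erule eventually_mono) (use that in auto)
    then show ?thesis unfolding E_def esssup_ball_eq[OF V] by (intro Inf_superset_mono Collect_mono impI)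
  qed
  have "((\<lambda>s. E x s) \<longlongrightarrow> (INF s\<in>{0<..}. E x s)) (at_right 0)" for x
  proof (rule order_tendstoI)
    fix a assume a: "a < (INF s\<in>{0<..}. E x s)"
    have "a < E x s" if "s > 0" for s
      using a INF_lower[of s "{0<..}" "E x"] that by (auto intro: less_le_trans)
    then show "\<forall>\<^sub>F s in at_right 0. a < E x s"
      using eventually_at_right_less[of 0] by (auto elim: eventually_mono)
  next
    fix b assume "(INF s\<in>{0<..}. E x s) < b"
    then obtain t where t: "t > 0" "E x t < b" by (auto simp: INF_less_iff)
    then have "E x s < b" if "s < t" for s using mono[of s t x] that by auto
    moreover have "\<forall>\<^sub>F s in at_right 0. s < t" using t(1) unfolding eventually_at_right_field by blast
    ultimately show "\<forall>\<^sub>F s in at_right 0. E x s < b" by (auto elim: eventually_mono)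
  qed
  then show ?thesis unfolding usc_representative_def E_def by (intro exI[of _ "\<lambda>x. INF s\<in>{0<..}. E x s"]) (simp add: E_def)
qed

text \<open>Near \<open>x\<close> all values are close to \<open>V x\<close>, and no ball is a null set, so that the essential supremum
cannot drop below these values.\<close>

lemma usc_representative_continuous:
  fixes V :: "'a::euclidean_space \<Rightarrow> real"
  assumes V: "continuous_on UNIV V"
  shows "usc_representative V (\<lambda>x. ereal (V x))"
  unfolding usc_representative_def
proof
  fix x
  have Vm: "V \<in> borel_measurable lborel" using V by (simp add: borel_measurable_continuous_onI)
  have near: "\<exists>d>0. \<forall>y\<in>ball x d. \<bar>V y - V x\<bar> < \<epsilon>" if "\<epsilon> > 0" for \<epsilon>
    using V that unfolding continuous_on_iff dist_real_def by (metis UNIV_I dist_commute mem_ball)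
  show "((\<lambda>s. esssup (restrict_space lborel (ball x s)) (\<lambda>y. ereal (V y))) \<longlongrightarrow> ereal (V x)) (at_right 0)"
    unfolding esssup_ball_eq[OF Vm]
  proof (rule order_tendstoI)
    fix a :: ereal assume "a < ereal (V x)"
    then obtain a' where a': "a < ereal a'" "a' < V x" using ereal_dense2 by force
    obtain d where d: "d > 0" "\<forall>y\<in>ball x d. \<bar>V y - V x\<bar> < V x - a'" using near[of "V x - a'"] a' by auto
    have "ereal a' \<le> Inf {z. AE y in lborel. y \<in> ball x s \<longrightarrow> ereal (V y) \<le> z}" if s: "s > 0" for s
    proof (rule Inf_greatest, clarify)
      fix z assume ae: "AE y in lborel. y \<in> ball x s \<longrightarrow> ereal (V y) \<le> z"
      show "ereal a' \<le> z"
      proof (rule ccontr)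
        assume z: "\<not> ereal a' \<le> z"
        have imp: "y \<notin> ball x (min s d)" if "y \<in> ball x s \<longrightarrow> ereal (V y) \<le> z" for y
        proof
          assume y: "y \<in> ball x (min s d)"
          then have "a' < V y" using d(2) by (auto simp: abs_less_iff dest!: bspec[of _ _ y])
          then have "ereal a' \<le> z" using that y by (auto intro: order_trans[rotated])
          then show False using z by simp
        qed
        have "AE y in lborel. y \<notin> ball x (min s d)"
          using ae by (rule eventually_mono) (rule imp)
        then have "emeasure lborel (ball x (min s d)) = 0"
          using AE_iff_measurable[of "ball x (min s d)" lborel "\<lambda>y. y \<notin> ball x (min s d)"]
          by (simp del: mem_ball)
        then have "measure lborel (ball x (min s d)) = 0" by (simp add: measure_def)
        moreover have "measure lborel (ball x (min s d)) > 0" using s d(1) by (intro content_ball_pos) simp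
        ultimately show False by linarith
      qed
    qed
    then have "a < Inf {z. AE y in lborel. y \<in> ball x s \<longrightarrow> ereal (V y) \<le> z}" if "s > 0" for s
      using a'(1) that by (auto intro: less_le_trans)
    then show "\<forall>\<^sub>F s in at_right 0. a < Inf {z. AE y in lborel. y \<in> ball x s \<longrightarrow> ereal (V y) \<le> z}"
      using eventually_at_right_less[of 0] by (auto elim: eventually_mono)
  next
    fix b :: ereal assume "ereal (V x) < b"
    then obtain b' where b': "ereal b' < b" "V x < b'" using ereal_dense2 by force
    obtain d where d: "d > 0" "\<forall>y\<in>ball x d. \<bar>V y - V x\<bar> < b' - V x" using near[of "b' - V x"] b' by auto
    have "Inf {z. AE y in lborel. y \<in> ball x s \<longrightarrow> ereal (V y) \<le> z} < b" if s: "s < d" for s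
    proof -
      have "ereal (V y) \<le> ereal b'" if "y \<in> ball x s" for y
      proof -
        have "y \<in> ball x d" using that s by auto
        then have "\<bar>V y - V x\<bar> < b' - V x" using d(2) by blast
        then show ?thesis by (simp add: abs_less_iff)
      qed
      then have "Inf {z. AE y in lborel. y \<in> ball x s \<longrightarrow> ereal (V y) \<le> z} \<le> ereal b'"
        by (intro Inf_lower) auto
      then show ?thesis using b'(1) by simp
    qed
    moreover have "\<forall>\<^sub>F s in at_right 0. s < d" using d(1) unfolding eventually_at_right_field by blast
    ultimately show "\<forall>\<^sub>F s in at_right 0. Inf {z. AE y in lborel. y \<in> ball x s \<longrightarrow> ereal (V y) \<le> z} < b"
      by (auto elim: eventually_mono)
  qed
qed

lemma tendsto_L1_loc_of_locally_uniformly: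
  fixes V :: "'a::euclidean_space \<Rightarrow> real"
  assumes f: "tendsto_locally_uniformly f V" and V: "continuous_on UNIV V"
  shows "tendsto_L1_loc f V"
  unfolding tendsto_L1_loc_def
proof (intro allI impI conjI)
  fix K :: "'a set" assume K: "compact K"
  show "set_integrable lborel K V" unfolding set_integrable_def
    using K continuous_on_subset[OF V] by (intro borel_integrable_compact) auto
  show "(\<lambda>j. set_nn_integral lborel K (\<lambda>x. e2ennreal \<bar>f j x - ereal (V x)\<bar>)) \<longlonglongrightarrow> 0"
  proof (rule ennreal_tendsto_0I)
    fix \<epsilon> :: real assume eps: "\<epsilon> > 0"
    have "emeasure lborel K < \<infinity>" using K emeasure_compact_finite by blast
    then obtain c where c: "c \<ge> 0" "emeasure lborel K = ennreal c" by (cases "emeasure lborel K") auto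
    define d where "d = \<epsilon> / (c + 1)"
    have d: "d > 0" "d * c \<le> \<epsilon>" using eps c by (auto simp: d_def field_simps)
    have "\<forall>\<^sub>F j in sequentially. (\<forall>x\<in>K. \<bar>f j x\<bar> \<noteq> \<infinity>) \<and> (\<forall>x\<in>K. dist (real_of_ereal (f j x)) (V x) < d)"
      using f K d(1) unfolding tendsto_locally_uniformly_def
      by (intro eventually_conj uniform_limitD) auto
    then show "\<forall>\<^sub>F j in sequentially. set_nn_integral lborel K (\<lambda>x. e2ennreal \<bar>f j x - ereal (V x)\<bar>) \<le> ennreal \<epsilon>"
    proof (rule eventually_mono)
      fix j assume j: "(\<forall>x\<in>K. \<bar>f j x\<bar> \<noteq> \<infinity>) \<and> (\<forall>x\<in>K. dist (real_of_ereal (f j x)) (V x) < d)"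
      have "e2ennreal \<bar>f j x - ereal (V x)\<bar> * indicator K x \<le> ennreal d * indicator K x" for x
      proof (cases "x \<in> K")
        case True
        then obtain w where "f j x = ereal w" using j by (cases "f j x") auto
        then show ?thesis using j True by (auto simp: dist_real_def e2ennreal_ereal intro!: ennreal_leI dest!: bspec[of _ _ x])
      qed simp
      then have "set_nn_integral lborel K (\<lambda>x. e2ennreal \<bar>f j x - ereal (V x)\<bar>) \<le> (\<integral>\<^sup>+x. ennreal d * indicator K x \<partial>lborel)"
        by (intro nn_integral_mono) auto
      also have "\<dots> = ennreal d * ennreal c" using K c
        by (subst nn_integral_cmult_indicator) (auto simp: borel_compact)
      also have "\<dots> \<le> ennreal \<epsilon>" using d c by (simp add: ennreal_mult[symmetric] ennreal_leI)
      finally show "set_nn_integral lborel K (\<lambda>x. e2ennreal \<bar>f j x - ereal (V x)\<bar>) \<le> ennreal \<epsilon>" .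
    qed
  qed
qed

section \<open>Tangents below exponent two\<close>

context riesz_subharmonic
begin

text \<open>Blowing up by \<open>r\<close> and multiplying by \<open>r powr (p - 2)\<close> leaves the Hoelder constant for the exponent
\<open>2 - p\<close> unchanged, so all \<open>u\<^sub>r\<close> share one modulus of continuity. The function \<open>u\<^sub>r\<close> is controlled on
the ball of radius \<open>\<rho> / r\<close> only; composing with the nearest point projection onto this ball extends
it to the whole space without enlarging the constant.\<close>

lemma tangent_exists_of_lt_2:
  assumes p2: "p < 2" and X0: "0 \<in> X"
  obtains r V where "\<And>j. r j > 0" "decseq r" "r \<longlonglongrightarrow> 0"
    "tendsto_locally_uniformly (\<lambda>j. tangential_flow p u (r j)) V" "continuous_on UNIV V"
proof -
  define U where "U x = real_of_ereal (u x)" for x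
  obtain \<rho> C where \<rho>: "\<rho> > 0" "C \<ge> 0" "cball 0 \<rho> \<subseteq> X"
    and hol: "\<And>x y. x \<in> cball 0 \<rho> \<Longrightarrow> y \<in> cball 0 \<rho> \<Longrightarrow> \<bar>U x - U y\<bar> \<le> C * dist x y powr (2 - p)"
    using holder_of_lt_2[OF p2 X0] unfolding U_def by blast
  define r0 where "r0 j = \<rho> / real (Suc j)" for j
  have r0: "r0 j > 0" for j using \<rho>(1) by (simp add: r0_def)
  define B where "B j = cball (0::real^'n) (real (Suc j))" for j
  define c where "c j = closest_point (B j)" for j
  have B: "convex (B j)" "closed (B j)" "B j \<noteq> {}" for j by (auto simp: B_def)
  have c: "c j x \<in> B j" "dist (c j x) (c j y) \<le> dist x y" for j x y
    unfolding c_def using closest_point_in_set[OF B(2,3)] closest_point_lipschitz[OF B] by auto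
  have cid: "c j x = x" if "x \<in> B j" for j x using that by (simp add: c_def closest_point_self)
  have in\<rho>: "r0 j *\<^sub>R y \<in> cball 0 \<rho>" if "y \<in> B j" for j y
  proof -
    have "norm (r0 j *\<^sub>R y) = r0 j * norm y" using r0[of j] by simp
    also have "\<dots> \<le> r0 j * real (Suc j)" using that r0[of j] by (intro mult_left_mono) (auto simp: B_def)
    also have "\<dots> = \<rho>" by (simp add: r0_def)
    finally show ?thesis by simp
  qed
  define G where "G j x = r0 j powr (p - 2) * (U (r0 j *\<^sub>R c j x) - U 0)" for j x
  have Ghol: "\<bar>G j x - G j y\<bar> \<le> C * dist x y powr (2 - p)" for j x y
  proof -
    have "\<bar>G j x - G j y\<bar> = r0 j powr (p - 2) * \<bar>U (r0 j *\<^sub>R c j x) - U (r0 j *\<^sub>R c j y)\<bar>"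
    proof -
      have "G j x - G j y = r0 j powr (p - 2) * (U (r0 j *\<^sub>R c j x) - U (r0 j *\<^sub>R c j y))"
        by (simp add: G_def algebra_simps)
      then show ?thesis by (simp add: abs_mult)
    qed
    also have "\<dots> \<le> r0 j powr (p - 2) * (C * dist (r0 j *\<^sub>R c j x) (r0 j *\<^sub>R c j y) powr (2 - p))"
      by (intro mult_left_mono hol in\<rho> c(1)) simp
    also have "dist (r0 j *\<^sub>R c j x) (r0 j *\<^sub>R c j y) = r0 j * dist (c j x) (c j y)"
      using r0[of j] by (simp add: dist_norm scaleR_diff_right[symmetric] del: scaleR_diff_right)
    also have "r0 j powr (p - 2) * (C * (r0 j * dist (c j x) (c j y)) powr (2 - p))
        = (r0 j powr (p - 2) * r0 j powr (2 - p)) * (C * dist (c j x) (c j y) powr (2 - p))"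
      using r0[of j] by (simp add: powr_mult)
    also have "r0 j powr (p - 2) * r0 j powr (2 - p) = 1" using r0[of j] by (simp add: powr_add[symmetric])
    also have "1 * (C * dist (c j x) (c j y) powr (2 - p)) \<le> C * dist x y powr (2 - p)"
      using p2 \<rho>(2) c(2) by (auto intro!: mult_left_mono powr_mono2)
    finally show ?thesis .
  qed
  have G0: "G j 0 = 0" for j using cid[of 0 j] by (simp add: G_def B_def)
  have equi: "\<exists>d>0. \<forall>j x y. dist x y < d \<longrightarrow> \<bar>G j x - G j y\<bar> < \<epsilon>" if eps: "\<epsilon> > 0" for \<epsilon>
  proof -
    define d where "d = (\<epsilon> / (C + 1)) powr (1 / (2 - p))"
    have d: "d > 0" using eps \<rho>(2) by (simp add: d_def)
    have dp: "d powr (2 - p) = \<epsilon> / (C + 1)" using p2 eps \<rho>(2) by (simp add: d_def powr_powr)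
    have "\<bar>G j x - G j y\<bar> < \<epsilon>" if "dist x y < d" for j x y
    proof -
      have "dist x y powr (2 - p) \<le> d powr (2 - p)" using that p2 by (intro powr_mono2) auto
      then have "C * dist x y powr (2 - p) \<le> C * (\<epsilon> / (C + 1))" using \<rho>(2) dp by (intro mult_left_mono) auto
      also have "\<dots> < \<epsilon>" using eps \<rho>(2) by (simp add: field_simps)
      finally show ?thesis using Ghol[of j x y] by simp
    qed
    then show ?thesis using d by blast
  qed
  have bdd: "\<exists>b. \<forall>j. \<bar>G j x\<bar> \<le> b" for x using Ghol[of _ x 0] G0 by auto
  obtain k V where k: "strict_mono (k :: nat \<Rightarrow> nat)"
      and V: "\<And>K. compact K \<Longrightarrow> uniform_limit K (\<lambda>j. G (k j)) V sequentially"
  proof (rule diagonal_uniform_subsequence[of "\<lambda>j (i::unit). G j"])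
    fix k and V :: "unit \<Rightarrow> real^'n \<Rightarrow> real"
    assume "strict_mono (k :: nat \<Rightarrow> nat)"
      "\<And>i K. compact K \<Longrightarrow> uniform_limit K (\<lambda>j. G (k j)) (V i) sequentially"
    then show thesis by (rule that[of k "V ()"])
  qed (use equi bdd in auto)
  define r where "r j = r0 (k j)" for j
  have rpos: "r j > 0" for j using r0 by (simp add: r_def)
  have rdec: "decseq r"
    using \<rho>(1) strict_mono_less_eq[OF k] by (auto simp: decseq_def r_def r0_def intro!: divide_left_mono)
  have "r0 \<longlonglongrightarrow> 0" unfolding r0_def
    using tendsto_mult[OF tendsto_const LIMSEQ_inverse_real_of_nat, of \<rho>] by (simp add: divide_inverse)
  then have rlim: "r \<longlonglongrightarrow> 0" unfolding r_def using LIMSEQ_subseq_LIMSEQ[OF _ k] by (auto simp: o_def)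
  have Gcont: "continuous_on S (G j)" for S j
    unfolding continuous_on_iff dist_real_def
  proof (intro ballI allI impI)
    fix x and \<epsilon> :: real assume "\<epsilon> > 0"
    then obtain d where "d > 0" "\<And>j x y. dist x y < d \<Longrightarrow> \<bar>G j x - G j y\<bar> < \<epsilon>" using equi by blast
    then show "\<exists>d>0. \<forall>x'\<in>S. dist x' x < d \<longrightarrow> \<bar>G j x' - G j x\<bar> < \<epsilon>" by blast
  qed
  have Vcont: "continuous_on UNIV V"
  proof -
    have "continuous_on (cball x 1) V" for x
      by (rule uniform_limit_theorem[OF _ V[OF compact_cball]]) (simp_all add: Gcont)
    then have "isCont V x" for x
      by (rule continuous_on_interior[of "cball x 1"]) simp
    then show ?thesis by (simp add: continuous_at_imp_continuous_on)
  qed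
  have fin: "u x = ereal (U x)" if "x \<in> cball 0 \<rho>" for x
    using finite_of_lt_2[OF p2, of x] that \<rho>(3) by (cases "u x") (auto simp: U_def)
  have flow: "tangential_flow p u (r j) x = ereal (G (k j) x)" if "x \<in> B (k j)" for j x
    using fin[OF in\<rho>[OF that]] fin[of 0] \<rho>(1) p2 cid[OF that]
    by (simp add: tangential_flow_def G_def r_def)
  have "tendsto_locally_uniformly (\<lambda>j. tangential_flow p u (r j)) V"
    unfolding tendsto_locally_uniformly_def
  proof (intro allI impI)
    fix K :: "(real^'n) set" assume K: "compact K"
    then obtain b where b: "\<And>x. x \<in> K \<Longrightarrow> norm x \<le> b" using compact_imp_bounded bounded_iff by metis
    obtain N where N: "b \<le> real N" using real_arch_simple by blast
    have "x \<in> B (k j)" if "j \<ge> N" "x \<in> K" for j x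
      using b[OF that(2)] N that(1) seq_suble[OF k, of j] by (simp add: B_def)
    then have ev: "\<forall>\<^sub>F j in sequentially. \<forall>x\<in>K. tangential_flow p u (r j) x = ereal (G (k j) x)"
      using flow unfolding eventually_sequentially by blast
    then have "\<forall>\<^sub>F j in sequentially. \<forall>x\<in>K. \<bar>tangential_flow p u (r j) x\<bar> \<noteq> \<infinity>"
      by (rule eventually_mono) auto
    moreover have ev2: "\<forall>\<^sub>F j in sequentially. \<forall>x\<in>K. G (k j) x = real_of_ereal (tangential_flow p u (r j) x)"
      using ev by (rule eventually_mono) auto
    have "uniform_limit K (\<lambda>j x. real_of_ereal (tangential_flow p u (r j) x)) V sequentially"
      using uniform_limit_cong[OF ev2, of V V] V[OF K] by simp
    ultimately show "(\<forall>\<^sub>F j in sequentially. \<forall>x\<in>K. \<bar>tangential_flow p u (r j) x\<bar> \<noteq> \<infinity>) \<and>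
        uniform_limit K (\<lambda>j x. real_of_ereal (tangential_flow p u (r j) x)) V sequentially" by blast
  qed
  then show ?thesis using that rpos rdec rlim Vcont by blast
qed

end

section \<open>The heat kernel\<close>

lemma integrable_gaussian:
  assumes "a > 0"
  shows "integrable lborel (\<lambda>z::'a::euclidean_space. exp (- (z \<bullet> z) / a))"
proof -
  define \<sigma> where "\<sigma> = sqrt (a / 2)"
  have \<sigma>: "\<sigma> > 0" "2 * \<sigma>\<^sup>2 = a" using assms by (auto simp: \<sigma>_def)
  have "integrable lborel (\<lambda>x. sqrt (2 * pi * \<sigma>\<^sup>2) * normal_density 0 \<sigma> x)"
    using integrable_normal_moment[OF \<sigma>(1), of 0 0] by simp
  moreover have "sqrt (2 * pi * \<sigma>\<^sup>2) * normal_density 0 \<sigma> x = exp (- (x^2) / a)" for x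
    using \<sigma> by (simp add: normal_density_def)
  ultimately have "integrable lborel (\<lambda>x::real. exp (- (x^2) / a))" by simp
  then have fin: "(\<integral>\<^sup>+x. ennreal (exp (- (x^2) / a)) \<partial>lborel) < \<infinity>"
    by (simp add: integrable_iff_bounded)
  have prod: "exp (- (z \<bullet> z) / a) = (\<Prod>b\<in>Basis. exp (- ((z \<bullet> b)^2) / a))" for z :: 'a
    by (simp add: exp_sum[symmetric] euclidean_inner[of z z] power2_eq_square sum_divide_distrib sum_negf)
  have "(\<integral>\<^sup>+z. ennreal (exp (- (z \<bullet> z) / a)) \<partial>(lborel::'a measure))
      = (\<integral>\<^sup>+z. (\<Prod>b\<in>Basis. ennreal (exp (- ((z \<bullet> b)^2) / a))) \<partial>(lborel::'a measure))"
    unfolding prod by (subst prod_ennreal) auto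
  also have "\<dots> = (\<Prod>b\<in>(Basis::'a set). \<integral>\<^sup>+x. ennreal (exp (- (x^2) / a)) \<partial>lborel)"
    by (rule nn_integral_lborel_prod) auto
  also have "\<dots> < \<infinity>"
    using fin by (simp add: power_less_top_ennreal)
  finally show ?thesis by (intro integrableI_bounded) auto
qed

text \<open>Change of variables, used for the scaling of the heat kernel and for the reflection in a
convolution.\<close>

lemma integral_affine:
  fixes f :: "'a::euclidean_space \<Rightarrow> real"
  assumes c: "c \<noteq> 0" and f: "integrable lborel f"
  shows "integrable lborel (\<lambda>y. f (x + c *\<^sub>R y))"
    and "(\<integral>y. f y \<partial>lborel) = \<bar>c\<bar>^DIM('a) * (\<integral>y. f (x + c *\<^sub>R y) \<partial>lborel)"
proof -
  have fm[measurable]: "f \<in> borel_measurable borel" using f by auto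
  have "integrable (density (distr lborel borel (\<lambda>y. x + c *\<^sub>R y)) (\<lambda>_. ennreal (\<bar>c\<bar>^DIM('a)))) f"
    using f lborel_affine[OF c, of x] by simp
  then have "integrable lborel (\<lambda>y. \<bar>c\<bar>^DIM('a) *\<^sub>R f (x + c *\<^sub>R y))"
    by (simp add: integrable_density integrable_distr_eq)
  then show "integrable lborel (\<lambda>y. f (x + c *\<^sub>R y))" using c by simp
  have "(\<integral>y. f y \<partial>lborel) = (\<integral>y. f y \<partial>(density (distr lborel borel (\<lambda>y. x + c *\<^sub>R y)) (\<lambda>_. ennreal (\<bar>c\<bar>^DIM('a)))))"
    using lborel_affine[OF c, of x] by simp
  also have "\<dots> = \<bar>c\<bar>^DIM('a) * (\<integral>y. f (x + c *\<^sub>R y) \<partial>lborel)"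
    by (simp add: integral_density integral_distr)
  finally show "(\<integral>y. f y \<partial>lborel) = \<bar>c\<bar>^DIM('a) * (\<integral>y. f (x + c *\<^sub>R y) \<partial>lborel)" .
qed

definition gauss_mass :: "'a::euclidean_space itself \<Rightarrow> real" where
  "gauss_mass _ = (\<integral>z. exp (- (z \<bullet> z) / 4) \<partial>(lborel :: 'a measure))"

text \<open>The fundamental solution of the heat equation. Division by the mass of the Gaussian normalises it,
and its total mass is one at all times by scaling alone.\<close>

definition heat_kernel :: "real \<Rightarrow> 'a::euclidean_space \<Rightarrow> real" where
  "heat_kernel t x = t powr (- DIM('a) / 2) * exp (- (x \<bullet> x) / (4 * t)) / gauss_mass TYPE('a)"

text \<open>The mean distance that heat has spread at time one; at time \<open>t\<close> it is \<open>sqrt t\<close> times as large.\<close>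

definition gauss_first_moment :: "'a::euclidean_space itself \<Rightarrow> real" where
  "gauss_first_moment _ = (\<integral>z. norm z * exp (- (z \<bullet> z) / 4) \<partial>(lborel :: 'a measure)) / gauss_mass TYPE('a)"

lemma gauss_mass_pos: "gauss_mass TYPE('a::euclidean_space) > 0"
proof -
  let ?f = "\<lambda>z::'a. exp (- (z \<bullet> z) / 4)"
  have "integral\<^sup>L lborel ?f \<noteq> 0"
  proof
    assume "integral\<^sup>L lborel ?f = 0"
    then have "AE z in lborel. ?f z = 0"
      using integrable_gaussian[of 4, where 'a='a] by (subst (asm) integral_nonneg_eq_0_iff_AE) auto
    then have "AE z in (lborel :: 'a measure). False" by simp
    then have "emeasure (lborel :: 'a measure) UNIV = 0"
      using AE_iff_measurable[of UNIV "lborel :: 'a measure" "\<lambda>_. False"] by simp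
    then show False by simp
  qed
  moreover have "integral\<^sup>L lborel ?f \<ge> 0" by simp
  ultimately show ?thesis unfolding gauss_mass_def by linarith
qed

lemma heat_kernel_nonneg: "heat_kernel t x \<ge> 0" for x :: "'a::euclidean_space"
  using gauss_mass_pos[where 'a='a] by (simp add: heat_kernel_def)

lemma heat_kernel_minus: "heat_kernel t (x - y) = heat_kernel t (y - x)"
  by (simp add: heat_kernel_def inner_diff algebra_simps)

lemma continuous_on_heat_kernel: "continuous_on S (heat_kernel t)"
  unfolding heat_kernel_def[abs_def] divide_inverse by (intro continuous_intros)

lemma borel_measurable_heat_kernel[measurable]: "heat_kernel t \<in> borel_measurable borel"
  by (intro borel_measurable_continuous_onI continuous_on_heat_kernel)

lemma le_exp_square: "a \<le> exp (a\<^sup>2 / 4)" for a :: real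
proof -
  have "0 \<le> (a / 2 - 1)\<^sup>2" by simp
  then have "a \<le> 1 + a\<^sup>2 / 4" by (simp add: power2_eq_square algebra_simps)
  also have "\<dots> \<le> exp (a\<^sup>2 / 4)" by (rule exp_ge_add_one_self)
  finally show ?thesis .
qed

lemma integrable_norm_gaussian:
  "integrable lborel (\<lambda>z::'a::euclidean_space. norm z * exp (- (z \<bullet> z) / 4))"
proof (rule Bochner_Integration.integrable_bound)
  show "integrable lborel (\<lambda>z::'a. 2 * exp (- (z \<bullet> z) / 8))" using integrable_gaussian[of 8, where 'a='a] by simp
  show "AE z in lborel. norm (norm z * exp (- (z \<bullet> z) / 4)) \<le> norm (2 * exp (- ((z::'a) \<bullet> z) / 8))"
  proof (rule AE_I2)
    fix z :: 'a
    have "norm z / 2 \<le> exp ((norm z / 2)\<^sup>2 / 4)" by (rule le_exp_square)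
    also have "\<dots> \<le> exp ((z \<bullet> z) / 8)" by (simp add: power2_norm_eq_inner power_divide)
    finally have "norm z * exp (- (z \<bullet> z) / 4) \<le> 2 * exp ((z \<bullet> z) / 8) * exp (- (z \<bullet> z) / 4)" by simp
    also have "\<dots> = 2 * exp (- (z \<bullet> z) / 8)" by (simp add: mult_exp_exp)
    finally show "norm (norm z * exp (- (z \<bullet> z) / 4)) \<le> norm (2 * exp (- (z \<bullet> z) / 8))" by simp
  qed
qed measurable

text \<open>Parabolic scaling reduces every integral of the heat kernel to time one.\<close>

lemma heat_kernel_scale:
  fixes z :: "'a::euclidean_space"
  assumes "t > 0"
  shows "heat_kernel t (sqrt t *\<^sub>R z) * sqrt t ^ DIM('a) = exp (- (z \<bullet> z) / 4) / gauss_mass TYPE('a)"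
proof -
  have "sqrt t ^ DIM('a) = t powr (DIM('a) / 2)"
    using assms by (simp add: powr_half_sqrt[symmetric] powr_realpow[symmetric] powr_powr)
  then have "t powr (- DIM('a) / 2) * sqrt t ^ DIM('a) = 1"
    using assms by (simp add: powr_add[symmetric])
  moreover have "(sqrt t *\<^sub>R z) \<bullet> (sqrt t *\<^sub>R z) = t * (z \<bullet> z)"
    using assms by (simp add: mult.assoc[symmetric])
  moreover have "heat_kernel t (sqrt t *\<^sub>R z) * sqrt t ^ DIM('a) = (t powr (- DIM('a) / 2) * sqrt t ^ DIM('a))
      * exp (- ((sqrt t *\<^sub>R z) \<bullet> (sqrt t *\<^sub>R z)) / (4 * t)) / gauss_mass TYPE('a)"
    by (simp add: heat_kernel_def)
  ultimately show ?thesis using assms by (simp del: inner_scaleR_left inner_scaleR_right)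
qed

lemma heat_kernel_integral:
  assumes t: "t > 0"
  shows integrable_heat_kernel: "integrable lborel (heat_kernel t :: 'a::euclidean_space \<Rightarrow> real)"
    and integral_heat_kernel: "(\<integral>y. heat_kernel t y \<partial>(lborel::'a measure)) = 1"
    and integrable_norm_heat_kernel: "integrable lborel (\<lambda>y::'a. norm y * heat_kernel t y)"
    and integral_norm_heat_kernel: "(\<integral>y. norm y * heat_kernel t y \<partial>(lborel::'a measure)) = sqrt t * gauss_first_moment TYPE('a)"
proof -
  let ?c = "1 / sqrt t" and ?Z = "gauss_mass TYPE('a)"
  have c: "?c \<noteq> 0" "\<bar>?c\<bar> = ?c" using t by auto
  have eq: "heat_kernel t y = ?c ^ DIM('a) * (exp (- ((0 + ?c *\<^sub>R y) \<bullet> (0 + ?c *\<^sub>R y)) / 4) / ?Z)" for y :: 'a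
  proof -
    have "heat_kernel t y * sqrt t ^ DIM('a) = exp (- ((?c *\<^sub>R y) \<bullet> (?c *\<^sub>R y)) / 4) / ?Z"
      using heat_kernel_scale[OF t, of "?c *\<^sub>R y"] t by simp
    moreover have "?c ^ DIM('a) * sqrt t ^ DIM('a) = 1" using t by (simp add: power_mult_distrib[symmetric])
    ultimately have "heat_kernel t y = ?c ^ DIM('a) * (exp (- ((?c *\<^sub>R y) \<bullet> (?c *\<^sub>R y)) / 4) / ?Z)"
      by (metis (no_types) mult.left_commute mult.right_neutral)
    then show ?thesis by simp
  qed
  have neq: "norm y * heat_kernel t y = sqrt t * ?c ^ DIM('a) * (norm (0 + ?c *\<^sub>R y) * exp (- ((0 + ?c *\<^sub>R y) \<bullet> (0 + ?c *\<^sub>R y)) / 4) / ?Z)" for y :: 'a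
    unfolding eq using t by simp
  have i0: "integrable lborel (\<lambda>z::'a. exp (- (z \<bullet> z) / 4) / ?Z)" using integrable_gaussian[of 4, where 'a='a] by simp
  have i1: "integrable lborel (\<lambda>z::'a. norm z * exp (- (z \<bullet> z) / 4) / ?Z)" using integrable_norm_gaussian[where 'a='a] by simp
  show "integrable lborel (heat_kernel t :: 'a \<Rightarrow> real)" unfolding eq[abs_def]
    by (rule integrable_mult_right[OF integral_affine(1)[OF c(1) i0, of 0]])
  show "integrable lborel (\<lambda>y::'a. norm y * heat_kernel t y)" unfolding neq[abs_def]
    by (rule integrable_mult_right[OF integral_affine(1)[OF c(1) i1, of 0]])
  have "(\<integral>y. heat_kernel t y \<partial>(lborel::'a measure)) = (\<integral>z. exp (- (z \<bullet> z) / 4) / ?Z \<partial>(lborel::'a measure))"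
    unfolding eq integral_affine(2)[OF c(1) i0, of 0] c(2) by (rule integral_mult_right_zero)
  also have "\<dots> = 1" using gauss_mass_pos[where 'a='a] by (simp add: gauss_mass_def)
  finally show "(\<integral>y. heat_kernel t y \<partial>(lborel::'a measure)) = 1" .
  have "(\<integral>y. norm y * heat_kernel t y \<partial>(lborel::'a measure)) = sqrt t * (\<integral>z. norm z * exp (- (z \<bullet> z) / 4) / ?Z \<partial>(lborel::'a measure))"
    unfolding neq integral_affine(2)[OF c(1) i1, of 0] c(2) mult.assoc integral_mult_right_zero ..
  also have "\<dots> = sqrt t * gauss_first_moment TYPE('a)" by (simp add: gauss_first_moment_def)
  finally show "(\<integral>y. norm y * heat_kernel t y \<partial>(lborel::'a measure)) = sqrt t * gauss_first_moment TYPE('a)" .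
qed

lemma gauss_first_moment_nonneg: "gauss_first_moment TYPE('a::euclidean_space) \<ge> 0"
  unfolding gauss_first_moment_def using gauss_mass_pos[where 'a='a] by simp

lemma heat_kernel_shift:
  fixes x :: "'a::euclidean_space"
  assumes t: "t > 0"
  shows "integrable lborel (\<lambda>y. heat_kernel t (x - y))" "(\<integral>y. heat_kernel t (x - y) \<partial>lborel) = 1"
    "integrable lborel (\<lambda>y. norm (x - y) * heat_kernel t (x - y))"
    "(\<integral>y. norm (x - y) * heat_kernel t (x - y) \<partial>lborel) = sqrt t * gauss_first_moment TYPE('a)"
  using integral_affine[of "-1" "heat_kernel t" x] integrable_heat_kernel[OF t, where 'a='a] integral_heat_kernel[OF t, where 'a='a]
    integral_affine[of "-1" "\<lambda>y. norm y * heat_kernel t y" x] integrable_norm_heat_kernel[OF t, where 'a='a]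
    integral_norm_heat_kernel[OF t, where 'a='a]
  by simp_all

text \<open>The heat flow changes a Lipschitz function by at most its Lipschitz constant times the mean
displacement. The bound serves twice: for the initial values in the comparison, and for the cutoff
function in the smoothing estimate.\<close>

lemma heat_kernel_approximation:
  fixes f :: "'a::euclidean_space \<Rightarrow> real"
  assumes t: "t > 0" and f: "integrable lborel (\<lambda>y. heat_kernel t (x - y) * f y)"
    and L: "\<And>y. \<bar>f y - f x\<bar> \<le> L * norm (x - y)"
  shows "\<bar>(\<integral>y. heat_kernel t (x - y) * f y \<partial>lborel) - f x\<bar> \<le> L * (sqrt t * gauss_first_moment TYPE('a))"
proof -
  have i1: "integrable lborel (\<lambda>y. heat_kernel t (x - y) * f x)" using heat_kernel_shift(1)[OF t, of x] by simp
  have "(\<integral>y. heat_kernel t (x - y) * f y \<partial>lborel) - f x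
      = (\<integral>y. heat_kernel t (x - y) * f y - heat_kernel t (x - y) * f x \<partial>lborel)"
    using f i1 heat_kernel_shift(2)[OF t, of x] by (subst Bochner_Integration.integral_diff) simp_all
  also have "\<bar>\<dots>\<bar> \<le> (\<integral>y. L * (norm (x - y) * heat_kernel t (x - y)) \<partial>lborel)"
  proof (rule integral_abs_bound[THEN order_trans], rule integral_mono)
    show "integrable lborel (\<lambda>y. \<bar>heat_kernel t (x - y) * f y - heat_kernel t (x - y) * f x\<bar>)" using f i1 by simp
    show "integrable lborel (\<lambda>y. L * (norm (x - y) * heat_kernel t (x - y)))" using heat_kernel_shift(3)[OF t, of x] by simp
    fix y
    have "\<bar>heat_kernel t (x - y) * f y - heat_kernel t (x - y) * f x\<bar> = heat_kernel t (x - y) * \<bar>f y - f x\<bar>"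
      by (simp add: right_diff_distrib[symmetric] abs_mult heat_kernel_nonneg)
    also have "\<dots> \<le> heat_kernel t (x - y) * (L * norm (x - y))" by (intro mult_left_mono L heat_kernel_nonneg)
    finally show "\<bar>heat_kernel t (x - y) * f y - heat_kernel t (x - y) * f x\<bar> \<le> L * (norm (x - y) * heat_kernel t (x - y))"
      by (simp add: mult_ac)
  qed
  also have "\<dots> = L * (sqrt t * gauss_first_moment TYPE('a))" using heat_kernel_shift(4)[OF t, of x] by simp
  finally show ?thesis .
qed

lemma heat_kernel_strict_antimono:
  fixes z w :: "'a::euclidean_space"
  assumes "t > 0" "norm z < norm w"
  shows "heat_kernel t w < heat_kernel t z"
proof -
  have "z \<bullet> z < w \<bullet> w" using assms(2) by (simp add: norm_lt)
  then show ?thesis using assms(1) gauss_mass_pos[where 'a='a] by (simp add: heat_kernel_def divide_strict_right_mono)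
qed

lemma heat_kernel_antimono:
  fixes z w :: "'a::euclidean_space"
  assumes "t > 0" "norm z \<le> norm w"
  shows "heat_kernel t w \<le> heat_kernel t z"
proof -
  have "z \<bullet> z \<le> w \<bullet> w" using assms(2) by (simp add: norm_le)
  then show ?thesis using assms(1) gauss_mass_pos[where 'a='a] by (simp add: heat_kernel_def divide_right_mono)
qed

lemma heat_kernel_time_derivative:
  fixes z :: "'a::euclidean_space"
  assumes t: "t > 0"
  shows "((\<lambda>t. heat_kernel t z) has_real_derivative
           heat_kernel t z * ((z \<bullet> z) / (4 * t^2) - DIM('a) / (2 * t))) (at t)"
proof -
  have "t powr (- DIM('a) / 2 - 1) = t powr (- DIM('a) / 2) / t"
    using t by (simp add: powr_diff)
  then show ?thesis using t gauss_mass_pos[where 'a='a]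
    unfolding heat_kernel_def
    by (auto intro!: derivative_eq_intros simp: field_simps power2_eq_square)
qed

text \<open>At a fixed point the kernel increases until the time \<open>\<bar>z\<bar>\<^sup>2 / (2 DIM('a))\<close>, at which the bulk of the
heat arrives.\<close>

lemma heat_kernel_mono_time:
  fixes z :: "'a::euclidean_space"
  assumes t: "0 < s" "s \<le> t" "2 * real DIM('a) * t \<le> z \<bullet> z"
  shows "heat_kernel s z \<le> heat_kernel t z"
proof (rule DERIV_nonneg_imp_nondecreasing[OF t(2)])
  fix r assume r: "s \<le> r" "r \<le> t"
  then have "r > 0" using t by simp
  have "2 * real DIM('a) * r \<le> 2 * real DIM('a) * t" using r by (intro mult_left_mono) auto
  then have "2 * real DIM('a) * r \<le> z \<bullet> z" using t(3) by linarith
  then have "(z \<bullet> z) / (4 * r^2) - DIM('a) / (2 * r) \<ge> 0" using \<open>r > 0\<close> by (simp add: field_simps power2_eq_square)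
  then show "\<exists>y. ((\<lambda>t. heat_kernel t z) has_real_derivative y) (at r) \<and> 0 \<le> y"
    using heat_kernel_time_derivative[OF \<open>r > 0\<close>, of z] heat_kernel_nonneg[of r z] by (meson mult_nonneg_nonneg)
qed

lemma heat_kernel_tendsto_0:
  fixes z :: "'a::euclidean_space"
  assumes "z \<noteq> 0"
  shows "((\<lambda>t. heat_kernel t z) \<longlongrightarrow> 0) (at_right 0)"
proof -
  define a where "a = real DIM('a) / 2"
  define b where "b = (z \<bullet> z) / 4"
  have b: "b > 0" using assms by (simp add: b_def)
  have "((\<lambda>t::real. t powr (- a) * exp (- b / t)) \<longlongrightarrow> 0) (at_right 0)" using b by real_asymp
  then have "((\<lambda>t::real. t powr (- a) * exp (- b / t) / gauss_mass TYPE('a)) \<longlongrightarrow> 0 / gauss_mass TYPE('a)) (at_right 0)"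
    by (intro tendsto_divide) (use gauss_mass_pos[where 'a='a] in auto)
  then show ?thesis by (simp add: heat_kernel_def a_def b_def)
qed

section \<open>Heat flow of a compactly supported function\<close>

lemma C2_on_affine:
  assumes "C2_on S \<phi> g H"
  shows "C2_on S (\<lambda>x. a * \<phi> x + c) (\<lambda>x. a *\<^sub>R g x) (\<lambda>x. a *\<^sub>R H x)"
proof -
  have "(\<lambda>h. a * (g x \<bullet> h)) = (\<bullet>) (a *\<^sub>R g x)" "(\<lambda>h. a *\<^sub>R (H x *v h)) = (*v) (a *\<^sub>R H x)" for x
    by (simp_all add: fun_eq_iff scaleR_matrix_vector_assoc)
  moreover have "((\<lambda>x. a * \<phi> x + c) has_derivative (\<lambda>h. a * (g x \<bullet> h))) (at x)" if "x \<in> S" for x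
    using assms that unfolding C2_on_def by (auto intro!: derivative_eq_intros)
  moreover have "((\<lambda>x. a *\<^sub>R g x) has_derivative (\<lambda>h. a *\<^sub>R (H x *v h))) (at x)" if "x \<in> S" for x
    using assms that unfolding C2_on_def by (intro has_derivative_scaleR_right) auto
  moreover have "continuous_on S (\<lambda>x. a *\<^sub>R H x)"
    using assms unfolding C2_on_def by (intro continuous_intros) auto
  ultimately show ?thesis unfolding C2_on_def by metis
qed

lemma continuous_on_convolution_integrand:
  fixes k :: "'a::euclidean_space \<Rightarrow> 'b::real_normed_vector"
  assumes f: "continuous_on C f" and k: "continuous_on UNIV k"
  shows "continuous_on (U \<times> C) (\<lambda>(x, y). f y *\<^sub>R k (x - y))"
proof -
  have "continuous_on (U \<times> C) (\<lambda>z. f (snd z))"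
    by (rule continuous_on_compose2[OF f continuous_on_snd]) (auto intro: continuous_on_id)
  moreover have "continuous_on (U \<times> C) (\<lambda>z. k (fst z - snd z))"
    by (rule continuous_on_compose2[OF k]) (auto intro!: continuous_intros)
  ultimately show ?thesis unfolding case_prod_unfold by (intro continuous_intros)
qed

lemma convolution_integrable:
  fixes k :: "'a::euclidean_space \<Rightarrow> 'b::banach"
  assumes f: "continuous_on (cbox a b) f" and k: "continuous_on UNIV k"
  shows "(\<lambda>y. f y *\<^sub>R k (x - y)) integrable_on cbox a b"
  by (intro integrable_continuous continuous_intros f continuous_on_compose2[OF k]) auto

text \<open>The scalar case of differentiation under the integral. The matrix valued second derivative is
obtained from it by applying it to the components of the gradient.\<close>

lemma convolution_has_derivative:
  fixes k :: "'a::euclidean_space \<Rightarrow> real"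
  assumes f: "continuous_on (cbox a b) f"
    and k: "\<And>z. (k has_derivative (\<lambda>h. k' z \<bullet> h)) (at z)" and k': "continuous_on UNIV k'"
  shows "((\<lambda>x. integral (cbox a b) (\<lambda>y. f y *\<^sub>R k (x - y))) has_derivative
          (\<lambda>h. integral (cbox a b) (\<lambda>y. f y *\<^sub>R k' (x - y)) \<bullet> h)) (at x)"
proof -
  have kc: "continuous_on UNIV k"
    using k has_derivative_continuous by (blast intro: continuous_at_imp_continuous_on)
  define fx where "fx x y = blinfun_inner_right (f y *\<^sub>R k' (x - y))" for x y
  have int: "integral (cbox a b) (fx x) = blinfun_inner_right (integral (cbox a b) (\<lambda>y. f y *\<^sub>R k' (x - y)))"
    using integral_linear[OF convolution_integrable[OF f k', of x] bounded_linear_blinfun_inner_right]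
    by (simp add: fx_def[abs_def] o_def)
  have "((\<lambda>x. integral (cbox a b) (\<lambda>y. f y *\<^sub>R k (x - y))) has_derivative
         blinfun_apply (integral (cbox a b) (fx x))) (at x within UNIV)"
  proof (rule leibniz_rule)
    fix z y
    have "((\<lambda>x. k (x - y)) has_derivative (\<lambda>h. k' (z - y) \<bullet> h)) (at z)"
    proof -
      have "((\<lambda>x. x - y) has_derivative (\<lambda>h. h)) (at z)"
        by (rule has_derivative_eq_rhs[OF has_derivative_diff[OF has_derivative_ident has_derivative_const]]) simp
      then show ?thesis by (rule has_derivative_compose) (rule k)
    qed
    then have "((\<lambda>x. f y *\<^sub>R k (x - y)) has_derivative (\<lambda>h. f y *\<^sub>R (k' (z - y) \<bullet> h))) (at z)"
      by (rule has_derivative_scaleR_right)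
    moreover have "(\<lambda>h. f y *\<^sub>R (k' (z - y) \<bullet> h)) = blinfun_apply (fx z y)"
      by (simp add: fx_def fun_eq_iff)
    ultimately show "((\<lambda>x. f y *\<^sub>R k (x - y)) has_derivative blinfun_apply (fx z y)) (at z within UNIV)" by simp
  next
    show "(\<lambda>y. f y *\<^sub>R k (z - y)) integrable_on cbox a b" for z by (rule convolution_integrable[OF f kc])
    show "continuous_on (UNIV \<times> cbox a b) (\<lambda>(x, y). fx x y)"
      using bounded_linear.continuous_on[OF bounded_linear_blinfun_inner_right
          continuous_on_convolution_integrand[OF f k', of UNIV]]
      by (simp add: fx_def case_prod_unfold)
  qed auto
  moreover have "blinfun_apply (integral (cbox a b) (fx x)) = (\<lambda>h. integral (cbox a b) (\<lambda>y. f y *\<^sub>R k' (x - y)) \<bullet> h)"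
    by (simp add: int fun_eq_iff)
  ultimately show ?thesis by simp
qed

lemma C2_on_convolution:
  fixes k :: "real^'n \<Rightarrow> real"
  assumes f: "continuous_on (cbox a b) f" and k: "C2_on UNIV k g H"
  shows "C2_on S (\<lambda>x. integral (cbox a b) (\<lambda>y. f y *\<^sub>R k (x - y)))
           (\<lambda>x. integral (cbox a b) (\<lambda>y. f y *\<^sub>R g (x - y)))
           (\<lambda>x. integral (cbox a b) (\<lambda>y. f y *\<^sub>R H (x - y)))"
proof -
  have kd: "(k has_derivative (\<lambda>h. g z \<bullet> h)) (at z)" and gd: "(g has_derivative (\<lambda>h. H z *v h)) (at z)" for z
    using k by (auto simp: C2_on_def)
  have Hc: "continuous_on UNIV H" using k by (simp add: C2_on_def)
  have gc: "continuous_on UNIV g"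
    using gd has_derivative_continuous by (blast intro: continuous_at_imp_continuous_on)
  have nth: "integral (cbox a b) (\<lambda>y. f y *\<^sub>R v (x - y)) $ i = integral (cbox a b) (\<lambda>y. f y *\<^sub>R (v (x - y) $ i))"
    if "continuous_on UNIV v" for v :: "real^'n \<Rightarrow> ('c::euclidean_space)^'n" and x i
    using integral_linear[OF convolution_integrable[OF f that, of x] bounded_linear_vec_nth[of i]]
    by (simp add: o_def)
  have comp: "((\<lambda>x. integral (cbox a b) (\<lambda>y. f y *\<^sub>R g (x - y)) $ i) has_derivative
       (\<lambda>h. (integral (cbox a b) (\<lambda>y. f y *\<^sub>R H (x - y)) *v h) $ i)) (at x)" for x i
  proof -
    have "((\<lambda>z. g z $ i) has_derivative (\<lambda>h. (H z *v h) $ i)) (at z)" for z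
      by (rule bounded_linear.has_derivative[OF bounded_linear_vec_nth gd])
    then have "((\<lambda>z. g z $ i) has_derivative (\<lambda>h. H z $ i \<bullet> h)) (at z)" for z
      by (simp add: matrix_vector_mul_component)
    moreover have "continuous_on UNIV (\<lambda>z. H z $ i)" using Hc by (intro continuous_intros)
    ultimately have "((\<lambda>x. integral (cbox a b) (\<lambda>y. f y *\<^sub>R (g (x - y) $ i))) has_derivative
       (\<lambda>h. integral (cbox a b) (\<lambda>y. f y *\<^sub>R (H (x - y) $ i)) \<bullet> h)) (at x)"
      by (rule convolution_has_derivative[OF f])
    then show ?thesis by (simp only: nth[OF gc] nth[OF Hc] matrix_vector_mul_component)
  qed
  have "((\<lambda>x. integral (cbox a b) (\<lambda>y. f y *\<^sub>R g (x - y))) has_derivative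
       (\<lambda>h. integral (cbox a b) (\<lambda>y. f y *\<^sub>R H (x - y)) *v h)) (at x)" for x
  proof (subst has_derivative_componentwise_within, rule ballI)
    fix i :: "real^'n" assume "i \<in> Basis"
    then obtain j where i: "i = axis j 1" by (auto simp: Basis_vec_def)
    show "((\<lambda>x. integral (cbox a b) (\<lambda>y. f y *\<^sub>R g (x - y)) \<bullet> i) has_derivative
        (\<lambda>h. (integral (cbox a b) (\<lambda>y. f y *\<^sub>R H (x - y)) *v h) \<bullet> i)) (at x)"
      using comp[of j x] unfolding i by (simp add: inner_axis)
  qed
  moreover have "continuous_on S (\<lambda>x. integral (cbox a b) (\<lambda>y. f y *\<^sub>R H (x - y)))"
    by (rule integral_continuous_on_param) (rule continuous_on_convolution_integrand[OF f Hc])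
  ultimately show ?thesis unfolding C2_on_def
    using convolution_has_derivative[OF f kd gc] by blast
qed

definition heat_gradient :: "real \<Rightarrow> real^'n \<Rightarrow> real^'n" where
  "heat_gradient t z = (- heat_kernel t z / (2 * t)) *\<^sub>R z"

definition heat_hessian :: "real \<Rightarrow> real^'n \<Rightarrow> real^'n^'n" where
  "heat_hessian t z = (- heat_kernel t z / (2 * t)) *\<^sub>R mat 1 + (heat_kernel t z / (4 * t\<^sup>2)) *\<^sub>R proj_line z"

lemma C2_on_heat_kernel:
  fixes S :: "(real^'n) set"
  assumes t: "t > 0"
  shows "C2_on S (heat_kernel t) (heat_gradient t) (heat_hessian t)"
proof -
  define h where "h s = t powr (- DIM(real^'n) / 2) * exp (- s / (4 * t)) / gauss_mass TYPE(real^'n)" for s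
  have hk: "heat_kernel t z = h ((z - 0) \<bullet> (z - 0))" for z :: "real^'n"
    by (simp add: heat_kernel_def h_def)
  have dh: "(h has_real_derivative - h s / (4 * t)) (at s)" for s
    unfolding h_def using t gauss_mass_pos[where 'a="real^'n"]
    by (auto intro!: derivative_eq_intros simp: mult_ac)
  have "C2_on S (\<lambda>x. h ((x - 0) \<bullet> (x - 0)))
           (\<lambda>x. (2 * (- h ((x - 0) \<bullet> (x - 0)) / (4 * t))) *\<^sub>R (x - 0))
           (\<lambda>x. (2 * (- h ((x - 0) \<bullet> (x - 0)) / (4 * t))) *\<^sub>R mat 1
                 + (4 * (h ((x - 0) \<bullet> (x - 0)) / (16 * t^2))) *\<^sub>R proj_line (x - 0))"
  proof (rule C2_on_radial[where T=UNIV])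
    show "((\<lambda>s. - h s / (4 * t)) has_real_derivative h s / (16 * t^2)) (at s)" for s
      using t by (auto intro!: derivative_eq_intros dh simp: power2_eq_square)
    show "continuous_on UNIV (\<lambda>s. h s / (16 * t\<^sup>2))" unfolding h_def divide_inverse by (intro continuous_intros)
  qed (use dh in auto)
  then show ?thesis unfolding hk[symmetric]
    by (simp add: heat_gradient_def[abs_def] heat_hessian_def[abs_def])
qed

lemma trace_scaleR: "trace (c *\<^sub>R A) = c * trace (A :: real^'n^'n)"
  by (simp add: trace_def sum_distrib_left)

lemma bounded_linear_trace: "bounded_linear (trace :: real^'n^'n \<Rightarrow> real)"
  using linear_conv_bounded_linear linearI[of "trace :: real^'n^'n \<Rightarrow> real"] by (auto simp: trace_add trace_scaleR)

lemma trace_heat_hessian: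
  fixes z :: "real^'n"
  assumes "t > 0"
  shows "trace (heat_hessian t z) = heat_kernel t z * ((z \<bullet> z) / (4 * t^2) - CARD('n) / (2 * t))"
proof -
  have "trace (proj_line z) = z \<bullet> z" by (simp add: trace_def proj_line_nth inner_vec_def)
  moreover have "trace (mat 1 :: real^'n^'n) = CARD('n)" by (simp add: trace_I)
  ultimately show ?thesis unfolding heat_hessian_def trace_add trace_scaleR by (simp add: field_simps)
qed

text \<open>Differentiation under the integral in time gives the integral of the time derivative of the kernel,
which is the trace of its Hessian by \<open>trace_heat_hessian\<close>.\<close>

lemma convolution_heat_equation:
  fixes x :: "real^'n"
  assumes f: "continuous_on (cbox a b) f" and t: "t > 0"
  shows "((\<lambda>t. integral (cbox a b) (\<lambda>y. f y *\<^sub>R heat_kernel t (x - y))) has_real_derivative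
          trace (integral (cbox a b) (\<lambda>y. f y *\<^sub>R heat_hessian t (x - y)))) (at t)"
proof -
  define fx where "fx t y = f y * (heat_kernel t (x - y) * (((x - y) \<bullet> (x - y)) / (4 * t^2) - CARD('n) / (2 * t)))" for t y
  have Hc: "continuous_on UNIV (heat_hessian t :: real^'n \<Rightarrow> _)"
    using C2_on_heat_kernel[OF t, of "UNIV :: (real^'n) set"] by (simp add: C2_on_def)
  have fyc: "continuous_on ({0<..} \<times> cbox a b) (\<lambda>z. f (snd z))"
    by (rule continuous_on_compose2[OF f continuous_on_snd]) (auto intro: continuous_on_id)
  have "((\<lambda>t. integral (cbox a b) (\<lambda>y. f y *\<^sub>R heat_kernel t (x - y))) has_field_derivative
         integral (cbox a b) (fx t)) (at t within {0<..})"
  proof (rule leibniz_rule_field_derivative)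
    fix s :: real and y :: "real^'n" assume "s \<in> {0<..}"
    then have s: "s > 0" by simp
    show "((\<lambda>t. f y *\<^sub>R heat_kernel t (x - y)) has_field_derivative fx s y) (at s within {0<..})"
      unfolding fx_def real_scaleR_def
      using DERIV_cmult[OF heat_kernel_time_derivative[OF s, of "x - y"], of "f y"] by (auto intro: has_field_derivative_at_within)
    show "(\<lambda>y. f y *\<^sub>R heat_kernel s (x - y)) integrable_on cbox a b"
      by (rule convolution_integrable[OF f continuous_on_heat_kernel])
  next
    have hk: "continuous_on ({0<..} \<times> cbox a b) (\<lambda>z. heat_kernel (fst z) (x - snd z))"
      unfolding heat_kernel_def using gauss_mass_pos[where 'a="real^'n"] by (auto intro!: continuous_intros)
    have "continuous_on ({0<..} \<times> cbox a b) (\<lambda>z. ((x - snd z) \<bullet> (x - snd z)) / (4 * (fst z)\<^sup>2) - CARD('n) / (2 * fst z))"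
      by (intro continuous_intros) auto
    then show "continuous_on ({0<..} \<times> cbox a b) (\<lambda>(t, y). fx t y)"
      unfolding fx_def case_prod_unfold by (intro continuous_on_mult fyc hk)
  qed (use t in auto)
  moreover have "at t within {0<..} = at t" using t by (intro at_within_open) auto
  moreover have "integral (cbox a b) (fx t) = trace (integral (cbox a b) (\<lambda>y. f y *\<^sub>R heat_hessian t (x - y)))"
    using integral_linear[OF convolution_integrable[OF f Hc, of x] bounded_linear_trace]
    by (simp add: o_def fx_def[abs_def] trace_scaleR trace_heat_hessian[OF t])
  ultimately show ?thesis by simp
qed

section \<open>Comparison with the heat flow\<close>

text \<open>The viscosity form of \<open>\<Delta> u \<ge> 0\<close>, which is subharmonicity for the cone of matrices with nonnegative
trace. The value \<open>-\<infinity>\<close> may be taken on any set; lower bounds on \<open>u\<close> enter the compactness theorem as a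
separate, quantitative hypothesis.\<close>

definition viscosity_subharmonic :: "(real^'n) set \<Rightarrow> (real^'n \<Rightarrow> ereal) \<Rightarrow> bool" where
  "viscosity_subharmonic X u \<longleftrightarrow>
     upper_semicontinuous_on X u \<and> (\<forall>x\<in>X. u x < \<infinity>) \<and>
     (\<forall>x0\<in>X. \<forall>\<phi> g H S.
        open S \<and> x0 \<in> S \<and> S \<subseteq> X \<and> C2_on S \<phi> g H \<and>
        (\<forall>x\<in>S. u x \<le> ereal (\<phi> x)) \<and> u x0 = ereal (\<phi> x0) \<longrightarrow> trace (H x0) \<ge> 0)"

text \<open>Let \<open>W\<close> be the heat flow of \<open>f\<close> and \<open>\<kappa>\<close> a bound for the heat kernel at distance at least \<open>R - s\<close>. The
claim is that \<open>u + W \<le> \<kappa> * \<integral> f\<close> at time \<open>T\<close>. This holds on the sphere of radius \<open>R\<close>, because there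
\<open>u \<le> 0\<close> and \<open>W \<le> \<kappa> * \<integral> f\<close>, and, up to an error of order \<open>sqrt t\<close>, at small times \<open>t\<close>, because \<open>W\<close>
starts as \<open>f \<le> - u\<close>. If it fails, then \<open>u + W\<close> minus a small multiple \<open>\<mu> t\<close> of time has its maximum at
an interior point \<open>z\<close> and at a time \<open>t\<close> after the initial one. In space, a translate of \<open>- W\<close> is a test
function for \<open>u\<close> at \<open>z\<close>, which gives \<open>\<Delta> W \<le> 0\<close>. In time, maximality gives \<open>\<partial>\<^sub>t W \<ge> \<mu> > 0\<close>. The heat
equation makes these contradictory.\<close>

lemma heat_comparison:
  fixes u :: "real^'n \<Rightarrow> ereal" and f :: "real^'n \<Rightarrow> real"
  assumes u: "viscosity_subharmonic X u" and X: "cball 0 R \<subseteq> X"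
    and u0: "\<And>x. x \<in> cball 0 R \<Longrightarrow> u x \<le> 0" and s: "0 < s" "s < R"
    and L: "L \<ge> 0" "\<And>x y. \<bar>f x - f y\<bar> \<le> L * norm (x - y)"
    and f: "\<And>y. 0 \<le> f y" "\<And>y. y \<notin> ball 0 s \<Longrightarrow> f y = 0" "\<And>y. y \<in> ball 0 s \<Longrightarrow> u y \<le> ereal (- f y)"
    and T: "T > 0" and \<kappa>: "\<And>t z. 0 < t \<Longrightarrow> t \<le> T \<Longrightarrow> R - s \<le> norm z \<Longrightarrow> heat_kernel t (z::real^'n) \<le> \<kappa>"
    and x: "x \<in> ball 0 R"
  shows "u x \<le> ereal (\<kappa> * (\<integral>y. f y \<partial>lborel) - (\<integral>y. heat_kernel T (x - y) * f y \<partial>lborel))"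
proof (rule ccontr)
  assume neg: "\<not> ?thesis"
  have fc: "continuous_on S f" for S
  proof (rule lipschitz_on_continuous_on, rule lipschitz_onI)
    show "dist (f x) (f y) \<le> L * dist x y" for x y using L(2)[of x y] by (simp add: dist_norm)
  qed (rule L(1))
  obtain a where a: "cball 0 R \<subseteq> cbox (-a) (a::real^'n)"
    using bounded_subset_cbox_symmetric[OF bounded_cball] by blast
  let ?C = "cbox (-a) a"
  define W where "W t x = integral ?C (\<lambda>y. f y *\<^sub>R heat_kernel t (x - y))" for t x
  define DW where "DW t x = trace (integral ?C (\<lambda>y. f y *\<^sub>R heat_hessian t (x - y)))" for t x
  have supp: "y \<in> ?C" if "f y \<noteq> 0" for y
    using f(2)[of y] that a s by force
  have leb: "integrable lborel (\<lambda>y. f y * k y)" "(\<integral>y. f y * k y \<partial>lborel) = integral ?C (\<lambda>y. f y * k y)"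
    if k: "continuous_on UNIV k" for k :: "real^'n \<Rightarrow> real"
  proof -
    have "set_integrable lborel ?C (\<lambda>y. f y * k y)" unfolding set_integrable_def
      by (intro borel_integrable_compact compact_cbox continuous_intros fc continuous_on_subset[OF k]) auto
    moreover have eq: "indicator ?C y *\<^sub>R (f y * k y) = f y * k y" for y using supp[of y] by (auto simp: indicator_def)
    ultimately show "integrable lborel (\<lambda>y. f y * k y)"
        "(\<integral>y. f y * k y \<partial>lborel) = integral ?C (\<lambda>y. f y * k y)"
      using set_borel_integral_eq_integral(2)[of ?C "\<lambda>y. f y * k y"]
      unfolding set_integrable_def set_lebesgue_integral_def eq by auto
  qed
  have shiftc: "continuous_on UNIV (\<lambda>y. heat_kernel t (x - y))" for t and x :: "real^'n"
    by (rule continuous_on_compose2[OF continuous_on_heat_kernel[of UNIV]]) (auto intro!: continuous_intros)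
  define I where "I = (\<integral>y. f y \<partial>lborel)"
  have fint: "integrable lborel f" using leb(1)[of "\<lambda>_. 1"] by simp
  have Wleb: "W t x = (\<integral>y. f y * heat_kernel t (x - y) \<partial>lborel)" for t x
    using leb(2)[OF shiftc] by (simp add: W_def)
  define C1 where "C1 = L * gauss_first_moment TYPE(real^'n)"
  have C1: "C1 \<ge> 0" using L(1) gauss_first_moment_nonneg[where 'a="real^'n"] by (simp add: C1_def)
  have Winit: "W t x \<le> f x + C1 * sqrt t" if "t > 0" for t x
  proof -
    have "integrable lborel (\<lambda>y. heat_kernel t (x - y) * f y)" using leb(1)[OF shiftc] by (simp add: mult.commute)
    moreover have "\<bar>f y - f x\<bar> \<le> L * norm (x - y)" for y using L(2)[of x y] by (simp add: abs_minus_commute)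
    ultimately have "\<bar>(\<integral>y. heat_kernel t (x - y) * f y \<partial>lborel) - f x\<bar> \<le> L * (sqrt t * gauss_first_moment TYPE(real^'n))"
      by (rule heat_kernel_approximation[OF that])
    then show ?thesis unfolding Wleb C1_def by (simp add: mult_ac abs_le_iff)
  qed
  have Wbdry: "W t z \<le> \<kappa> * I" if t: "0 < t" "t \<le> T" and z: "norm z = R" for t z
  proof -
    have "W t z \<le> (\<integral>y. \<kappa> * f y \<partial>lborel)" unfolding Wleb
    proof (rule integral_mono)
      show "integrable lborel (\<lambda>y. f y * heat_kernel t (z - y))" by (rule leb(1)[OF shiftc])
      show "integrable lborel (\<lambda>y. \<kappa> * f y)" using fint by simp
      fix y
      show "f y * heat_kernel t (z - y) \<le> \<kappa> * f y"
      proof (cases "y \<in> ball 0 s")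
        case True
        then have "R - s \<le> norm (z - y)" using norm_triangle_ineq2[of z y] z by simp
        then show ?thesis using mult_left_mono[OF \<kappa>[OF t] f(1)[of y]] by (simp add: mult.commute)
      qed (simp add: f(2))
    qed
    then show ?thesis by (simp add: I_def)
  qed
  have ballX: "y \<in> X" if "norm y \<le> R" for y using that X by auto
  have fin: "u y < \<infinity>" if "norm y \<le> R" for y using u ballX[OF that] unfolding viscosity_subharmonic_def by blast
  have ux: "u x < \<infinity>" using fin x by simp
  have Weq: "(\<integral>y. heat_kernel T (x - y) * f y \<partial>lborel) = W T x" by (simp add: Wleb mult.commute)
  obtain w where w: "u x = ereal w" "w > \<kappa> * I - W T x"
    using neg ux unfolding Weq I_def[symmetric] by (cases "u x") auto
  define \<eta> where "\<eta> = w - \<kappa> * I + W T x"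
  have \<eta>: "\<eta> > 0" using w by (simp add: \<eta>_def)
  \<comment> \<open>The slope in time and the initial error each use up a quarter of the excess \<open>\<eta>\<close>.\<close>
  define \<mu> where "\<mu> = \<eta> / (4 * T)"
  have \<mu>: "\<mu> > 0" "\<mu> * T = \<eta> / 4" using \<eta> T by (auto simp: \<mu>_def)
  define t0 where "t0 = min (T / 2) ((\<eta> / (4 * (C1 + 1)))\<^sup>2)"
  have t0: "0 < t0" "t0 < T" using T \<eta> C1 by (auto simp: t0_def)
  define \<delta> where "\<delta> = C1 * sqrt t0"
  have \<delta>: "\<delta> \<le> \<eta> / 4"
  proof -
    have "sqrt t0 \<le> sqrt ((\<eta> / (4 * (C1 + 1)))\<^sup>2)" unfolding t0_def by (intro real_sqrt_le_mono) simp
    also have "\<dots> = \<eta> / (4 * (C1 + 1))" using \<eta> C1 by (simp add: abs_of_nonneg)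
    finally have "\<delta> \<le> C1 * (\<eta> / (4 * (C1 + 1)))" unfolding \<delta>_def using C1 by (rule mult_left_mono)
    also have "\<dots> \<le> \<eta> / 4" using \<eta> C1 by (simp add: field_simps)
    finally show ?thesis .
  qed
  define Q where "Q = cball (0::real^'n) R \<times> {t0..T}"
  define \<Psi> where "\<Psi> q = W (snd q) (fst q) - \<kappa> * I - \<mu> * snd q - \<delta>" for q :: "(real^'n) \<times> real"
  have "compact Q" unfolding Q_def by (intro compact_Times) auto
  have Wc: "continuous_on Q (\<lambda>q. W (snd q) (fst q))" unfolding W_def
  proof (rule integral_continuous_on_param)
    have "continuous_on (Q \<times> ?C) (\<lambda>z. f (snd z))"
      by (rule continuous_on_compose2[OF fc[of UNIV] continuous_on_snd]) (auto intro: continuous_on_id)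
    moreover have "continuous_on (Q \<times> ?C) (\<lambda>z. heat_kernel (snd (fst z)) (fst (fst z) - snd z))"
      unfolding heat_kernel_def using gauss_mass_pos[where 'a="real^'n"] t0
      by (auto intro!: continuous_intros simp: Q_def)
    ultimately show "continuous_on (Q \<times> ?C) (\<lambda>(q, y). f y *\<^sub>R heat_kernel (snd q) (fst q - y))"
      unfolding case_prod_unfold by (intro continuous_on_scaleR)
  qed
  have "upper_semicontinuous_on Q (\<lambda>q. u (fst q) + ereal (\<Psi> q))"
  proof (rule usc_add_continuous)
    show "upper_semicontinuous_on Q (\<lambda>q. u (fst q))"
      using u X by (intro usc_compose[of X u Q fst] continuous_intros)
        (auto simp: viscosity_subharmonic_def Q_def)
    show "u (fst q) < \<infinity>" if "q \<in> Q" for q using that by (intro fin) (auto simp: Q_def)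
    show "continuous_on Q \<Psi>" unfolding \<Psi>_def by (intro continuous_intros Wc)
  qed
  moreover have xQ: "(x, T) \<in> Q" using x t0 by (simp add: Q_def)
  ultimately obtain q where q: "q \<in> Q" "\<And>q'. q' \<in> Q \<Longrightarrow> u (fst q') + ereal (\<Psi> q') \<le> u (fst q) + ereal (\<Psi> q)"
    using usc_attains_max[OF \<open>compact Q\<close>] by blast
  obtain z t where qz: "q = (z, t)" by (cases q)
  have zt: "norm z \<le> R" "t0 \<le> t" "t \<le> T" using q(1) by (auto simp: qz Q_def)
  have "u x + ereal (\<Psi> (x, T)) = ereal (\<eta> - \<eta> / 4 - \<delta>)" by (simp add: w(1) \<Psi>_def \<eta>_def \<mu>(2))
  then have "ereal (\<eta> / 2) \<le> u x + ereal (\<Psi> (x, T))" using \<delta> by simp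
  also have "\<dots> \<le> u z + ereal (\<Psi> (z, t))" using q(2)[OF xQ] by (simp add: qz)
  finally have pos: "ereal (\<eta> / 2) \<le> u z + ereal (\<Psi> (z, t))" .
  have "u z < \<infinity>" using fin zt by simp
  then obtain v where v: "u z = ereal v" using pos by (cases "u z") auto
  have vpos: "v + \<Psi> (z, t) > 0" using pos \<eta> by (simp add: v)
  have v0: "v \<le> 0" using u0[of z] zt by (simp add: v)
  have "norm z \<noteq> R"
  proof
    assume "norm z = R"
    then have "W t z \<le> \<kappa> * I" using Wbdry zt t0 by simp
    moreover have "\<mu> * t > 0" "\<delta> \<ge> 0" using \<mu>(1) zt t0 C1 by (auto simp: \<delta>_def)
    ultimately show False using vpos v0 by (simp add: \<Psi>_def)
  qed
  then have zR: "z \<in> ball 0 R" using zt by simp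
  have \<kappa>I: "\<kappa> * I \<ge> 0"
  proof -
    define y where "y = (R - s) *\<^sub>R (axis undefined 1 :: real^'n)"
    have "norm y = R - s" using s by (simp add: y_def norm_axis_1)
    then have "heat_kernel T y \<le> \<kappa>" by (intro \<kappa> T) auto
    then have "\<kappa> \<ge> 0" using heat_kernel_nonneg[of T y] by linarith
    moreover have "I \<ge> 0" unfolding I_def using f(1) by simp
    ultimately show ?thesis by simp
  qed
  have "t \<noteq> t0"
  proof
    assume "t = t0"
    then have "W t z \<le> f z + \<delta>" using Winit[OF t0(1)] by (simp add: \<delta>_def)
    moreover have "v \<le> - f z" using f(2,3)[of z] v v0 by (cases "z \<in> ball 0 s") auto
    moreover have "\<mu> * t > 0" using \<mu>(1) zt t0 by simp
    ultimately show False using vpos \<kappa>I by (simp add: \<Psi>_def)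
  qed
  then have tt: "t0 < t" using zt by simp
  then have t_pos: "t > 0" using t0 by simp
  have "DW t z \<le> 0"
  proof -
    have "C2_on (ball 0 R) (\<lambda>x. (-1) * W t x + (v + W t z))
      (\<lambda>x. (-1) *\<^sub>R integral ?C (\<lambda>y. f y *\<^sub>R heat_gradient t (x - y)))
      (\<lambda>x. (-1) *\<^sub>R integral ?C (\<lambda>y. f y *\<^sub>R heat_hessian t (x - y)))"
      unfolding W_def by (intro C2_on_affine C2_on_convolution fc C2_on_heat_kernel t_pos)
    moreover have "u y \<le> ereal ((-1) * W t y + (v + W t z))" if "y \<in> ball 0 R" for y
    proof -
      have "(y, t) \<in> Q" using that zt by (simp add: Q_def)
      then have "u y + ereal (\<Psi> (y, t)) \<le> ereal (v + \<Psi> (z, t))" using q(2)[of "(y, t)"] by (simp add: qz v)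
      then show ?thesis by (cases "u y") (auto simp: \<Psi>_def)
    qed
    moreover have "u z = ereal ((-1) * W t z + (v + W t z))" by (simp add: v)
    moreover have "ball 0 R \<subseteq> X" using X by auto
    ultimately have "trace ((-1) *\<^sub>R integral ?C (\<lambda>y. f y *\<^sub>R heat_hessian t (z - y))) \<ge> 0"
      using u zR unfolding viscosity_subharmonic_def by (meson open_ball subsetD)
    then show ?thesis unfolding DW_def trace_scaleR by simp
  qed
  moreover have "DW t z \<ge> \<mu>"
  proof (rule ccontr)
    assume "\<not> DW t z \<ge> \<mu>"
    moreover have "((\<lambda>t. W t z - \<mu> * t) has_real_derivative DW t z - \<mu>) (at t)"
      using convolution_heat_equation[OF fc t_pos, of "-a" a z] unfolding W_def DW_def
      by (auto intro!: derivative_eq_intros)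
    ultimately obtain d where d: "d > 0" "\<And>h. h > 0 \<Longrightarrow> h < d \<Longrightarrow> W t z - \<mu> * t < W (t - h) z - \<mu> * (t - h)"
      using DERIV_neg_dec_left[of "\<lambda>t. W t z - \<mu> * t" "DW t z - \<mu>" t] by auto
    define h where "h = min (d / 2) (t - t0)"
    have h: "h > 0" "h < d" "t0 \<le> t - h" using d(1) tt by (auto simp: h_def)
    have "(z, t - h) \<in> Q" using zt h by (simp add: Q_def)
    then have "v + \<Psi> (z, t - h) \<le> v + \<Psi> (z, t)" using q(2)[of "(z, t - h)"] by (simp add: qz v)
    then show False using d(2)[OF h(1,2)] by (simp add: \<Psi>_def)
  qed
  ultimately show False using \<mu>(1) by simp
qed

section \<open>Heat averages and the weak Harnack inequality\<close>

text \<open>Infimal convolution of the truncation \<open>min k v\<close> with \<open>k * dist\<close>. Lower semicontinuity is what makes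
these functions increase to \<open>v\<close>.\<close>

lemma lsc_lipschitz_approximation:
  fixes v :: "'a::metric_space \<Rightarrow> ennreal"
  assumes lsc: "\<And>c. open {x. c < v x}"
  obtains f :: "nat \<Rightarrow> 'a \<Rightarrow> real" where
    "\<And>k x. 0 \<le> f k x" "\<And>k x y. \<bar>f k x - f k y\<bar> \<le> real k * dist x y"
    "\<And>x. incseq (\<lambda>k. f k x)" "\<And>x. (SUP k. ennreal (f k x)) = v x"
proof -
  define w where "w k y = enn2real (min (of_nat k) (v y))" for k y
  have wfin: "min (of_nat k) (v y) < \<infinity>" for k y
    by (rule le_less_trans[OF min.cobounded1]) (simp add: ennreal_of_nat_eq_real_of_nat)
  have w: "ennreal (w k y) = min (of_nat k) (v y)" for k y using wfin[of k y] by (simp add: w_def)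
  have w0: "0 \<le> w k y" for k y by (simp add: w_def)
  have wmono: "w k y \<le> w l y" if "k \<le> l" for k l y
    unfolding w_def using that wfin by (intro enn2real_mono min.mono) auto
  define f where "f k x = (INF y. w k y + real k * dist x y)" for k x
  have bdd: "bdd_below (range (\<lambda>y. w k y + real k * dist x y))" for k x
    by (rule bdd_belowI[of _ 0]) (use w0 in auto)
  have flow: "f k x \<le> w k y + real k * dist x y" for k x y
    unfolding f_def by (rule cINF_lower[OF bdd]) simp
  have fge: "c \<le> f k x" if "\<And>y. c \<le> w k y + real k * dist x y" for c k x
    unfolding f_def by (rule cINF_greatest) (use that in auto)
  show ?thesis
  proof (rule that[of f])
    show "0 \<le> f k x" for k x by (rule fge) (use w0 in auto)
    have one: "f k x - real k * dist x y \<le> f k y" for k x y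
    proof (rule fge)
      fix z
      have "real k * dist x z \<le> real k * (dist x y + dist y z)" by (intro mult_left_mono dist_triangle) simp
      then show "f k x - real k * dist x y \<le> w k z + real k * dist y z" using flow[of k x z] by (simp add: algebra_simps)
    qed
    show "\<bar>f k x - f k y\<bar> \<le> real k * dist x y" for k x y
      using one[of k x y] one[of k y x] by (simp add: dist_commute abs_le_iff)
    show "incseq (\<lambda>k. f k x)" for x
    proof (rule incseq_SucI, rule fge)
      fix k y
      have "f k x \<le> w k y + real k * dist x y" by (rule flow)
      also have "\<dots> \<le> w (Suc k) y + real (Suc k) * dist x y" using wmono[of k "Suc k" y] by (intro add_mono mult_right_mono) auto
      finally show "f k x \<le> w (Suc k) y + real (Suc k) * dist x y" .
    qed
    show "(SUP k. ennreal (f k x)) = v x" for x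
    proof (rule antisym)
      show "(SUP k. ennreal (f k x)) \<le> v x"
      proof (rule SUP_least)
        fix k
        have "ennreal (f k x) \<le> ennreal (w k x)" using flow[of k x x] by (intro ennreal_leI) simp
        also have "\<dots> \<le> v x" by (simp add: w)
        finally show "ennreal (f k x) \<le> v x" .
      qed
      show "v x \<le> (SUP k. ennreal (f k x))"
      proof (rule dense_le)
        fix c assume c: "c < v x"
        then have "c \<noteq> \<infinity>" by auto
        then obtain c' where c': "c' \<ge> 0" "c = ennreal c'" by (cases c) auto
        obtain d where d: "d > 0" "ball x d \<subseteq> {y. c < v y}" using lsc[of c] c unfolding open_contains_ball by blast
        obtain k where k: "max c' (c' / d) \<le> real k" using real_arch_simple by blast
        have "c' \<le> f k x"
        proof (rule fge)
          fix y
          show "c' \<le> w k y + real k * dist x y"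
          proof (cases "y \<in> ball x d")
            case True
            then have "c < v y" using d(2) by auto
            moreover have "c \<le> of_nat k" using k c' by (simp add: ennreal_of_nat_eq_real_of_nat)
            ultimately have "ennreal c' \<le> ennreal (w k y)" unfolding w c'(2) by simp
            then have "c' \<le> w k y" using w0 by (simp add: ennreal_le_iff)
            then show ?thesis by (simp add: add_increasing2)
          next
            case False
            then have "c' \<le> real k * d" using k d(1) by (simp add: pos_divide_le_eq)
            also have "\<dots> \<le> real k * dist x y" using False by (intro mult_left_mono) auto
            finally show ?thesis using w0[of k y] by simp
          qed
        qed
        then have "c \<le> ennreal (f k x)" unfolding c'(2) by (rule ennreal_leI)
        also have "\<dots> \<le> (SUP k. ennreal (f k x))" by (rule SUP_upper) simp
        finally show "c \<le> (SUP k. ennreal (f k x))" .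
      qed
    qed
  qed
qed

text \<open>For \<open>u \<le> 0\<close> on the ball this is the nonnegative function \<open>- u\<close>, possibly infinite, extended by \<open>0\<close>; so
integrals over the ball become integrals over the whole space, and the extension is still lower
semicontinuous.\<close>

definition neg_on_ball :: "real \<Rightarrow> ('a::real_normed_vector \<Rightarrow> ereal) \<Rightarrow> 'a \<Rightarrow> ennreal" where
  "neg_on_ball s u y = (if y \<in> ball 0 s then e2ennreal (- u y) else 0)"

lemma open_neg_on_ball:
  assumes u: "upper_semicontinuous_on X u" and X: "ball 0 s \<subseteq> X" and u0: "\<And>x. x \<in> ball 0 s \<Longrightarrow> u x \<le> 0"
  shows "open {x. c < neg_on_ball s u x}"
proof -
  have "c < neg_on_ball s u x \<longleftrightarrow> x \<in> ball 0 s \<and> u x < - enn2ereal c" for x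
  proof (cases "x \<in> ball 0 s")
    case True
    then have "c < neg_on_ball s u x \<longleftrightarrow> enn2ereal c < - u x"
      using u0[OF True] by (simp add: neg_on_ball_def less_ennreal.rep_eq enn2ereal_e2ennreal)
    also have "\<dots> \<longleftrightarrow> u x < - enn2ereal c" by (rule ereal_less_uminus_reorder)
    finally show ?thesis using True by simp
  qed (simp add: neg_on_ball_def)
  then have "{x. c < neg_on_ball s u x} = {x\<in>ball 0 s. u x < - enn2ereal c}" by auto
  moreover have "openin (top_of_set (ball 0 s)) {x\<in>ball 0 s. u x < - enn2ereal c}"
    using usc_subset[OF u X] by (auto simp: upper_semicontinuous_on_def)
  ultimately show ?thesis using openin_open_trans by fastforce
qed

lemma borel_measurable_neg_on_ball:
  fixes u :: "'a::euclidean_space \<Rightarrow> ereal"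
  assumes u: "upper_semicontinuous_on X u" and X: "ball 0 s \<subseteq> X" and u0: "\<And>x. x \<in> ball 0 s \<Longrightarrow> u x \<le> 0"
  shows "neg_on_ball s u \<in> borel_measurable borel"
  by (rule borel_measurableI_greater) (use open_neg_on_ball[OF assms] in auto)

text \<open>Lipschitz functions that increase to \<open>- u\<close> on the small ball are admissible initial values for
\<open>heat_comparison\<close>. They are kept explicit because the weak Harnack inequality needs the difference of
the two integrals before the limit, when both are finite.\<close>

lemma heat_comparison_approximation:
  fixes u :: "real^'n \<Rightarrow> ereal"
  assumes u: "viscosity_subharmonic X u" and X: "cball 0 R \<subseteq> X"
    and u0: "\<And>x. x \<in> cball 0 R \<Longrightarrow> u x \<le> 0" and s: "0 < s" "s < R"
  obtains f :: "nat \<Rightarrow> real^'n \<Rightarrow> real" where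
    "\<And>k y. 0 \<le> f k y" "\<And>k y. y \<notin> ball 0 s \<Longrightarrow> f k y = 0" "\<And>k. integrable lborel (f k)"
    "\<And>k. continuous_on UNIV (f k)"
    "\<And>y. incseq (\<lambda>k. f k y)" "\<And>y. (SUP k. ennreal (f k y)) = neg_on_ball s u y"
    "\<And>k T \<kappa> x. T > 0 \<Longrightarrow> (\<forall>t z. 0 < t \<and> t \<le> T \<and> R - s \<le> norm z \<longrightarrow> heat_kernel t (z::real^'n) \<le> \<kappa>) \<Longrightarrow>
       x \<in> ball 0 R \<Longrightarrow>
       u x \<le> ereal (\<kappa> * (\<integral>y. f k y \<partial>lborel) - (\<integral>y. heat_kernel T (x - y) * f k y \<partial>lborel))"
proof -
  have sR: "ball 0 s \<subseteq> cball (0::real^'n) R" using s by auto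
  have lsc: "open {x. c < neg_on_ball s u x}" for c
  proof (rule open_neg_on_ball)
    show "upper_semicontinuous_on X u" using u by (simp add: viscosity_subharmonic_def)
  qed (use u0 X sR in blast)+
  obtain f where f: "\<And>k x. 0 \<le> f k x" "\<And>k x y. \<bar>f k x - f k y\<bar> \<le> real k * dist x y"
    "\<And>x. incseq (\<lambda>k. f k x)" "\<And>x. (SUP k. ennreal (f k x)) = neg_on_ball s u x"
    using lsc_lipschitz_approximation[OF lsc] by blast
  have le: "ennreal (f k y) \<le> neg_on_ball s u y" for k y unfolding f(4)[symmetric] by (rule SUP_upper) simp
  have off: "f k y = 0" if "y \<notin> ball 0 s" for k y
    using le[of k y] f(1)[of k y] that by (auto simp: neg_on_ball_def ennreal_eq_0_iff)
  have on: "u y \<le> ereal (- f k y)" if y: "y \<in> ball 0 s" for k y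
  proof -
    have "u y \<le> 0" using u0 y sR by blast
    then have "ereal (f k y) \<le> - u y"
      using le[of k y] y f(1)[of k y]
      by (simp add: neg_on_ball_def less_eq_ennreal.rep_eq enn2ereal_e2ennreal enn2ereal_ennreal)
    then show ?thesis by (cases "u y") auto
  qed
  have fc: "continuous_on UNIV (f k)" for k
    by (rule lipschitz_on_continuous_on[of "real k"], rule lipschitz_onI) (use f(2) in \<open>auto simp: dist_real_def\<close>)
  have fint: "integrable lborel (f k)" for k
  proof -
    have "integrable lborel (\<lambda>y. indicator (cball 0 R) y *\<^sub>R f k y)"
      by (intro borel_integrable_compact compact_cball continuous_on_subset[OF fc]) auto
    moreover have "indicator (cball 0 R) y *\<^sub>R f k y = f k y" for y
      using off[of y k] s by (auto simp: indicator_def)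
    ultimately show ?thesis by (simp only:)
  qed
  show ?thesis
  proof (rule that[OF f(1) off fint fc f(3,4)])
    fix k :: nat and T \<kappa> :: real and x :: "real^'n" assume T: "T > 0" and x: "x \<in> ball 0 R"
      and \<kappa>: "\<forall>t z. 0 < t \<and> t \<le> T \<and> R - s \<le> norm z \<longrightarrow> heat_kernel t (z::real^'n) \<le> \<kappa>"
    show "u x \<le> ereal (\<kappa> * (\<integral>y. f k y \<partial>lborel) - (\<integral>y. heat_kernel T (x - y) * f k y \<partial>lborel))"
      by (rule heat_comparison[OF u X u0 s _ _ f(1) off on T _ x, of "real k"])
        (use f(2) \<kappa> in \<open>auto simp: dist_norm\<close>)
  qed
qed

lemma integrable_heat_kernel_mult:
  fixes f :: "'a::euclidean_space \<Rightarrow> real"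
  assumes "T > 0" and f: "integrable lborel f"
  shows "integrable lborel (\<lambda>y. heat_kernel T (x - y) * f y)"
proof (rule Bochner_Integration.integrable_bound)
  show "integrable lborel (\<lambda>y. heat_kernel T (0::'a) * f y)" using f by simp
  show "(\<lambda>y. heat_kernel T (x - y) * f y) \<in> borel_measurable lborel" using f by measurable
  show "AE y in lborel. norm (heat_kernel T (x - y) * f y) \<le> norm (heat_kernel T (0::'a) * f y)"
    by (intro AE_I2) (auto simp: abs_mult heat_kernel_nonneg intro!: mult_right_mono heat_kernel_antimono assms)
qed

text \<open>A nonnegative superharmonic function lies above its heat average, up to the small multiple \<open>\<kappa>\<close> of its
integral.\<close>

lemma heat_supermean:
  fixes u :: "real^'n \<Rightarrow> ereal"
  assumes u: "viscosity_subharmonic X u" and X: "cball 0 R \<subseteq> X"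
    and u0: "\<And>x. x \<in> cball 0 R \<Longrightarrow> u x \<le> 0" and s: "0 < s" "s < R"
    and T: "T > 0" and \<kappa>: "\<And>t z. 0 < t \<Longrightarrow> t \<le> T \<Longrightarrow> R - s \<le> norm z \<Longrightarrow> heat_kernel t (z::real^'n) \<le> \<kappa>"
    and \<kappa>0: "\<kappa> \<ge> 0" and x: "x \<in> ball 0 R"
  shows "(\<integral>\<^sup>+y. ennreal (heat_kernel T (x - y)) * neg_on_ball s u y \<partial>lborel)
     \<le> e2ennreal (- u x) + ennreal \<kappa> * (\<integral>\<^sup>+y. neg_on_ball s u y \<partial>lborel)"
proof -
  obtain f where f: "\<And>k y. 0 \<le> f k y" "\<And>k y. y \<notin> ball 0 s \<Longrightarrow> f k y = 0" "\<And>k. integrable lborel (f k)"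
    "\<And>k. continuous_on UNIV (f k)"
    "\<And>y. incseq (\<lambda>k. f k y)" "\<And>y. (SUP k. ennreal (f k y)) = neg_on_ball s u y"
    and cmp0: "\<And>k T \<kappa> x. T > 0 \<Longrightarrow> (\<forall>t z. 0 < t \<and> t \<le> T \<and> R - s \<le> norm z \<longrightarrow> heat_kernel t (z::real^'n) \<le> \<kappa>) \<Longrightarrow>
       x \<in> ball 0 R \<Longrightarrow>
       u x \<le> ereal (\<kappa> * (\<integral>y. f k y \<partial>lborel) - (\<integral>y. heat_kernel T (x - y) * f k y \<partial>lborel))"
    using heat_comparison_approximation[OF u X u0 s] by blast
  note f = f(1,3,5,6)
  have cmp: "u x \<le> ereal (\<kappa> * (\<integral>y. f k y \<partial>lborel) - (\<integral>y. heat_kernel T (x - y) * f k y \<partial>lborel))" for k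
    by (rule cmp0[OF T _ x]) (use \<kappa> in blast)
  have fm[measurable]: "f k \<in> borel_measurable borel" for k using f(2)[of k] by auto
  have "(\<integral>\<^sup>+y. ennreal (heat_kernel T (x - y)) * ennreal (f k y) \<partial>lborel)
     \<le> e2ennreal (- u x) + ennreal \<kappa> * (\<integral>\<^sup>+y. neg_on_ball s u y \<partial>lborel)" for k
  proof -
    have "(\<integral>\<^sup>+y. ennreal (heat_kernel T (x - y)) * ennreal (f k y) \<partial>lborel)
        = ennreal (\<integral>y. heat_kernel T (x - y) * f k y \<partial>lborel)"
      by (subst nn_integral_eq_integral[symmetric, OF integrable_heat_kernel_mult[OF T f(2)]])
        (simp_all add: ennreal_mult heat_kernel_nonneg f(1))
    also have "\<dots> \<le> e2ennreal (- u x) + ennreal (\<kappa> * (\<integral>y. f k y \<partial>lborel))"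
    proof (cases "u x")
      case (real w)
      have "w \<le> 0" using u0[of x] x real by simp
      have "(\<integral>y. heat_kernel T (x - y) * f k y \<partial>lborel) \<le> - w + \<kappa> * (\<integral>y. f k y \<partial>lborel)" using cmp[of k] real by simp
      then have "ennreal (\<integral>y. heat_kernel T (x - y) * f k y \<partial>lborel) \<le> ennreal (- w + \<kappa> * (\<integral>y. f k y \<partial>lborel))"
        by (rule ennreal_leI)
      also have "\<dots> = ennreal (- w) + ennreal (\<kappa> * (\<integral>y. f k y \<partial>lborel))"
        using \<open>w \<le> 0\<close> \<kappa>0 f(1) by (intro ennreal_plus) auto
      finally show ?thesis using real by (simp add: e2ennreal_ereal)
    next
      case PInf
      then show ?thesis using u0[of x] x by simp
    next
      case MInf
      then show ?thesis by (simp add: e2ennreal_infty)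
    qed
    also have "ennreal (\<kappa> * (\<integral>y. f k y \<partial>lborel)) = ennreal \<kappa> * (\<integral>\<^sup>+y. ennreal (f k y) \<partial>lborel)"
      using f(1) \<kappa>0 by (subst nn_integral_eq_integral[OF f(2)]) (auto simp: ennreal_mult)
    also have "\<dots> \<le> ennreal \<kappa> * (\<integral>\<^sup>+y. neg_on_ball s u y \<partial>lborel)"
      unfolding f(4)[symmetric] by (intro mult_left_mono nn_integral_mono SUP_upper) auto
    finally show ?thesis by (simp add: add_left_mono)
  qed
  then have "(SUP k. \<integral>\<^sup>+y. ennreal (heat_kernel T (x - y)) * ennreal (f k y) \<partial>lborel)
     \<le> e2ennreal (- u x) + ennreal \<kappa> * (\<integral>\<^sup>+y. neg_on_ball s u y \<partial>lborel)" by (intro SUP_least)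
  moreover have "(SUP k. \<integral>\<^sup>+y. ennreal (heat_kernel T (x - y)) * ennreal (f k y) \<partial>lborel)
      = (\<integral>\<^sup>+y. (SUP k. ennreal (heat_kernel T (x - y)) * ennreal (f k y)) \<partial>lborel)"
    using f(3) by (intro nn_integral_monotone_convergence_SUP[symmetric])
      (auto simp: incseq_def le_fun_def intro!: mult_left_mono ennreal_leI)
  moreover have "(SUP k. ennreal (heat_kernel T (x - y)) * ennreal (f k y))
      = ennreal (heat_kernel T (x - y)) * neg_on_ball s u y" for y
    unfolding f(4)[symmetric] by (rule SUP_mult_left_ennreal[symmetric])
  ultimately show ?thesis by simp
qed

lemma heat_kernel_far_bound:
  fixes z :: "'a::euclidean_space"
  assumes "0 < t" "t \<le> T" "0 < d" "2 * real DIM('a) * T \<le> d\<^sup>2" "norm (w :: 'a) = d" "d \<le> norm z"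
  shows "heat_kernel t z \<le> heat_kernel T w"
proof -
  have "heat_kernel t z \<le> heat_kernel t w" using assms by (intro heat_kernel_antimono) auto
  also have "\<dots> \<le> heat_kernel T w" using assms by (intro heat_kernel_mono_time) (auto simp: power2_norm_eq_inner[symmetric])
  finally show ?thesis .
qed

text \<open>In \<open>heat_comparison\<close> the weight of \<open>f y\<close> is the heat kernel at \<open>x - y\<close>, minus the bound \<open>\<kappa>\<close> for the
heat kernel at the distance of the outer sphere. Points of the inner ball are closer to each other
than to the outer sphere, and so the weight is at least a positive constant \<open>c\<close> at a suitable time.\<close>

lemma weak_harnack:
  assumes s: "s > 0"
  obtains c where "c > 0"
    "\<And>X u x. viscosity_subharmonic X (u :: real^'n \<Rightarrow> ereal) \<Longrightarrow> cball 0 (4 * s) \<subseteq> X \<Longrightarrow>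
       (\<forall>x\<in>cball 0 (4 * s). u x \<le> 0) \<Longrightarrow> x \<in> ball 0 s \<Longrightarrow>
       ennreal c * (\<integral>\<^sup>+y. neg_on_ball s u y \<partial>lborel) \<le> e2ennreal (- u x)"
proof -
  \<comment> \<open>Until this time the kernel increases at distance \<open>3 * s\<close>, which is the distance between the ball of
    radius \<open>s\<close> and the sphere of radius \<open>4 * s\<close>; two points of the ball have distance below \<open>2 * s\<close>.\<close>
  define T where "T = (3 * s)\<^sup>2 / (2 * real DIM(real^'n))"
  have T: "T > 0" "2 * real DIM(real^'n) * T \<le> (3 * s)\<^sup>2" using s by (auto simp: T_def)
  define e1 :: "real^'n" where "e1 = axis undefined 1"
  define a b where "a = (2 * s) *\<^sub>R e1" and "b = (3 * s) *\<^sub>R e1"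
  have ab: "norm a = 2 * s" "norm b = 3 * s" using s by (auto simp: a_def b_def e1_def norm_axis_1)
  define c where "c = heat_kernel T a - heat_kernel T b"
  have c: "c > 0" unfolding c_def using heat_kernel_strict_antimono[OF T(1), of a b] ab s by simp
  show ?thesis
  proof (rule that[OF c])
    fix X and u :: "real^'n \<Rightarrow> ereal" and x :: "real^'n"
    assume u: "viscosity_subharmonic X u" and X: "cball 0 (4 * s) \<subseteq> X"
      and u0': "\<forall>x\<in>cball 0 (4 * s). u x \<le> 0" and x: "x \<in> ball 0 s"
    have u0: "\<And>x. x \<in> cball 0 (4 * s) \<Longrightarrow> u x \<le> 0" using u0' by blast
    have ss: "s < 4 * s" and x4: "x \<in> ball 0 (4 * s)" using s x by auto
    have far: "heat_kernel t z \<le> heat_kernel T b" if "0 < t" "t \<le> T" "4 * s - s \<le> norm z" for t and z :: "real^'n"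
      using that s ab T by (intro heat_kernel_far_bound[of t T "3 * s"]) auto
    obtain f where f: "\<And>k y. 0 \<le> f k y" "\<And>k y. y \<notin> ball 0 s \<Longrightarrow> f k y = 0" "\<And>k. integrable lborel (f k)"
      "\<And>k. continuous_on UNIV (f k)"
      "\<And>y. incseq (\<lambda>k. f k y)" "\<And>y. (SUP k. ennreal (f k y)) = neg_on_ball s u y"
      and cmp0: "\<And>k T \<kappa> x. T > 0 \<Longrightarrow> (\<forall>t z. 0 < t \<and> t \<le> T \<and> 4 * s - s \<le> norm z \<longrightarrow> heat_kernel t (z::real^'n) \<le> \<kappa>) \<Longrightarrow>
         x \<in> ball 0 (4 * s) \<Longrightarrow>
         u x \<le> ereal (\<kappa> * (\<integral>y. f k y \<partial>lborel) - (\<integral>y. heat_kernel T (x - y) * f k y \<partial>lborel))"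
      using heat_comparison_approximation[OF u X u0 s ss] by blast
    note f = f(1,2,3,5,6)
    have cmp: "u x \<le> ereal (heat_kernel T b * (\<integral>y. f k y \<partial>lborel) - (\<integral>y. heat_kernel T (x - y) * f k y \<partial>lborel))" for k
      by (rule cmp0[OF T(1) _ x4]) (use far in blast)
    have fm[measurable]: "f k \<in> borel_measurable borel" for k using f(3)[of k] by auto
    have "ennreal c * (\<integral>\<^sup>+y. ennreal (f k y) \<partial>lborel) \<le> e2ennreal (- u x)" for k
    proof -
      have "heat_kernel T a * (\<integral>y. f k y \<partial>lborel) \<le> (\<integral>y. heat_kernel T (x - y) * f k y \<partial>lborel)"
      proof (subst integral_mult_right_zero[symmetric], rule integral_mono)
        fix y
        show "heat_kernel T a * f k y \<le> heat_kernel T (x - y) * f k y"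
        proof (cases "y \<in> ball 0 s")
          case True
          then have "norm (x - y) \<le> norm a" using norm_triangle_ineq4[of x y] x ab by simp
          then show ?thesis by (intro mult_right_mono f(1) heat_kernel_antimono T(1))
        qed (simp add: f(2))
      qed (use f(3) integrable_heat_kernel_mult[OF T(1) f(3)] in auto)
      then have "heat_kernel T b * (\<integral>y. f k y \<partial>lborel) - (\<integral>y. heat_kernel T (x - y) * f k y \<partial>lborel)
          \<le> - (c * (\<integral>y. f k y \<partial>lborel))" by (simp add: c_def algebra_simps)
      then have "u x \<le> ereal (- (c * (\<integral>y. f k y \<partial>lborel)))" using cmp[of k] by (meson ereal_less_eq(3) order_trans)
      then have "ereal (c * (\<integral>y. f k y \<partial>lborel)) \<le> - u x" by (cases "u x") auto
      then have "e2ennreal (ereal (c * (\<integral>y. f k y \<partial>lborel))) \<le> e2ennreal (- u x)" by (rule e2ennreal_mono)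
      moreover have "ennreal c * (\<integral>\<^sup>+y. ennreal (f k y) \<partial>lborel) = ennreal (c * (\<integral>y. f k y \<partial>lborel))"
        using f(1) c by (subst nn_integral_eq_integral[OF f(3)]) (auto simp: ennreal_mult)
      ultimately show ?thesis by (simp add: e2ennreal_ereal)
    qed
    then have "(SUP k. ennreal c * (\<integral>\<^sup>+y. ennreal (f k y) \<partial>lborel)) \<le> e2ennreal (- u x)" by (intro SUP_least)
    moreover have "(SUP k. \<integral>\<^sup>+y. ennreal (f k y) \<partial>lborel) = (\<integral>\<^sup>+y. neg_on_ball s u y \<partial>lborel)"
      unfolding f(5)[symmetric] using f(4)
      by (intro nn_integral_monotone_convergence_SUP[symmetric]) (auto simp: incseq_def le_fun_def intro!: ennreal_leI)
    ultimately show "ennreal c * (\<integral>\<^sup>+y. neg_on_ball s u y \<partial>lborel) \<le> e2ennreal (- u x)"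
      by (simp add: SUP_mult_left_ennreal[symmetric])
  qed
qed

section \<open>Heat averages are close in the mean\<close>

text \<open>By assumption \<open>v - P + \<kappa>\<close> is nonnegative on the large ball, where \<open>P\<close> is the heat average of \<open>v\<close>. A
nonnegative function has an \<open>L\<^sup>1\<close> norm equal to its integral, so it suffices to integrate it against a
cutoff \<open>\<theta>\<close>. Fubini moves the heat average from \<open>v\<close> to \<open>\<theta>\<close>, which is Lipschitz and therefore hardly
changed by the heat flow.\<close>

lemma smoothing_estimate:
  fixes v :: "'a::euclidean_space \<Rightarrow> real"
  assumes v: "integrable lborel v" "\<And>y. 0 \<le> v y" and supp: "\<And>y. y \<notin> ball 0 s \<Longrightarrow> v y = 0"
    and T: "T > 0" and m: "0 < m" "m < s" and \<kappa>: "\<kappa> \<ge> 0"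
    and super: "AE x in lborel. x \<in> ball 0 s \<longrightarrow> (\<integral>y. heat_kernel T (x - y) * v y \<partial>lborel) \<le> v x + \<kappa>"
  shows "(\<integral>\<^sup>+x. ennreal \<bar>v x - (\<integral>y. heat_kernel T (x - y) * v y \<partial>lborel)\<bar> * indicator (ball 0 m) x \<partial>lborel)
     \<le> ennreal ((\<integral>y. v y \<partial>lborel) * (sqrt T * gauss_first_moment TYPE('a) / (s - m)) + 2 * \<kappa> * measure lborel (ball (0::'a) s))"
proof -
  define P where "P x = (\<integral>y. heat_kernel T (x - y) * v y \<partial>lborel)" for x
  define \<theta> where "\<theta> x = max 0 (min 1 ((s - norm x) / (s - m)))" for x :: 'a
  have vm[measurable]: "v \<in> borel_measurable borel" using v(1) by auto
  have \<theta>m[measurable]: "\<theta> \<in> borel_measurable borel" unfolding \<theta>_def by measurable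
  have \<theta>01: "0 \<le> \<theta> x" "\<theta> x \<le> 1" for x by (auto simp: \<theta>_def)
  have \<theta>in: "\<theta> x = 1" if "x \<in> ball 0 m" for x using that m by (auto simp: \<theta>_def)
  have \<theta>out: "\<theta> x = 0" if "x \<notin> ball 0 s" for x using that m by (auto simp: \<theta>_def divide_nonpos_pos)
  have \<theta>L: "\<bar>\<theta> x - \<theta> y\<bar> \<le> (1 / (s - m)) * norm (y - x)" for x y
  proof -
    have "\<bar>\<theta> x - \<theta> y\<bar> \<le> \<bar>(s - norm x) / (s - m) - (s - norm y) / (s - m)\<bar>" unfolding \<theta>_def by linarith
    also have "\<dots> = \<bar>norm y - norm x\<bar> / (s - m)" using m by (simp add: diff_divide_distrib[symmetric])
    also have "\<dots> \<le> norm (y - x) / (s - m)" using m by (intro divide_right_mono norm_triangle_ineq3) simp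
    finally show ?thesis by simp
  qed
  have \<theta>int: "integrable lborel \<theta>"
  proof (rule Bochner_Integration.integrable_bound)
    show "integrable lborel (indicator (ball (0::'a) s) :: 'a \<Rightarrow> real)"
      using emeasure_lborel_ball_finite[of "0::'a" s] by simp
    show "AE x in lborel. norm (\<theta> x) \<le> norm (indicator (ball 0 s) x :: real)"
      by (rule AE_I2) (use \<theta>01 \<theta>out in \<open>auto simp: indicator_def simp del: mem_ball\<close>)
  qed simp
  have \<theta>le: "(\<integral>x. \<theta> x \<partial>lborel) \<le> measure lborel (ball (0::'a) s)"
  proof -
    have "(\<integral>x. \<theta> x \<partial>lborel) \<le> (\<integral>x. indicator (ball (0::'a) s) x \<partial>lborel)"
    proof (rule Bochner_Integration.integral_mono[OF \<theta>int])
      show "integrable lborel (indicator (ball (0::'a) s) :: 'a \<Rightarrow> real)"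
        using emeasure_lborel_ball_finite[of "0::'a" s] by simp
      show "\<theta> x \<le> indicator (ball 0 s) x" for x
        using \<theta>01(2)[of x] \<theta>out[of x] by (auto simp: indicator_def simp del: mem_ball)
    qed
    then show ?thesis by simp
  qed
  have hkb: "0 \<le> heat_kernel T z" "heat_kernel T z \<le> heat_kernel T (0::'a)" for z :: 'a
    by (auto intro!: heat_kernel_nonneg heat_kernel_antimono T)
  define q where "q y = (\<integral>x. heat_kernel T (y - x) * \<theta> x \<partial>lborel)" for y
  have qint: "integrable lborel (\<lambda>x. heat_kernel T (y - x) * \<theta> x)" for y
    by (rule integrable_heat_kernel_mult[OF T \<theta>int])
  have q: "\<bar>q y - \<theta> y\<bar> \<le> (1 / (s - m)) * (sqrt T * gauss_first_moment TYPE('a))" for y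
    unfolding q_def by (rule heat_kernel_approximation[OF T qint]) (rule \<theta>L)
  have q0: "0 \<le> q y" for y unfolding q_def using hkb(1) \<theta>01(1) by (intro Bochner_Integration.integral_nonneg) auto
  define G where "G y x = v y * (heat_kernel T (y - x) * \<theta> x)" for y x
  have Gm[measurable]: "case_prod G \<in> borel_measurable (lborel \<Otimes>\<^sub>M lborel)" unfolding G_def by measurable
  have qm[measurable]: "q \<in> borel_measurable borel" unfolding q_def by measurable
  have q1: "q y \<le> 1 + (1 / (s - m)) * (sqrt T * gauss_first_moment TYPE('a))" for y
    using q[of y] \<theta>01(2)[of y] by (simp add: abs_le_iff)
  have vq: "integrable lborel (\<lambda>y. v y * q y)"
  proof (rule Bochner_Integration.integrable_bound)
    show "integrable lborel (\<lambda>y. (1 + (1 / (s - m)) * (sqrt T * gauss_first_moment TYPE('a))) * v y)" using v(1) by simp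
    show "AE y in lborel. norm (v y * q y) \<le> norm ((1 + (1 / (s - m)) * (sqrt T * gauss_first_moment TYPE('a))) * v y)"
    proof (rule AE_I2)
      fix y
      have "v y * q y \<le> v y * (1 + (1 / (s - m)) * (sqrt T * gauss_first_moment TYPE('a)))" by (intro mult_left_mono q1 v(2))
      moreover have "0 \<le> v y * q y" using v(2) q0 by simp
      ultimately show "norm (v y * q y) \<le> norm ((1 + (1 / (s - m)) * (sqrt T * gauss_first_moment TYPE('a))) * v y)"
        unfolding real_norm_def by (simp only: mult.commute)
    qed
  qed measurable
  have Gint: "integrable (lborel \<Otimes>\<^sub>M lborel) (case_prod G)"
  proof (rule lborel_pair.Fubini_integrable)
    have "(\<integral>x. norm (case_prod G (y, x)) \<partial>lborel) = v y * q y" for y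
      using v(2) hkb(1) \<theta>01(1) by (simp add: G_def q_def abs_mult)
    then show "integrable lborel (\<lambda>y. \<integral>x. norm (case_prod G (y, x)) \<partial>lborel)" using vq by simp
    show "AE y in lborel. integrable lborel (\<lambda>x. case_prod G (y, x))" using qint by (simp add: G_def)
  qed (rule Gm)
  \<comment> \<open>Symmetry of the kernel identifies the two iterated integrals.\<close>
  have swap: "(\<integral>x. \<theta> x * P x \<partial>lborel) = (\<integral>y. v y * q y \<partial>lborel)"
  proof -
    have "(\<integral>x. (\<integral>y. G y x \<partial>lborel) \<partial>lborel) = (\<integral>y. (\<integral>x. G y x \<partial>lborel) \<partial>lborel)"
      by (rule lborel_pair.Fubini_integral[OF Gint])
    moreover have "(\<integral>x. G y x \<partial>lborel) = v y * q y" for y by (simp add: G_def q_def)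
    moreover have "(\<integral>y. G y x \<partial>lborel) = \<theta> x * P x" for x
    proof -
      have "(\<integral>y. G y x \<partial>lborel) = (\<integral>y. \<theta> x * (heat_kernel T (x - y) * v y) \<partial>lborel)"
        by (intro Bochner_Integration.integral_cong) (auto simp: G_def heat_kernel_minus[of T _ x] mult_ac)
      then show ?thesis by (simp add: P_def)
    qed
    ultimately show ?thesis by simp
  qed
  have Pm[measurable]: "P \<in> borel_measurable borel" unfolding P_def by measurable
  have \<theta>P: "integrable lborel (\<lambda>x. \<theta> x * P x)"
  proof -
    have "integrable lborel (\<lambda>x. \<integral>y. G y x \<partial>lborel)"
      using lborel_pair.integrable_snd[OF Gint] .
    moreover have "(\<integral>y. G y x \<partial>lborel) = \<theta> x * P x" for x
    proof -
      have "(\<integral>y. G y x \<partial>lborel) = (\<integral>y. \<theta> x * (heat_kernel T (x - y) * v y) \<partial>lborel)"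
        by (intro Bochner_Integration.integral_cong) (auto simp: G_def heat_kernel_minus[of T _ x] mult_ac)
      then show ?thesis by (simp add: P_def)
    qed
    ultimately show ?thesis by simp
  qed
  have \<theta>v: "integrable lborel (\<lambda>x. \<theta> x * v x)"
    by (rule Bochner_Integration.integrable_bound[OF v(1)])
      (use \<theta>01 v(2) in \<open>auto simp: abs_mult intro!: mult_left_le_one_le\<close>)
  define h where "h x = \<theta> x * v x - \<theta> x * P x + 2 * \<kappa> * \<theta> x" for x
  have hint: "integrable lborel h" unfolding h_def using \<theta>v \<theta>P \<theta>int by auto
  have pt: "x \<in> ball 0 s \<longrightarrow> P x \<le> v x + \<kappa> \<Longrightarrow> \<bar>v x - P x\<bar> * indicator (ball 0 m) x \<le> h x \<and> 0 \<le> h x" for x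
  proof (cases "x \<in> ball 0 s")
    case True
    assume "x \<in> ball 0 s \<longrightarrow> P x \<le> v x + \<kappa>"
    then have le: "P x \<le> v x + \<kappa>" using True by simp
    have h: "h x = \<theta> x * (v x - P x + 2 * \<kappa>)" by (simp add: h_def algebra_simps)
    have "0 \<le> h x" unfolding h using le \<kappa> \<theta>01 by (intro mult_nonneg_nonneg) auto
    moreover have "\<bar>v x - P x\<bar> \<le> h x" if "x \<in> ball 0 m" unfolding h \<theta>in[OF that] using le \<kappa> by simp
    ultimately show ?thesis by (cases "x \<in> ball 0 m") (auto simp: indicator_def simp del: mem_ball)
  next
    case False
    then have "x \<notin> ball 0 m" using m by auto
    then show ?thesis using \<theta>out[OF False] by (simp add: h_def)
  qed
  have ae: "AE x in lborel. \<bar>v x - P x\<bar> * indicator (ball 0 m) x \<le> h x \<and> 0 \<le> h x"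
    using super unfolding P_def[symmetric] by (rule eventually_mono) (rule pt)
  have "(\<integral>\<^sup>+x. ennreal \<bar>v x - P x\<bar> * indicator (ball 0 m) x \<partial>lborel) \<le> (\<integral>\<^sup>+x. ennreal (h x) \<partial>lborel)"
  proof (rule nn_integral_mono_AE)
    show "AE x in lborel. ennreal \<bar>v x - P x\<bar> * indicator (ball 0 m) x \<le> ennreal (h x)"
      using ae by (rule eventually_mono) (auto simp: indicator_def ennreal_leI split: if_splits)
  qed
  also have "\<dots> = ennreal (\<integral>x. h x \<partial>lborel)"
    using ae by (intro nn_integral_eq_integral[OF hint]) (auto elim: eventually_mono)
  also have "\<dots> \<le> ennreal ((\<integral>y. v y \<partial>lborel) * (sqrt T * gauss_first_moment TYPE('a) / (s - m)) + 2 * \<kappa> * measure lborel (ball (0::'a) s))"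
  proof (rule ennreal_leI)
    have "(\<integral>x. h x \<partial>lborel) = (\<integral>x. \<theta> x * v x \<partial>lborel) - (\<integral>x. \<theta> x * P x \<partial>lborel) + 2 * \<kappa> * (\<integral>x. \<theta> x \<partial>lborel)"
      unfolding h_def using \<theta>v \<theta>P \<theta>int by simp
    also have "(\<integral>x. \<theta> x * v x \<partial>lborel) - (\<integral>x. \<theta> x * P x \<partial>lborel) = (\<integral>x. v x * (\<theta> x - q x) \<partial>lborel)"
      unfolding swap using \<theta>v vq by (subst Bochner_Integration.integral_diff[symmetric]) (auto simp: algebra_simps)
    also have "\<dots> \<le> (\<integral>x. v x * ((1 / (s - m)) * (sqrt T * gauss_first_moment TYPE('a))) \<partial>lborel)"
    proof (rule integral_mono)
      show "integrable lborel (\<lambda>x. v x * (\<theta> x - q x))"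
        using Bochner_Integration.integrable_diff[OF \<theta>v vq] by (simp add: algebra_simps)
      show "integrable lborel (\<lambda>x. v x * ((1 / (s - m)) * (sqrt T * gauss_first_moment TYPE('a))))" using v(1) by simp
      show "v x * (\<theta> x - q x) \<le> v x * ((1 / (s - m)) * (sqrt T * gauss_first_moment TYPE('a)))" for x
        using q[of x] by (intro mult_left_mono v(2)) (simp add: abs_le_iff)
    qed
    also have "\<dots> = (\<integral>y. v y \<partial>lborel) * (sqrt T * gauss_first_moment TYPE('a) / (s - m))" by simp
    finally have "(\<integral>x. h x \<partial>lborel) \<le> (\<integral>y. v y \<partial>lborel) * (sqrt T * gauss_first_moment TYPE('a) / (s - m)) + 2 * \<kappa> * (\<integral>x. \<theta> x \<partial>lborel)" by simp
    also have "2 * \<kappa> * (\<integral>x. \<theta> x \<partial>lborel) \<le> 2 * \<kappa> * measure lborel (ball (0::'a) s)"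
      using \<theta>le \<kappa> by (intro mult_left_mono) auto
    finally show "(\<integral>x. h x \<partial>lborel) \<le> (\<integral>y. v y \<partial>lborel) * (sqrt T * gauss_first_moment TYPE('a) / (s - m)) + 2 * \<kappa> * measure lborel (ball (0::'a) s)" by simp
  qed
  finally show ?thesis by (simp add: P_def)
qed

section \<open>Compactness of viscosity subharmonic functions\<close>

text \<open>The Riesz-Fischer argument on all balls simultaneously. The functions are only required to be
measurable and integrable on the ball of radius \<open>m\<close> from some index on, because the rescaled functions
are defined on growing balls.\<close>

lemma L1_loc_complete:
  fixes f :: "nat \<Rightarrow> 'a::euclidean_space \<Rightarrow> real"
  assumes meas: "\<And>m::nat. \<forall>\<^sub>F j in sequentially. (\<lambda>x. indicator (ball 0 (real m)) x * f j x) \<in> borel_measurable borel"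
    and fin: "\<And>m::nat. \<forall>\<^sub>F j in sequentially. (\<integral>\<^sup>+x. ennreal \<bar>f j x\<bar> * indicator (ball 0 (real m)) x \<partial>lborel) < \<infinity>"
    and cauchy: "\<And>(m::nat) \<epsilon>::real. \<epsilon> > 0 \<Longrightarrow>
       \<exists>N. \<forall>i\<ge>N. \<forall>j\<ge>N. (\<integral>\<^sup>+x. ennreal \<bar>f i x - f j x\<bar> * indicator (ball 0 (real m)) x \<partial>lborel) \<le> ennreal \<epsilon>"
  obtains V where "V \<in> borel_measurable borel"
    "\<And>m::nat. (\<integral>\<^sup>+x. ennreal \<bar>V x\<bar> * indicator (ball 0 (real m)) x \<partial>lborel) < \<infinity>"
    "\<And>m::nat. (\<lambda>j. \<integral>\<^sup>+x. ennreal \<bar>f j x - V x\<bar> * indicator (ball 0 (real m)) x \<partial>lborel) \<longlonglongrightarrow> 0"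
proof -
  let ?I = "\<lambda>(m::nat) g. \<integral>\<^sup>+x. ennreal \<bar>g x\<bar> * indicator (ball (0::'a) (real m)) x \<partial>lborel"
  have ballm[measurable]: "ball (0::'a) r \<in> sets borel" for r by simp
  have "\<forall>m. \<exists>N. \<forall>i\<ge>N. \<forall>j\<ge>N. ?I m (\<lambda>x. f i x - f j x) \<le> ennreal ((1/2)^m) \<and>
      (\<lambda>x. indicator (ball 0 (real m)) x * f i x) \<in> borel_measurable borel \<and> ?I m (f i) < \<infinity>"
  proof
    fix m :: nat
    obtain N1 where N1: "\<forall>i\<ge>N1. \<forall>j\<ge>N1. ?I m (\<lambda>x. f i x - f j x) \<le> ennreal ((1/2)^m)" using cauchy[of "(1/2)^m" m] by auto
    obtain N2 where N2: "\<forall>j\<ge>N2. (\<lambda>x. indicator (ball 0 (real m)) x * f j x) \<in> borel_measurable borel"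
      using meas[of m] unfolding eventually_sequentially by blast
    obtain N3 where N3: "\<forall>j\<ge>N3. ?I m (f j) < \<infinity>" using fin[of m] unfolding eventually_sequentially by blast
    show "\<exists>N. \<forall>i\<ge>N. \<forall>j\<ge>N. ?I m (\<lambda>x. f i x - f j x) \<le> ennreal ((1/2)^m) \<and>
      (\<lambda>x. indicator (ball 0 (real m)) x * f i x) \<in> borel_measurable borel \<and> ?I m (f i) < \<infinity>"
      using N1 N2 N3 by (intro exI[of _ "max N1 (max N2 N3)"]) auto
  qed
  from choice[OF this] obtain N where N: "\<And>m i j. i \<ge> N m \<Longrightarrow> j \<ge> N m \<Longrightarrow> ?I m (\<lambda>x. f i x - f j x) \<le> ennreal ((1/2)^m)"
      "\<And>m i. i \<ge> N m \<Longrightarrow> (\<lambda>x. indicator (ball 0 (real m)) x * f i x) \<in> borel_measurable borel"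
      "\<And>m i. i \<ge> N m \<Longrightarrow> ?I m (f i) < \<infinity>"
    by blast
  \<comment> \<open>The partial sums dominate all thresholds \<open>N i\<close> with \<open>i \<le> m\<close>.\<close>
  define k where "k m = (\<Sum>i\<le>m. N i)" for m :: nat
  have kN: "N m \<le> k l" if "m \<le> l" for m l
    unfolding k_def using that by (intro member_le_sum) auto
  \<comment> \<open>Cutting off makes every term measurable on the whole space and leaves the limit at each point unchanged.\<close>
  define W where "W l x = indicator (ball 0 (real l)) x * f (k l) x" for l :: nat and x
  have Wm[measurable]: "W l \<in> borel_measurable borel" for l unfolding W_def using N(2)[OF kN] by simp
  define V where "V x = lim (\<lambda>l. W l x)" for x
  have Vm[measurable]: "V \<in> borel_measurable borel" unfolding V_def by (rule borel_measurable_lim_metric) measurable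
  have WW: "?I m (\<lambda>x. W l x - W l' x) \<le> ennreal ((1/2)^l)" if l: "m \<le> l" "l \<le> l'" for m l l'
  proof -
    have "?I m (\<lambda>x. W l x - W l' x) \<le> ?I l (\<lambda>x. f (k l) x - f (k l') x)"
      using l by (intro nn_integral_mono) (auto simp: W_def indicator_def)
    also have "\<dots> \<le> ennreal ((1/2)^l)" using l by (intro N(1) kN) auto
    finally show ?thesis .
  qed
  have conv: "AE x in lborel. x \<in> ball 0 (real m) \<longrightarrow> (\<lambda>l. W l x) \<longlonglongrightarrow> V x" for m :: nat
  proof -
    let ?g = "\<lambda>l x. ennreal \<bar>W (l + m) x - W (Suc l + m) x\<bar> * indicator (ball 0 (real m)) x"
    have gm[measurable]: "?g l \<in> borel_measurable lborel" for l by measurable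
    have "(\<integral>\<^sup>+x. (\<Sum>l. ?g l x) \<partial>lborel) = (\<Sum>l. \<integral>\<^sup>+x. ?g l x \<partial>lborel)"
      by (rule nn_integral_suminf) (rule gm)
    also have "\<dots> \<le> (\<Sum>l. ennreal ((1/2)^(l + m)))"
      by (intro suminf_le summableI WW) auto
    also have "\<dots> = ennreal (\<Sum>l. (1/2)^(l + m))"
      by (rule suminf_ennreal2) (simp_all add: power_add summable_mult2 summable_geometric)
    also have "\<dots> < \<infinity>" by simp
    finally have "AE x in lborel. (\<Sum>l. ?g l x) \<noteq> \<infinity>"
      by (intro nn_integral_PInf_AE) auto
    then show ?thesis
    proof (rule eventually_mono, intro impI)
      fix x assume x: "(\<Sum>l. ?g l x) \<noteq> \<infinity>" "x \<in> ball 0 (real m)"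
      then have "(\<Sum>l. ennreal \<bar>W (l + m) x - W (Suc l + m) x\<bar>) \<noteq> \<infinity>" by simp
      then have "summable (\<lambda>l. \<bar>W (l + m) x - W (Suc l + m) x\<bar>)"
        by (intro summable_suminf_not_top) auto
      then have "summable (\<lambda>l. W (l + m) x - W (Suc l + m) x)" by (rule summable_rabs_cancel)
      then have "convergent (\<lambda>n. \<Sum>l<n. W (l + m) x - W (Suc l + m) x)" by (simp add: summable_iff_convergent)
      moreover have "(\<Sum>l<n. W (l + m) x - W (Suc l + m) x) = W m x - W (n + m) x" for n
        by (induction n) auto
      ultimately obtain c where "(\<lambda>n. W m x - W (n + m) x) \<longlonglongrightarrow> c" by (auto simp: convergent_def)
      then have "(\<lambda>n. W m x - (W m x - W (n + m) x)) \<longlonglongrightarrow> W m x - c" by (intro tendsto_intros)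
      then have "(\<lambda>n. W (n + m) x) \<longlonglongrightarrow> W m x - c" by simp
      then have "(\<lambda>n. W n x) \<longlonglongrightarrow> W m x - c" by (rule LIMSEQ_offset)
      then show "(\<lambda>l. W l x) \<longlonglongrightarrow> V x" unfolding V_def by (simp add: limI)
    qed
  qed
  \<comment> \<open>Fatou, applied to the differences with later terms.\<close>
  have WV: "?I m (\<lambda>x. W l x - V x) \<le> ennreal ((1/2)^l)" if l: "m \<le> l" for m l
  proof -
    have "?I m (\<lambda>x. W l x - V x) = (\<integral>\<^sup>+x. liminf (\<lambda>l'. ennreal \<bar>W l x - W l' x\<bar> * indicator (ball (0::'a) (real m)) x) \<partial>lborel)"
    proof (rule nn_integral_cong_AE)
      show "AE x in lborel. ennreal \<bar>W l x - V x\<bar> * indicator (ball 0 (real m)) x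
        = liminf (\<lambda>l'. ennreal \<bar>W l x - W l' x\<bar> * indicator (ball 0 (real m)) x)"
        using conv[of m]
      proof (rule eventually_mono)
        fix x assume x: "x \<in> ball 0 (real m) \<longrightarrow> (\<lambda>l. W l x) \<longlonglongrightarrow> V x"
        show "ennreal \<bar>W l x - V x\<bar> * indicator (ball 0 (real m)) x
          = liminf (\<lambda>l'. ennreal \<bar>W l x - W l' x\<bar> * indicator (ball 0 (real m)) x)"
        proof (cases "x \<in> ball 0 (real m)")
          case True
          then have "(\<lambda>l'. ennreal \<bar>W l x - W l' x\<bar>) \<longlonglongrightarrow> ennreal \<bar>W l x - V x\<bar>"
            using x by (intro tendsto_ennrealI tendsto_rabs tendsto_diff tendsto_const) auto
          then have "liminf (\<lambda>l'. ennreal \<bar>W l x - W l' x\<bar>) = ennreal \<bar>W l x - V x\<bar>" by (intro lim_imp_Liminf) auto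
          then show ?thesis using True by simp
        next
          case False
          then show ?thesis by (simp add: Liminf_const del: mem_ball)
        qed
      qed
    qed
    also have "\<dots> \<le> liminf (\<lambda>l'. ?I m (\<lambda>x. W l x - W l' x))"
      by (rule nn_integral_liminf) measurable
    also have "\<dots> \<le> liminf (\<lambda>_. ennreal ((1/2)^l))"
      by (intro Liminf_mono eventually_sequentiallyI[of l] WW l)
    also have "\<dots> = ennreal ((1/2)^l)" by (simp add: Liminf_const)
    finally show ?thesis .
  qed
  have Weq: "indicator (ball (0::'a) (real m)) x * f (k l) x = indicator (ball 0 (real m)) x * W l x" if "m \<le> l" for m l x
    using that by (auto simp: W_def indicator_def)
  have tri: "?I m (\<lambda>x. g x - V x) \<le> ?I m (\<lambda>x. g x - W l x) + ?I m (\<lambda>x. W l x - V x)"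
    if gm[measurable]: "g \<in> borel_measurable borel" for g m l
  proof -
    have "?I m (\<lambda>x. g x - V x) \<le> (\<integral>\<^sup>+x. ennreal \<bar>g x - W l x\<bar> * indicator (ball (0::'a) (real m)) x
          + ennreal \<bar>W l x - V x\<bar> * indicator (ball (0::'a) (real m)) x \<partial>lborel)"
      by (intro nn_integral_mono) (auto simp: indicator_def ennreal_plus[symmetric] simp del: ennreal_plus intro!: ennreal_leI)
    also have "\<dots> = ?I m (\<lambda>x. g x - W l x) + ?I m (\<lambda>x. W l x - V x)"
      by (rule nn_integral_add) measurable
    finally show ?thesis .
  qed
  have lim: "(\<lambda>j. ?I m (\<lambda>x. f j x - V x)) \<longlonglongrightarrow> 0" for m :: nat
  proof (rule ennreal_tendsto_0I)
    fix \<epsilon> :: real assume eps: "\<epsilon> > 0"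
    obtain l0 where l0: "(1/2::real)^l0 < \<epsilon> / 2" using real_arch_pow_inv[of "\<epsilon>/2" "1/2"] eps by auto
    define l where "l = max l0 m"
    have le: "(1/2::real)^l \<le> (1/2)^l0" by (rule power_decreasing) (simp_all add: l_def)
    have l: "m \<le> l" "(1/2::real)^l \<le> \<epsilon> / 2" using le l0 by (simp add: l_def, linarith)
    have "?I m (\<lambda>x. f j x - V x) \<le> ennreal \<epsilon>" if j: "j \<ge> N l" for j
    proof -
      define g where "g x = indicator (ball 0 (real l)) x * f j x" for x
      have gm: "g \<in> borel_measurable borel" unfolding g_def by (rule N(2)[OF j])
      have "?I m (\<lambda>x. f j x - V x) = ?I m (\<lambda>x. g x - V x)"
        using l(1) by (intro nn_integral_cong) (auto simp: g_def indicator_def)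
      also have "\<dots> \<le> ?I m (\<lambda>x. g x - W l x) + ?I m (\<lambda>x. W l x - V x)" by (rule tri[OF gm])
      also have "?I m (\<lambda>x. g x - W l x) \<le> ?I l (\<lambda>x. f j x - f (k l) x)"
        using l(1) by (intro nn_integral_mono) (auto simp: g_def W_def indicator_def)
      also have "\<dots> \<le> ennreal ((1/2)^l)" by (intro N(1) j kN) simp
      also have "?I m (\<lambda>x. W l x - V x) \<le> ennreal ((1/2)^l)" by (rule WV[OF l(1)])
      also have "ennreal ((1/2)^l) + ennreal ((1/2)^l) \<le> ennreal \<epsilon>"
        using l(2) by (subst ennreal_plus[symmetric]) (auto intro!: ennreal_leI)
      finally show ?thesis by (simp add: add_mono)
    qed
    then show "\<forall>\<^sub>F j in sequentially. ?I m (\<lambda>x. f j x - V x) \<le> ennreal \<epsilon>"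
      unfolding eventually_sequentially by blast
  qed
  have Vfin: "?I m V < \<infinity>" for m :: nat
  proof -
    have "?I m V = ?I m (\<lambda>x. 0 - V x)" by simp
    also have "\<dots> \<le> ?I m (\<lambda>x. 0 - W m x) + ?I m (\<lambda>x. W m x - V x)" by (rule tri) simp
    also have "?I m (\<lambda>x. 0 - W m x) = ?I m (f (k m))"
      by (intro nn_integral_cong) (auto simp: W_def indicator_def)
    also have "?I m (f (k m)) + ?I m (\<lambda>x. W m x - V x) < \<infinity>"
      using N(3)[OF kN[of m m]] WV[of m m] by (simp add: le_less_trans)
    finally show ?thesis .
  qed
  show ?thesis by (rule that[OF Vm Vfin lim])
qed

lemma heat_kernel_lipschitz:
  assumes t: "t > 0"
  obtains L where "L \<ge> 0" "\<And>x y :: real^'n. \<bar>heat_kernel t x - heat_kernel t y\<bar> \<le> L * norm (x - y)"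
proof -
  define A where "A = t powr (- DIM(real^'n) / 2) / gauss_mass TYPE(real^'n)"
  define L where "L = A * sqrt t / (2 * t)"
  have A: "A \<ge> 0" using gauss_mass_pos[where 'a="real^'n"] by (simp add: A_def)
  have grad: "norm (heat_gradient t z) \<le> L" for z :: "real^'n"
  proof -
    have "norm z / sqrt t \<le> exp ((norm z / sqrt t)\<^sup>2 / 4)" by (rule le_exp_square)
    also have "(norm z / sqrt t)\<^sup>2 / 4 = (z \<bullet> z) / (4 * t)" using t by (simp add: power_divide power2_norm_eq_inner)
    finally have "norm z \<le> exp ((z \<bullet> z) / (4 * t)) * sqrt t" using t by (simp add: field_simps)
    then have "norm z * exp (- (z \<bullet> z) / (4 * t)) \<le> exp ((z \<bullet> z) / (4 * t)) * sqrt t * exp (- (z \<bullet> z) / (4 * t))"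
      by (rule mult_right_mono) simp
    also have "\<dots> = sqrt t * (exp ((z \<bullet> z) / (4 * t)) * exp (- ((z \<bullet> z) / (4 * t))))" by simp
    also have "\<dots> = sqrt t" by (simp only: exp_minus_inverse mult_1_right)
    finally have main: "norm z * exp (- (z \<bullet> z) / (4 * t)) \<le> sqrt t" .
    have "norm (heat_gradient t z) = A * (norm z * exp (- (z \<bullet> z) / (4 * t))) / (2 * t)"
      using t heat_kernel_nonneg[of t z] by (simp add: heat_gradient_def abs_mult) (simp add: heat_kernel_def A_def)
    also have "\<dots> \<le> L" unfolding L_def using t A main by (intro divide_right_mono mult_left_mono) auto
    finally show ?thesis .
  qed
  show ?thesis
  proof (rule that[of L])
    show "L \<ge> 0" using A t by (simp add: L_def)
    fix x y :: "real^'n"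
    have "norm (heat_kernel t x - heat_kernel t y) \<le> L * norm (x - y)"
    proof (rule differentiable_bound[of UNIV])
      fix z :: "real^'n"
      show "(heat_kernel t has_derivative (\<lambda>h. heat_gradient t z \<bullet> h)) (at z within UNIV)"
        using C2_on_heat_kernel[OF t, of "UNIV :: (real^'n) set"] by (simp add: C2_on_def)
      show "onorm (\<lambda>h. heat_gradient t z \<bullet> h) \<le> L"
      proof (rule onorm_bound)
        show "norm (heat_gradient t z \<bullet> h) \<le> L * norm h" for h
          using Cauchy_Schwarz_ineq2[of "heat_gradient t z" h] mult_right_mono[OF grad[of z], of "norm h"] by simp
      qed (use A t in \<open>simp add: L_def\<close>)
    qed auto
    then show "\<bar>heat_kernel t x - heat_kernel t y\<bar> \<le> L * norm (x - y)" by simp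
  qed
qed

text \<open>A test function for the rescaled function is transformed back to a test function for \<open>u\<close>; both
scalings multiply the trace of the Hessian by a positive number.\<close>

lemma viscosity_subharmonic_rescale:
  fixes u :: "real^'n \<Rightarrow> ereal"
  assumes u: "viscosity_subharmonic X u" and r: "r > 0" and a: "a > 0"
  shows "viscosity_subharmonic {x. r *\<^sub>R x \<in> X} (\<lambda>x. ereal a * u (r *\<^sub>R x) + ereal c)"
  unfolding viscosity_subharmonic_def
proof (intro conjI ballI allI impI)
  let ?Y = "{x. r *\<^sub>R x \<in> X}"
  have lt: "u (r *\<^sub>R x) < \<infinity>" if "x \<in> ?Y" for x using u that by (simp add: viscosity_subharmonic_def)
  have less: "ereal a * w < d \<longleftrightarrow> w < d / ereal a" for w d
    using a by (subst ereal_less_divide_pos) auto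
  have usc1: "upper_semicontinuous_on ?Y (\<lambda>x. u (r *\<^sub>R x))"
  proof (rule usc_compose[where X=X and u=u and h="\<lambda>x. r *\<^sub>R x"])
    show "upper_semicontinuous_on X u" using u by (simp add: viscosity_subharmonic_def)
    show "continuous_on ?Y (\<lambda>x. r *\<^sub>R x)" by (intro continuous_intros)
  qed auto
  have "upper_semicontinuous_on ?Y (\<lambda>x. ereal a * u (r *\<^sub>R x))"
    using usc1 unfolding upper_semicontinuous_on_def less by blast
  then show "upper_semicontinuous_on ?Y (\<lambda>x. ereal a * u (r *\<^sub>R x) + ereal c)"
  proof (rule usc_add_continuous)
    show "ereal a * u (r *\<^sub>R x) < \<infinity>" if "x \<in> ?Y" for x using lt[OF that] a by (cases "u (r *\<^sub>R x)") auto
  qed simp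
  show "ereal a * u (r *\<^sub>R x) + ereal c < \<infinity>" if "x \<in> ?Y" for x using lt[OF that] a by (cases "u (r *\<^sub>R x)") auto
  fix x0 \<phi> g and H :: "real^'n \<Rightarrow> real^'n^'n" and S
  assume x0: "x0 \<in> ?Y" and S: "open S \<and> x0 \<in> S \<and> S \<subseteq> ?Y \<and> C2_on S \<phi> g H \<and>
      (\<forall>x\<in>S. ereal a * u (r *\<^sub>R x) + ereal c \<le> ereal (\<phi> x)) \<and> ereal a * u (r *\<^sub>R x0) + ereal c = ereal (\<phi> x0)"
  define S' where "S' = (\<lambda>y. (1/r) *\<^sub>R y) -` S"
  have S'r: "r *\<^sub>R x \<in> S' \<longleftrightarrow> x \<in> S" for x using r by (simp add: S'_def)
  have openS': "open S'" unfolding S'_def using S by (intro open_vimage) (auto intro!: continuous_intros)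
  have sub': "S' \<subseteq> X"
  proof
    fix y assume "y \<in> S'"
    then have "(1/r) *\<^sub>R y \<in> S" by (simp add: S'_def)
    then show "y \<in> X" using S r by auto
  qed
  have C2: "C2_on S' (\<lambda>y. \<phi> ((1/r) *\<^sub>R y)) (\<lambda>y. (1/r) *\<^sub>R g ((1/r) *\<^sub>R y)) (\<lambda>y. (1/r\<^sup>2) *\<^sub>R H ((1/r) *\<^sub>R y))"
    unfolding C2_on_def
  proof (intro conjI ballI)
    fix y assume "y \<in> S'"
    then have y: "(1/r) *\<^sub>R y \<in> S" by (simp add: S'_def)
    have sc: "((\<lambda>y. (1/r) *\<^sub>R y) has_derivative (\<lambda>h. (1/r) *\<^sub>R h)) (at y)"
      by (intro has_derivative_scaleR_right has_derivative_ident)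
    have "((\<lambda>y. \<phi> ((1/r) *\<^sub>R y)) has_derivative (\<lambda>h. g ((1/r) *\<^sub>R y) \<bullet> ((1/r) *\<^sub>R h))) (at y)"
      using sc by (rule has_derivative_compose) (use S y in \<open>simp add: C2_on_def\<close>)
    moreover have "(\<lambda>h. g ((1/r) *\<^sub>R y) \<bullet> ((1/r) *\<^sub>R h)) = (\<bullet>) ((1/r) *\<^sub>R g ((1/r) *\<^sub>R y))" by (simp add: fun_eq_iff)
    ultimately show "((\<lambda>y. \<phi> ((1/r) *\<^sub>R y)) has_derivative (\<bullet>) ((1/r) *\<^sub>R g ((1/r) *\<^sub>R y))) (at y)" by simp
    have "((\<lambda>y. g ((1/r) *\<^sub>R y)) has_derivative (\<lambda>h. H ((1/r) *\<^sub>R y) *v ((1/r) *\<^sub>R h))) (at y)"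
      using sc by (rule has_derivative_compose) (use S y in \<open>simp add: C2_on_def\<close>)
    then have "((\<lambda>y. (1/r) *\<^sub>R g ((1/r) *\<^sub>R y)) has_derivative (\<lambda>h. (1/r) *\<^sub>R (H ((1/r) *\<^sub>R y) *v ((1/r) *\<^sub>R h)))) (at y)"
      by (rule has_derivative_scaleR_right)
    moreover have "(\<lambda>h. (1/r) *\<^sub>R (H ((1/r) *\<^sub>R y) *v ((1/r) *\<^sub>R h))) = (*v) ((1/r\<^sup>2) *\<^sub>R H ((1/r) *\<^sub>R y))"
      by (simp add: fun_eq_iff matrix_vector_mult_scaleR scaleR_matrix_vector_assoc[symmetric] power2_eq_square)
    ultimately show "((\<lambda>y. (1/r) *\<^sub>R g ((1/r) *\<^sub>R y)) has_derivative (*v) ((1/r\<^sup>2) *\<^sub>R H ((1/r) *\<^sub>R y))) (at y)" by simp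
  next
    have "continuous_on S H" using S by (simp add: C2_on_def)
    then have "continuous_on S' (\<lambda>y. H ((1/r) *\<^sub>R y))"
      by (rule continuous_on_compose2) (auto intro!: continuous_intros simp: S'_def)
    then show "continuous_on S' (\<lambda>y. (1/r\<^sup>2) *\<^sub>R H ((1/r) *\<^sub>R y))" by (intro continuous_intros)
  qed
  have inv: "w \<le> ereal ((1/a) * d + (- c / a))" if "ereal a * w + ereal c \<le> ereal d" for w d
  proof (cases w)
    case (real v)
    then have "a * v + c \<le> d" using that by simp
    then have "v \<le> (d - c) / a" using a by (simp add: pos_le_divide_eq mult.commute)
    then show ?thesis using real by (simp add: diff_divide_distrib)
  qed (use that a in auto)
  have inv': "w = ereal ((1/a) * d + (- c / a))" if "ereal a * w + ereal c = ereal d" for w d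
  proof (cases w)
    case (real v)
    then have "a * v + c = d" using that by simp
    then have "v = (d - c) / a" using a by (simp add: eq_divide_eq mult.commute)
    then show ?thesis using real by (simp add: diff_divide_distrib)
  qed (use that a in auto)
  have le: "u y \<le> ereal ((1/a) * \<phi> ((1/r) *\<^sub>R y) + (- c / a))" if "y \<in> S'" for y
  proof (rule inv)
    have "(1/r) *\<^sub>R y \<in> S" using that by (simp add: S'_def)
    then have "ereal a * u (r *\<^sub>R ((1/r) *\<^sub>R y)) + ereal c \<le> ereal (\<phi> ((1/r) *\<^sub>R y))" using S by blast
    then show "ereal a * u y + ereal c \<le> ereal (\<phi> ((1/r) *\<^sub>R y))" using r by simp
  qed
  have eq: "u (r *\<^sub>R x0) = ereal ((1/a) * \<phi> ((1/r) *\<^sub>R (r *\<^sub>R x0)) + (- c / a))"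
    using S r by (intro inv') auto
  have test: "\<And>x0 \<phi> g H S. x0 \<in> X \<Longrightarrow> open S \<Longrightarrow> x0 \<in> S \<Longrightarrow> S \<subseteq> X \<Longrightarrow> C2_on S \<phi> g H \<Longrightarrow>
        (\<forall>x\<in>S. u x \<le> ereal (\<phi> x)) \<Longrightarrow> u x0 = ereal (\<phi> x0) \<Longrightarrow> trace (H x0) \<ge> 0"
    using u unfolding viscosity_subharmonic_def by blast
  define q where "q = (1/a) * (1/r\<^sup>2)"
  have "trace ((1/a) *\<^sub>R ((1/r\<^sup>2) *\<^sub>R H ((1/r) *\<^sub>R (r *\<^sub>R x0)))) \<ge> 0"
    by (rule test[OF _ openS' _ sub' C2_on_affine[OF C2, of "1/a" "- c / a"], of "r *\<^sub>R x0"])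
       (use x0 S S'r le eq in auto)
  moreover have "trace ((1/a) *\<^sub>R ((1/r\<^sup>2) *\<^sub>R H ((1/r) *\<^sub>R (r *\<^sub>R x0)))) = q * trace (H x0)"
    using r by (simp add: trace_scaleR q_def)
  moreover have "q > 0" using a r by (simp add: q_def)
  ultimately show "trace (H x0) \<ge> 0" by (simp add: zero_le_mult_iff)
qed

lemma viscosity_subharmonic_add_const:
  assumes "viscosity_subharmonic X u"
  shows "viscosity_subharmonic X (\<lambda>x. u x + ereal c)"
proof -
  have "{x. 1 *\<^sub>R x \<in> X} = X" by simp
  moreover have "(\<lambda>x. ereal 1 * u (1 *\<^sub>R x) + ereal c) = (\<lambda>x. u x + ereal c)"
    by (simp add: one_ereal_def[symmetric])
  ultimately show ?thesis using viscosity_subharmonic_rescale[OF assms, of 1 1 c] by (simp only: zero_less_one simp_thms)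
qed

text \<open>All that the compactness proof needs about a single function \<open>u\<close>: the deficit \<open>v = N - u\<close> from its
upper bound has an integral that is bounded in terms of one value of \<open>u\<close>, by the Harnack inequality, and
\<open>v\<close> almost dominates its heat average. The bounds depend on \<open>N\<close>, \<open>C\<close>, \<open>s\<close> and \<open>c\<close> only. Writing \<open>v\<close> with real
values loses the set where \<open>u = -\<infinity>\<close>, which is a null set, so the relation between \<open>u\<close> and \<open>v\<close> holds
almost everywhere.\<close>

lemma deficit_bounds:
  fixes u :: "real^'n \<Rightarrow> ereal" and N C s c :: real
  assumes s: "s > 1" and X: "cball 0 (4 * s) \<subseteq> X" and u: "viscosity_subharmonic X u"
    and N: "\<forall>x\<in>cball 0 (4 * s). u x \<le> ereal N"
    and C: "\<exists>x\<in>cball 0 1. ereal (- C) \<le> u x" and CN: "C + N \<ge> 0"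
    and c: "c > 0" and harnack: "\<forall>X u x. viscosity_subharmonic X (u :: real^'n \<Rightarrow> ereal) \<longrightarrow> cball 0 (4 * s) \<subseteq> X \<longrightarrow>
       (\<forall>x\<in>cball 0 (4 * s). u x \<le> 0) \<longrightarrow> x \<in> ball 0 s \<longrightarrow>
       ennreal c * (\<integral>\<^sup>+y. neg_on_ball s u y \<partial>lborel) \<le> e2ennreal (- u x)"
  defines "v \<equiv> \<lambda>y. enn2real (neg_on_ball s (\<lambda>x. u x + ereal (- N)) y)"
  defines "A \<equiv> (C + N) / c"
  shows "integrable lborel v" "(\<integral>y. v y \<partial>lborel) \<le> A"
    "(\<lambda>x. indicator (ball 0 s) x * real_of_ereal (u x)) \<in> borel_measurable borel"
    "AE x in lborel. x \<in> ball 0 s \<longrightarrow> u x = ereal (N - v x)"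
    "\<And>T b. T > 0 \<Longrightarrow> norm b = 3 * s \<Longrightarrow> 2 * real CARD('n) * T \<le> (3 * s)\<^sup>2 \<Longrightarrow>
       AE x in lborel. x \<in> ball 0 s \<longrightarrow> (\<integral>y. heat_kernel T (x - y) * v y \<partial>lborel) \<le> v x + heat_kernel T (b::real^'n) * A"
proof -
  define w where "w x = u x + ereal (- N)" for x
  define n where "n = neg_on_ball s w"
  have vn: "v y = enn2real (n y)" for y by (simp add: v_def n_def w_def[abs_def])
  have w: "viscosity_subharmonic X w" unfolding w_def by (rule viscosity_subharmonic_add_const[OF u])
  have w0: "\<forall>x\<in>cball 0 (4 * s). w x \<le> 0"
  proof
    fix x :: "real^'n" assume "x \<in> cball 0 (4 * s)"
    then have "u x \<le> ereal N" using N by blast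
    then show "w x \<le> 0" unfolding w_def by (cases "u x") auto
  qed
  have bs: "ball 0 s \<subseteq> cball (0::real^'n) (4 * s)" using s by auto
  have nm[measurable]: "n \<in> borel_measurable borel" unfolding n_def
    by (rule borel_measurable_neg_on_ball[of X]) (use w w0 bs X in \<open>auto simp: viscosity_subharmonic_def simp del: mem_ball\<close>)
  obtain x1 where x1: "x1 \<in> cball 0 1" "ereal (- C) \<le> u x1" using C by blast
  have "x1 \<in> ball 0 s" using x1(1) s by simp
  then have "ennreal c * (\<integral>\<^sup>+y. n y \<partial>lborel) \<le> e2ennreal (- w x1)" unfolding n_def using harnack w X w0 by blast
  also have "\<dots> \<le> e2ennreal (ereal (C + N))" using x1(2) unfolding w_def
    by (intro e2ennreal_mono) (cases "u x1"; simp)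
  also have "\<dots> = ennreal (C + N)" by simp
  finally have "ennreal (1/c) * (ennreal c * (\<integral>\<^sup>+y. n y \<partial>lborel)) \<le> ennreal (1/c) * ennreal (C + N)" by (rule mult_left_mono) simp
  moreover have "ennreal (1/c) * (ennreal c * (\<integral>\<^sup>+y. n y \<partial>lborel)) = (\<integral>\<^sup>+y. n y \<partial>lborel)"
    using c by (simp add: mult.assoc[symmetric] ennreal_mult[symmetric])
  moreover have "ennreal (1/c) * ennreal (C + N) = ennreal A" using c CN by (simp add: A_def ennreal_mult[symmetric])
  ultimately have nA: "(\<integral>\<^sup>+y. n y \<partial>lborel) \<le> ennreal A" by simp
  have A0: "A \<ge> 0" using c CN by (simp add: A_def)
  have "(\<integral>\<^sup>+y. n y \<partial>lborel) \<noteq> \<infinity>" using nA by (auto simp: top_unique)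
  then have "AE y in lborel. n y \<noteq> \<infinity>" by (intro nn_integral_PInf_AE) simp_all
  then have nv: "AE y in lborel. n y = ennreal (v y)" by (rule eventually_mono) (simp add: vn less_top)
  have v0: "0 \<le> v y" for y by (simp add: vn)
  have vm[measurable]: "v \<in> borel_measurable borel" unfolding vn[abs_def] by measurable
  have nnv: "(\<integral>\<^sup>+y. ennreal (v y) \<partial>lborel) = (\<integral>\<^sup>+y. n y \<partial>lborel)"
    by (rule nn_integral_cong_AE) (use nv in \<open>auto elim: eventually_mono\<close>)
  show vint: "integrable lborel v"
    by (rule integrableI_nonneg) (use v0 nnv nA in \<open>auto simp: le_less_trans\<close>)
  have "ennreal (\<integral>y. v y \<partial>lborel) \<le> ennreal A"
    using nnv nA nn_integral_eq_integral[OF vint] v0 by simp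
  then show "(\<integral>y. v y \<partial>lborel) \<le> A" using A0 by (simp add: ennreal_le_iff)
  have un: "u x = ereal N - enn2ereal (n x)" if x: "x \<in> ball 0 s" for x
  proof -
    have "w x \<le> 0" using w0 x bs by blast
    then have "enn2ereal (n x) = - w x" using x by (simp add: n_def neg_on_ball_def enn2ereal_e2ennreal)
    then show ?thesis unfolding w_def by (cases "u x") auto
  qed
  have "indicator (ball 0 s) x * real_of_ereal (u x) = indicator (ball 0 s) x * real_of_ereal (ereal N - enn2ereal (n x))" for x
    using un[of x] by (cases "x \<in> ball 0 s") (auto simp del: mem_ball)
  then show "(\<lambda>x. indicator (ball 0 s) x * real_of_ereal (u x)) \<in> borel_measurable borel"
  proof (simp only:)
    have [measurable]: "ball (0::real^'n) s \<in> sets borel" by simp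
    show "(\<lambda>x. indicator (ball 0 s) x * real_of_ereal (ereal N - enn2ereal (n x))) \<in> borel_measurable borel" by measurable
  qed
  show "AE x in lborel. x \<in> ball 0 s \<longrightarrow> u x = ereal (N - v x)"
    using nv
  proof (rule eventually_mono, intro impI)
    fix x assume "n x = ennreal (v x)" "x \<in> ball 0 s"
    then show "u x = ereal (N - v x)" using un[of x] v0[of x] by (simp add: enn2ereal_ennreal)
  qed
  fix T :: real and b :: "real^'n"
  assume T: "T > 0" and b: "norm b = 3 * s" and T2: "2 * real CARD('n) * T \<le> (3 * s)\<^sup>2"
  have far: "heat_kernel t z \<le> heat_kernel T b" if "0 < t" "t \<le> T" "4 * s - s \<le> norm z" for t and z :: "real^'n"
    using that s b T2 by (intro heat_kernel_far_bound[of t T "3 * s"]) auto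
  have ss: "0 < s" "s < 4 * s" using s by auto
  show "AE x in lborel. x \<in> ball 0 s \<longrightarrow> (\<integral>y. heat_kernel T (x - y) * v y \<partial>lborel) \<le> v x + heat_kernel T b * A"
    using nv
  proof (rule eventually_mono, intro impI)
    fix x assume nx: "n x = ennreal (v x)" and x: "x \<in> ball 0 s"
    have x4: "x \<in> ball 0 (4 * s)" using x s by auto
    have "(\<integral>\<^sup>+y. ennreal (heat_kernel T (x - y)) * n y \<partial>lborel)
       \<le> e2ennreal (- w x) + ennreal (heat_kernel T b) * (\<integral>\<^sup>+y. n y \<partial>lborel)"
      unfolding n_def by (rule heat_supermean[OF w X _ ss T far heat_kernel_nonneg x4]) (use w0 in auto)
    also have "e2ennreal (- w x) = ennreal (v x)" using nx x by (simp add: n_def neg_on_ball_def)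
    also have "ennreal (v x) + ennreal (heat_kernel T b) * (\<integral>\<^sup>+y. n y \<partial>lborel) \<le> ennreal (v x) + ennreal (heat_kernel T b) * ennreal A"
      by (intro add_left_mono mult_left_mono nA) simp
    also have "\<dots> = ennreal (v x + heat_kernel T b * A)"
      using v0[of x] A0 heat_kernel_nonneg[of T b] by (simp add: ennreal_mult ennreal_plus)
    finally have le: "(\<integral>\<^sup>+y. ennreal (heat_kernel T (x - y)) * n y \<partial>lborel) \<le> ennreal (v x + heat_kernel T b * A)" .
    have "(\<integral>\<^sup>+y. ennreal (heat_kernel T (x - y)) * n y \<partial>lborel) = (\<integral>\<^sup>+y. ennreal (heat_kernel T (x - y) * v y) \<partial>lborel)"
      by (rule nn_integral_cong_AE) (use nv in \<open>auto elim!: eventually_mono simp: ennreal_mult heat_kernel_nonneg v0\<close>)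
    also have "\<dots> = ennreal (\<integral>y. heat_kernel T (x - y) * v y \<partial>lborel)"
      by (rule nn_integral_eq_integral[OF integrable_heat_kernel_mult[OF T vint]]) (simp add: heat_kernel_nonneg v0)
    finally have "ennreal (\<integral>y. heat_kernel T (x - y) * v y \<partial>lborel) \<le> ennreal (v x + heat_kernel T b * A)" using le by simp
    moreover have "0 \<le> v x + heat_kernel T b * A" using v0[of x] A0 heat_kernel_nonneg[of T b] by simp
    ultimately show "(\<integral>y. heat_kernel T (x - y) * v y \<partial>lborel) \<le> v x + heat_kernel T b * A" by (simp add: ennreal_le_iff)
  qed
qed

text \<open>Heat averages at a fixed time are Lipschitz and bounded in terms of the integral of \<open>v\<close>.\<close>

lemma heat_average_bounds:
  fixes v :: "real^'n \<Rightarrow> real"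
  assumes v: "integrable lborel v" "\<And>y. 0 \<le> v y" "(\<integral>y. v y \<partial>lborel) \<le> A" and T: "T > 0"
    and L: "L \<ge> 0" "\<And>x y :: real^'n. \<bar>heat_kernel T x - heat_kernel T y\<bar> \<le> L * norm (x - y)"
  shows "\<bar>(\<integral>y. heat_kernel T (x - y) * v y \<partial>lborel) - (\<integral>y. heat_kernel T (x' - y) * v y \<partial>lborel)\<bar> \<le> L * A * norm (x - x')"
    and "\<bar>(\<integral>y. heat_kernel T (x - y) * v y \<partial>lborel)\<bar> \<le> heat_kernel T (0::real^'n) * A"
proof -
  note i = integrable_heat_kernel_mult[OF T v(1)]
  have "(\<integral>y. heat_kernel T (x - y) * v y \<partial>lborel) - (\<integral>y. heat_kernel T (x' - y) * v y \<partial>lborel)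
      = (\<integral>y. heat_kernel T (x - y) * v y - heat_kernel T (x' - y) * v y \<partial>lborel)"
    using i by (subst Bochner_Integration.integral_diff) auto
  also have "\<bar>\<dots>\<bar> \<le> (\<integral>y. L * norm (x - x') * v y \<partial>lborel)"
  proof (rule integral_abs_bound[THEN order_trans], rule integral_mono)
    show "integrable lborel (\<lambda>y. \<bar>heat_kernel T (x - y) * v y - heat_kernel T (x' - y) * v y\<bar>)" using i by simp
    show "integrable lborel (\<lambda>y. L * norm (x - x') * v y)" using v(1) by simp
    show "\<bar>heat_kernel T (x - y) * v y - heat_kernel T (x' - y) * v y\<bar> \<le> L * norm (x - x') * v y" for y
      using mult_right_mono[OF L(2)[of "x - y" "x' - y"] v(2)[of y]] v(2)[of y]
      by (simp add: left_diff_distrib[symmetric] abs_mult)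
  qed
  also have "\<dots> = L * norm (x - x') * (\<integral>y. v y \<partial>lborel)" by simp
  also have "\<dots> \<le> L * norm (x - x') * A" using L(1) by (intro mult_left_mono v(3)) auto
  finally show "\<bar>(\<integral>y. heat_kernel T (x - y) * v y \<partial>lborel) - (\<integral>y. heat_kernel T (x' - y) * v y \<partial>lborel)\<bar> \<le> L * A * norm (x - x')"
    by (simp add: mult_ac)
  have "\<bar>(\<integral>y. heat_kernel T (x - y) * v y \<partial>lborel)\<bar> \<le> (\<integral>y. heat_kernel T (0::real^'n) * v y \<partial>lborel)"
  proof (rule integral_abs_bound[THEN order_trans], rule integral_mono)
    show "integrable lborel (\<lambda>y. \<bar>heat_kernel T (x - y) * v y\<bar>)" using i by simp
    show "\<bar>heat_kernel T (x - y) * v y\<bar> \<le> heat_kernel T (0::real^'n) * v y" for y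
      using v(2)[of y] by (auto simp: abs_mult heat_kernel_nonneg intro!: mult_right_mono heat_kernel_antimono T)
  qed (use v(1) in simp)
  also have "\<dots> \<le> heat_kernel T (0::real^'n) * A" using v(3) by (auto intro!: mult_left_mono heat_kernel_nonneg)
  finally show "\<bar>(\<integral>y. heat_kernel T (x - y) * v y \<partial>lborel)\<bar> \<le> heat_kernel T (0::real^'n) * A" .
qed

lemma abs_diff_via_smoothings:
  fixes a b c d z q r N :: real
  assumes "\<bar>c - z\<bar> < q" "\<bar>d - z\<bar> < q" "r = q + q"
  shows "\<bar>(N - a) - (N - b)\<bar> \<le> \<bar>a - c\<bar> + \<bar>b - d\<bar> + r"
  using assms by linarith

text \<open>For each radius \<open>m\<close> the deficits \<open>v m j\<close> from an upper bound \<open>N m\<close> are bounded in \<open>L\<^sup>1\<close>, and their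
heat averages \<open>P m i j\<close> at the times \<open>T i\<close> are equicontinuous in \<open>j\<close>. Choose a subsequence along which all
averages converge locally uniformly. Since \<open>v m j\<close> is within \<open>\<delta> m i\<close> of \<open>P m i j\<close> in \<open>L\<^sup>1\<close> for all \<open>j\<close>,
and \<open>\<delta> m i\<close> tends to \<open>0\<close> as \<open>i\<close> grows, the subsequence is Cauchy in \<open>L\<^sup>1\<close> on every ball.\<close>

lemma viscosity_subharmonic_compactness:
  fixes u :: "nat \<Rightarrow> real^'n \<Rightarrow> ereal"
  assumes above: "\<And>R. R > 0 \<Longrightarrow> \<exists>N\<ge>0. \<forall>\<^sub>F j in sequentially.
      \<exists>X. cball 0 R \<subseteq> X \<and> viscosity_subharmonic X (u j) \<and> (\<forall>x\<in>cball 0 R. u j x \<le> ereal N)"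
    and below: "\<forall>\<^sub>F j in sequentially. \<exists>x\<in>cball 0 1. ereal (- C) \<le> u j x" and C: "C \<ge> 0"
  obtains k V where "strict_mono (k :: nat \<Rightarrow> nat)" "V \<in> borel_measurable borel"
    "tendsto_L1_loc (\<lambda>j. u (k j)) V"
proof -
  \<comment> \<open>The cutoff of the smoothing estimate lives between the radii \<open>m + 1\<close> and \<open>m + 2\<close>; taking \<open>m + 1\<close>
    in place of \<open>m\<close> keeps the smaller radius positive.\<close>
  define s where "s m = real m + 2" for m :: nat
  have s: "s m > 1" "s m > 0" for m by (auto simp: s_def)
  have "\<forall>m. \<exists>N\<ge>0. \<forall>\<^sub>F j in sequentially.
      \<exists>X. cball 0 (4 * s m) \<subseteq> X \<and> viscosity_subharmonic X (u j) \<and> (\<forall>x\<in>cball 0 (4 * s m). u j x \<le> ereal N)"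
    using above s by simp
  from choice[OF this] obtain N where N: "\<And>m. N m \<ge> 0" "\<And>m. \<forall>\<^sub>F j in sequentially.
      \<exists>X. cball 0 (4 * s m) \<subseteq> X \<and> viscosity_subharmonic X (u j) \<and> (\<forall>x\<in>cball 0 (4 * s m). u j x \<le> ereal (N m))"
    by blast
  have "\<forall>m. \<exists>c>0. \<forall>X u x. viscosity_subharmonic X (u :: real^'n \<Rightarrow> ereal) \<longrightarrow> cball 0 (4 * s m) \<subseteq> X \<longrightarrow>
       (\<forall>x\<in>cball 0 (4 * s m). u x \<le> 0) \<longrightarrow> x \<in> ball 0 (s m) \<longrightarrow>
       ennreal c * (\<integral>\<^sup>+y. neg_on_ball (s m) u y \<partial>lborel) \<le> e2ennreal (- u x)"
  proof
    fix m
    show "\<exists>c>0. \<forall>X u x. viscosity_subharmonic X (u :: real^'n \<Rightarrow> ereal) \<longrightarrow> cball 0 (4 * s m) \<subseteq> X \<longrightarrow>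
       (\<forall>x\<in>cball 0 (4 * s m). u x \<le> 0) \<longrightarrow> x \<in> ball 0 (s m) \<longrightarrow>
       ennreal c * (\<integral>\<^sup>+y. neg_on_ball (s m) u y \<partial>lborel) \<le> e2ennreal (- u x)"
      by (rule weak_harnack[OF s(2)[of m], where 'n='n]) blast
  qed
  from choice[OF this] obtain c where c: "\<And>m. c m > 0"
    "\<And>m. \<forall>X u x. viscosity_subharmonic X (u :: real^'n \<Rightarrow> ereal) \<longrightarrow> cball 0 (4 * s m) \<subseteq> X \<longrightarrow>
       (\<forall>x\<in>cball 0 (4 * s m). u x \<le> 0) \<longrightarrow> x \<in> ball 0 (s m) \<longrightarrow>
       ennreal (c m) * (\<integral>\<^sup>+y. neg_on_ball (s m) u y \<partial>lborel) \<le> e2ennreal (- u x)"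
    by blast
  define A where "A m = (C + N m) / c m" for m
  have A0: "A m \<ge> 0" for m using C N(1)[of m] c(1)[of m] by (simp add: A_def)
  define good where "good m j \<longleftrightarrow> (\<exists>X. cball 0 (4 * s m) \<subseteq> X \<and> viscosity_subharmonic X (u j) \<and> (\<forall>x\<in>cball 0 (4 * s m). u j x \<le> ereal (N m)))
      \<and> (\<exists>x\<in>cball 0 1. ereal (- C) \<le> u j x)" for m j
  have good: "\<forall>\<^sub>F j in sequentially. good m j" for m
    unfolding good_def using N(2)[of m] below by (rule eventually_conj)
  define vv where "vv m j y = enn2real (neg_on_ball (s m) (\<lambda>x. u j x + ereal (- N m)) y)" for m j y
  define T where "T i = 1 / real (Suc i)" for i
  have T: "T i > 0" for i by (simp add: T_def)
  have pack: "integrable lborel (vv m j)" "(\<integral>y. vv m j y \<partial>lborel) \<le> A m"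
    "(\<lambda>x. indicator (ball 0 (s m)) x * real_of_ereal (u j x)) \<in> borel_measurable borel"
    "AE x in lborel. x \<in> ball 0 (s m) \<longrightarrow> u j x = ereal (N m - vv m j x)"
    "\<And>T b. T > 0 \<Longrightarrow> norm b = 3 * s m \<Longrightarrow> 2 * real CARD('n) * T \<le> (3 * s m)\<^sup>2 \<Longrightarrow>
       AE x in lborel. x \<in> ball 0 (s m) \<longrightarrow> (\<integral>y. heat_kernel T (x - y) * vv m j y \<partial>lborel) \<le> vv m j x + heat_kernel T (b::real^'n) * A m"
    if g: "good m j" for m j
  proof -
    obtain X where X: "cball 0 (4 * s m) \<subseteq> X" "viscosity_subharmonic X (u j)" "\<forall>x\<in>cball 0 (4 * s m). u j x \<le> ereal (N m)"
      and below: "\<exists>x\<in>cball 0 1. ereal (- C) \<le> u j x"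
      using g unfolding good_def by blast
    have CN: "C + N m \<ge> 0" using C N(1)[of m] by simp
    note pk = deficit_bounds[OF s(1) X below CN c(1) c(2)]
    show "integrable lborel (vv m j)" unfolding vv_def[abs_def] by (rule pk(1))
    show "(\<integral>y. vv m j y \<partial>lborel) \<le> A m" unfolding vv_def[abs_def] A_def by (rule pk(2))
    show "(\<lambda>x. indicator (ball 0 (s m)) x * real_of_ereal (u j x)) \<in> borel_measurable borel" by (rule pk(3))
    show "AE x in lborel. x \<in> ball 0 (s m) \<longrightarrow> u j x = ereal (N m - vv m j x)"
      unfolding vv_def[abs_def] by (rule pk(4))
    show "AE x in lborel. x \<in> ball 0 (s m) \<longrightarrow> (\<integral>y. heat_kernel T (x - y) * vv m j y \<partial>lborel) \<le> vv m j x + heat_kernel T b * A m"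
      if "T > 0" "norm b = 3 * s m" "2 * real CARD('n) * T \<le> (3 * s m)\<^sup>2" for T and b :: "real^'n"
      unfolding vv_def[abs_def] A_def by (rule pk(5)[OF that])
  qed
  define v where "v m j y = (if good m j then vv m j y else 0)" for m j y
  have v0: "0 \<le> v m j y" for m j y by (simp add: v_def vv_def)
  have voff: "v m j y = 0" if "y \<notin> ball 0 (s m)" for m j y using that by (simp add: v_def vv_def neg_on_ball_def)
  have vint: "integrable lborel (v m j)" and vA: "(\<integral>y. v m j y \<partial>lborel) \<le> A m" for m j
  proof -
    have veq: "v m j = (if good m j then vv m j else (\<lambda>_. 0))" by (simp add: v_def fun_eq_iff)
    show "integrable lborel (v m j)" unfolding veq using pack(1)[of m j] by simp
    show "(\<integral>y. v m j y \<partial>lborel) \<le> A m"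
    proof (cases "good m j")
      case True
      then show ?thesis using pack(2)[OF True] by (simp add: veq)
    next
      case False
      then show ?thesis using A0[of m] by (simp add: veq)
    qed
  qed
  define P where "P m i j x = (\<integral>y. heat_kernel (T i) (x - y) * v m j y \<partial>lborel)" for m i j and x :: "real^'n"
  have "\<exists>k V. strict_mono (k :: nat \<Rightarrow> nat) \<and> (\<forall>z K. compact K \<longrightarrow> uniform_limit K (\<lambda>j. P (fst z) (snd z) (k j)) (V z) sequentially)"
  proof (rule diagonal_uniform_subsequence[of "\<lambda>j (z::nat\<times>nat). P (fst z) (snd z) j"])
    fix z :: "nat \<times> nat" and \<epsilon> :: real assume eps: "\<epsilon> > 0"
    obtain L where L: "L \<ge> 0" "\<And>x y :: real^'n. \<bar>heat_kernel (T (snd z)) x - heat_kernel (T (snd z)) y\<bar> \<le> L * norm (x - y)"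
      using heat_kernel_lipschitz[OF T, where 'n='n] by blast
    define B where "B = L * A (fst z)"
    have B: "B \<ge> 0" using L(1) A0 by (simp add: B_def)
    have lip: "\<bar>P (fst z) (snd z) j x - P (fst z) (snd z) j y\<bar> \<le> B * norm (x - y)" for j x y
      unfolding P_def B_def by (rule heat_average_bounds(1)[OF vint v0 vA T L])
    show "\<exists>d>0. \<forall>j x y. dist x y < d \<longrightarrow> \<bar>P (fst z) (snd z) j x - P (fst z) (snd z) j y\<bar> < \<epsilon>"
    proof (intro exI[of _ "\<epsilon> / (B + 1)"] conjI allI impI)
      show "\<epsilon> / (B + 1) > 0" using eps B by simp
      fix j and x y :: "real^'n" assume "dist x y < \<epsilon> / (B + 1)"
      then have "B * norm (x - y) \<le> B * (\<epsilon> / (B + 1))" using B by (intro mult_left_mono) (auto simp: dist_norm)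
      also have "\<dots> < \<epsilon>" using eps B by (simp add: field_simps)
      finally show "\<bar>P (fst z) (snd z) j x - P (fst z) (snd z) j y\<bar> < \<epsilon>" using lip[of j x y] by simp
    qed
  next
    fix z :: "nat \<times> nat" and x
    obtain L where L: "L \<ge> 0" "\<And>x y :: real^'n. \<bar>heat_kernel (T (snd z)) x - heat_kernel (T (snd z)) y\<bar> \<le> L * norm (x - y)"
      using heat_kernel_lipschitz[OF T, where 'n='n] by blast
    show "\<exists>B. \<forall>j. \<bar>P (fst z) (snd z) j x\<bar> \<le> B"
      unfolding P_def using heat_average_bounds(2)[OF vint v0 vA T L] by blast
  qed blast
  then obtain k V0 where k: "strict_mono (k :: nat \<Rightarrow> nat)"
      and V0: "\<And>z K. compact K \<Longrightarrow> uniform_limit K (\<lambda>j. P (fst z) (snd z) (k j)) (V0 z) sequentially"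
    by blast
  have goodk: "\<forall>\<^sub>F j in sequentially. good m (k j)" for m
    using eventually_subseq[OF k good[of m]] by simp
  define f where "f j x = real_of_ereal (u (k j) x)" for j x
  have ballm[measurable]: "ball (0::real^'n) r \<in> sets borel" for r by simp
  have sub: "indicator (ball (0::real^'n) (real m)) x = indicator (ball 0 (real m)) x * (indicator (ball 0 (s m)) x :: real)" for m x
    by (auto simp: indicator_def s_def)
  have rel: "AE x in lborel. x \<in> ball 0 (s m) \<longrightarrow> u (k j) x = ereal (N m - v m (k j) x)" if "good m (k j)" for m j
    using pack(4)[OF that] that by (simp add: v_def)
  define e where "e = (axis undefined 1 :: real^'n)"
  define \<delta> where "\<delta> m i = A m * (sqrt (T i) * gauss_first_moment TYPE(real^'n))
      + 2 * (heat_kernel (T i) ((3 * s m) *\<^sub>R e) * A m) * measure lborel (ball (0::real^'n) (s m))" for m i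
  have smooth: "(\<integral>\<^sup>+x. ennreal \<bar>v m j x - P m i j x\<bar> * indicator (ball 0 (real m)) x \<partial>lborel) \<le> ennreal (\<delta> m i)"
    if g: "good m j" and Ti: "2 * real CARD('n) * T i \<le> (3 * s m)\<^sup>2" for m i j
  proof -
    have nb: "norm ((3 * s m) *\<^sub>R e) = 3 * s m" using s(2)[of m] by (simp add: e_def norm_axis_1)
    have "(\<integral>\<^sup>+x. ennreal \<bar>v m j x - P m i j x\<bar> * indicator (ball 0 (real m)) x \<partial>lborel)
      \<le> (\<integral>\<^sup>+x. ennreal \<bar>v m j x - P m i j x\<bar> * indicator (ball 0 (real m + 1)) x \<partial>lborel)"
      by (intro nn_integral_mono) (auto simp: indicator_def)
    also have "\<dots> \<le> ennreal ((\<integral>y. v m j y \<partial>lborel) * (sqrt (T i) * gauss_first_moment TYPE(real^'n) / (s m - (real m + 1)))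
       + 2 * (heat_kernel (T i) ((3 * s m) *\<^sub>R e) * A m) * measure lborel (ball (0::real^'n) (s m)))"
      unfolding P_def
    proof (rule smoothing_estimate[OF vint v0 voff T])
      show "AE x in lborel. x \<in> ball 0 (s m) \<longrightarrow> (\<integral>y. heat_kernel (T i) (x - y) * v m j y \<partial>lborel)
          \<le> v m j x + heat_kernel (T i) ((3 * s m) *\<^sub>R e) * A m"
        using pack(5)[OF g T nb Ti] g by (simp add: v_def)
    qed (auto simp: s_def heat_kernel_nonneg A0)
    also have "\<dots> \<le> ennreal (\<delta> m i)"
      unfolding \<delta>_def using vA[of m j] T[of i] gauss_first_moment_nonneg[where 'a="real^'n"]
      by (intro ennreal_leI add_right_mono) (auto simp: s_def intro!: mult_right_mono)
    finally show ?thesis .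
  qed
  have T0: "T \<longlonglongrightarrow> 0" unfolding T_def using LIMSEQ_inverse_real_of_nat by (simp add: inverse_eq_divide)
  have \<delta>0: "(\<lambda>i. \<delta> m i) \<longlonglongrightarrow> 0" for m
  proof -
    have "(3 * s m) *\<^sub>R e \<noteq> 0" using s(2)[of m] by (simp add: e_def axis_eq_0_iff)
    moreover have "filterlim T (at_right 0) sequentially"
      unfolding filterlim_at using T0 T by (auto intro!: always_eventually simp: less_imp_neq[THEN not_sym])
    ultimately have hk0: "(\<lambda>i. heat_kernel (T i) ((3 * s m) *\<^sub>R e)) \<longlonglongrightarrow> 0"
      using filterlim_compose[OF heat_kernel_tendsto_0] by blast
    have "(\<lambda>i. \<delta> m i) \<longlonglongrightarrow> A m * (sqrt 0 * gauss_first_moment TYPE(real^'n))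
      + 2 * (0 * A m) * measure lborel (ball (0::real^'n) (s m))" unfolding \<delta>_def by (intro tendsto_intros T0 hk0)
    then show ?thesis by simp
  qed
  have vm[measurable]: "v m j \<in> borel_measurable borel" for m j using vint[of m j] by auto
  have Pm[measurable]: "P m i j \<in> borel_measurable borel" for m i j unfolding P_def by measurable
  obtain V where V: "V \<in> borel_measurable borel"
    "\<And>m::nat. (\<integral>\<^sup>+x. ennreal \<bar>V x\<bar> * indicator (ball 0 (real m)) x \<partial>lborel) < \<infinity>"
    "\<And>m::nat. (\<lambda>j. \<integral>\<^sup>+x. ennreal \<bar>f j x - V x\<bar> * indicator (ball 0 (real m)) x \<partial>lborel) \<longlonglongrightarrow> 0"
  proof (rule L1_loc_complete[of f])
    fix m :: nat
    show "\<forall>\<^sub>F j in sequentially. (\<lambda>x. indicator (ball 0 (real m)) x * f j x) \<in> borel_measurable borel"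
      using goodk[of m]
    proof (rule eventually_mono)
      fix j assume "good m (k j)"
      from pack(3)[OF this] have [measurable]: "(\<lambda>x. indicator (ball 0 (s m)) x * f j x) \<in> borel_measurable borel" by (simp add: f_def)
      have "(\<lambda>x. indicator (ball 0 (real m)) x * (indicator (ball 0 (s m)) x * f j x)) \<in> borel_measurable borel" by measurable
      then show "(\<lambda>x. indicator (ball 0 (real m)) x * f j x) \<in> borel_measurable borel"
        by (subst sub) (simp add: mult.assoc)
    qed
    show "\<forall>\<^sub>F j in sequentially. (\<integral>\<^sup>+x. ennreal \<bar>f j x\<bar> * indicator (ball 0 (real m)) x \<partial>lborel) < \<infinity>"
      using goodk[of m]
    proof (rule eventually_mono)
      fix j assume g: "good m (k j)"
      have "(\<integral>\<^sup>+x. ennreal \<bar>f j x\<bar> * indicator (ball 0 (real m)) x \<partial>lborel)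
         \<le> (\<integral>\<^sup>+x. ennreal (N m) * indicator (ball 0 (real m)) x + ennreal (v m (k j) x) \<partial>lborel)"
      proof (rule nn_integral_mono_AE)
        show "AE x in lborel. ennreal \<bar>f j x\<bar> * indicator (ball 0 (real m)) x
            \<le> ennreal (N m) * indicator (ball 0 (real m)) x + ennreal (v m (k j) x)"
          using rel[OF g]
        proof (rule eventually_mono)
          fix x assume x: "x \<in> ball 0 (s m) \<longrightarrow> u (k j) x = ereal (N m - v m (k j) x)"
          show "ennreal \<bar>f j x\<bar> * indicator (ball 0 (real m)) x
            \<le> ennreal (N m) * indicator (ball 0 (real m)) x + ennreal (v m (k j) x)"
          proof (cases "x \<in> ball 0 (real m)")
            case True
            then have "x \<in> ball 0 (s m)" by (simp add: s_def)
            then have "f j x = N m - v m (k j) x" using x by (simp add: f_def)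
            then have "\<bar>f j x\<bar> \<le> N m + v m (k j) x" using N(1)[of m] v0[of m "k j" x] by linarith
            then have "ennreal \<bar>f j x\<bar> \<le> ennreal (N m + v m (k j) x)" by (rule ennreal_leI)
            then show ?thesis using True N(1)[of m] v0[of m "k j" x] by (simp add: ennreal_plus del: mem_ball)
          qed (simp del: mem_ball)
        qed
      qed
      also have "\<dots> = ennreal (N m) * emeasure lborel (ball (0::real^'n) (real m)) + (\<integral>\<^sup>+x. ennreal (v m (k j) x) \<partial>lborel)"
        by (subst nn_integral_add) (auto simp: nn_integral_cmult_indicator)
      also have "\<dots> < \<infinity>"
        using emeasure_lborel_ball_finite[of "0::real^'n" "real m"] nn_integral_eq_integral[OF vint] v0
        by (simp add: ennreal_mult_less_top)
      finally show "(\<integral>\<^sup>+x. ennreal \<bar>f j x\<bar> * indicator (ball 0 (real m)) x \<partial>lborel) < \<infinity>" .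
    qed
    fix \<epsilon> :: real assume eps: "\<epsilon> > 0"
    define M where "M = measure lborel (ball (0::real^'n) (real m))"
    have M0: "M \<ge> 0" by (simp add: M_def)
    have "\<forall>\<^sub>F i in sequentially. \<delta> m i < \<epsilon> / 3" by (rule order_tendstoD(2)[OF \<delta>0]) (use eps in simp)
    moreover have "\<forall>\<^sub>F i in sequentially. T i < (3 * s m)\<^sup>2 / (2 * real CARD('n))"
      using s(2)[of m] by (intro order_tendstoD(2)[OF T0]) simp
    ultimately obtain i where i: "\<delta> m i < \<epsilon> / 3" "T i < (3 * s m)\<^sup>2 / (2 * real CARD('n))"
      using eventually_happens'[OF sequentially_bot eventually_conj] by blast
    then have Ti: "2 * real CARD('n) * T i \<le> (3 * s m)\<^sup>2" by (simp add: field_simps)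
    have "\<forall>\<^sub>F j in sequentially. \<forall>x\<in>cball 0 (real m). dist (P m i (k j) x) (V0 (m, i) x) < \<epsilon> / (6 * (M + 1))"
    proof (rule uniform_limitD)
      show "uniform_limit (cball 0 (real m)) (\<lambda>j. P m i (k j)) (V0 (m, i)) sequentially"
        using V0[where K="cball 0 (real m)" and z="(m, i)"] by simp
      show "0 < \<epsilon> / (6 * (M + 1))" using eps M0 by simp
    qed
    with goodk[of m] have "\<forall>\<^sub>F j in sequentially. good m (k j) \<and> (\<forall>x\<in>cball 0 (real m). dist (P m i (k j) x) (V0 (m, i) x) < \<epsilon> / (6 * (M + 1)))"
      by (rule eventually_conj)
    then obtain n where n: "\<And>j. j \<ge> n \<Longrightarrow> good m (k j) \<and> (\<forall>x\<in>cball 0 (real m). dist (P m i (k j) x) (V0 (m, i) x) < \<epsilon> / (6 * (M + 1)))"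
      unfolding eventually_sequentially by blast
    show "\<exists>N. \<forall>a\<ge>N. \<forall>b\<ge>N. (\<integral>\<^sup>+x. ennreal \<bar>f a x - f b x\<bar> * indicator (ball 0 (real m)) x \<partial>lborel) \<le> ennreal \<epsilon>"
    proof (intro exI[of _ n] allI impI)
      fix a b assume ab: "n \<le> a" "n \<le> b"
      have ga: "good m (k a)" and gb: "good m (k b)" using n ab by auto
      let ?d = "\<lambda>j x. ennreal \<bar>v m (k j) x - P m i (k j) x\<bar> * indicator (ball 0 (real m)) x"
      have "(\<integral>\<^sup>+x. ennreal \<bar>f a x - f b x\<bar> * indicator (ball 0 (real m)) x \<partial>lborel)
         \<le> (\<integral>\<^sup>+x. (?d a x + ?d b x) + ennreal (\<epsilon> / (3 * (M + 1))) * indicator (ball 0 (real m)) x \<partial>lborel)"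
      proof (rule nn_integral_mono_AE)
        have "AE x in lborel. (x \<in> ball 0 (s m) \<longrightarrow> u (k a) x = ereal (N m - v m (k a) x)) \<and>
            (x \<in> ball 0 (s m) \<longrightarrow> u (k b) x = ereal (N m - v m (k b) x))"
          using rel[OF ga] rel[OF gb] by (rule eventually_conj)
        then show "AE x in lborel. ennreal \<bar>f a x - f b x\<bar> * indicator (ball 0 (real m)) x
            \<le> (?d a x + ?d b x) + ennreal (\<epsilon> / (3 * (M + 1))) * indicator (ball 0 (real m)) x"
        proof (rule eventually_mono)
          fix x assume x: "(x \<in> ball 0 (s m) \<longrightarrow> u (k a) x = ereal (N m - v m (k a) x)) \<and>
            (x \<in> ball 0 (s m) \<longrightarrow> u (k b) x = ereal (N m - v m (k b) x))"
          show "ennreal \<bar>f a x - f b x\<bar> * indicator (ball 0 (real m)) x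
            \<le> (?d a x + ?d b x) + ennreal (\<epsilon> / (3 * (M + 1))) * indicator (ball 0 (real m)) x"
          proof (cases "x \<in> ball 0 (real m)")
            case True
            then have "x \<in> ball 0 (s m)" by (simp add: s_def)
            then have fx: "f a x = N m - v m (k a) x" "f b x = N m - v m (k b) x" using x by (simp_all add: f_def)
            have "x \<in> cball 0 (real m)" using True by simp
            then have "\<bar>P m i (k a) x - V0 (m, i) x\<bar> < \<epsilon> / (6 * (M + 1))" "\<bar>P m i (k b) x - V0 (m, i) x\<bar> < \<epsilon> / (6 * (M + 1))"
              using n ab by (auto simp: dist_real_def)
            moreover have "\<epsilon> / (3 * (M + 1)) = \<epsilon> / (6 * (M + 1)) + \<epsilon> / (6 * (M + 1))"
            proof -
              have "a / (3 * b) = a / (6 * b) + a / (6 * b)" for a b :: real by (cases "b = 0") (simp_all add: field_simps)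
              then show ?thesis .
            qed
            ultimately have "\<bar>f a x - f b x\<bar> \<le> \<bar>v m (k a) x - P m i (k a) x\<bar> + \<bar>v m (k b) x - P m i (k b) x\<bar> + \<epsilon> / (3 * (M + 1))"
              unfolding fx by (rule abs_diff_via_smoothings)
            then have "ennreal \<bar>f a x - f b x\<bar> \<le> ennreal (\<bar>v m (k a) x - P m i (k a) x\<bar> + \<bar>v m (k b) x - P m i (k b) x\<bar> + \<epsilon> / (3 * (M + 1)))"
              by (rule ennreal_leI)
            then show ?thesis using True eps M0 by (simp add: ennreal_plus del: mem_ball)
          qed (simp del: mem_ball)
        qed
      qed
      also have "\<dots> = ((\<integral>\<^sup>+x. ?d a x \<partial>lborel) + (\<integral>\<^sup>+x. ?d b x \<partial>lborel)) + ennreal (\<epsilon> / (3 * (M + 1))) * emeasure lborel (ball (0::real^'n) (real m))"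
        by (simp add: nn_integral_add nn_integral_cmult_indicator)
      also have "\<dots> \<le> (ennreal (\<epsilon> / 3) + ennreal (\<epsilon> / 3)) + ennreal (\<epsilon> / 3)"
      proof (intro add_mono)
        show "(\<integral>\<^sup>+x. ?d a x \<partial>lborel) \<le> ennreal (\<epsilon> / 3)"
          using smooth[OF ga Ti] by (rule order_trans) (use i(1) in \<open>auto intro: ennreal_leI\<close>)
        show "(\<integral>\<^sup>+x. ?d b x \<partial>lborel) \<le> ennreal (\<epsilon> / 3)"
          using smooth[OF gb Ti] by (rule order_trans) (use i(1) in \<open>auto intro: ennreal_leI\<close>)
        have "emeasure lborel (ball (0::real^'n) (real m)) = ennreal M"
          unfolding M_def using emeasure_lborel_ball_finite[of "0::real^'n" "real m"] by (intro emeasure_eq_ennreal_measure) auto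
        then have "ennreal (\<epsilon> / (3 * (M + 1))) * emeasure lborel (ball (0::real^'n) (real m)) = ennreal (\<epsilon> / (3 * (M + 1)) * M)"
          using eps M0 by (simp only: ennreal_mult divide_nonneg_nonneg less_imp_le add_nonneg_nonneg mult_nonneg_nonneg zero_le_numeral zero_le_one)
        also have "\<dots> \<le> ennreal (\<epsilon> / 3)" using eps M0 by (intro ennreal_leI) (simp add: field_simps)
        finally show "ennreal (\<epsilon> / (3 * (M + 1))) * emeasure lborel (ball (0::real^'n) (real m)) \<le> ennreal (\<epsilon> / 3)" .
      qed
      also have "\<dots> = ennreal \<epsilon>" using eps by (simp add: ennreal_plus[symmetric] del: ennreal_plus)
      finally show "(\<integral>\<^sup>+x. ennreal \<bar>f a x - f b x\<bar> * indicator (ball 0 (real m)) x \<partial>lborel) \<le> ennreal \<epsilon>" .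
    qed
  qed blast
  have "tendsto_L1_loc (\<lambda>j. u (k j)) V"
    unfolding tendsto_L1_loc_def
  proof (intro allI impI conjI)
    fix K :: "(real^'n) set" assume K: "compact K"
    then obtain b where b: "\<And>x. x \<in> K \<Longrightarrow> norm x \<le> b" using compact_imp_bounded bounded_iff by metis
    obtain m :: nat where m: "b < real m" using reals_Archimedean2 by blast
    have Km: "K \<subseteq> ball 0 (real m)" using b m by force
    have [measurable]: "K \<in> sets borel" using K by (rule borel_compact)
    have [measurable]: "V \<in> borel_measurable borel" by (rule V(1))
    show "set_integrable lborel K V" unfolding set_integrable_def
    proof (rule integrableI_bounded)
      have "(\<integral>\<^sup>+x. ennreal (norm (indicator K x *\<^sub>R V x)) \<partial>lborel) \<le> (\<integral>\<^sup>+x. ennreal \<bar>V x\<bar> * indicator (ball 0 (real m)) x \<partial>lborel)"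
        using Km by (intro nn_integral_mono) (auto simp: indicator_def)
      then show "(\<integral>\<^sup>+x. ennreal (norm (indicator K x *\<^sub>R V x)) \<partial>lborel) < \<infinity>" using V(2)[of m] by (rule le_less_trans)
    qed measurable
    show "(\<lambda>j. set_nn_integral lborel K (\<lambda>x. e2ennreal \<bar>u (k j) x - ereal (V x)\<bar>)) \<longlonglongrightarrow> 0"
    proof (rule tendsto_sandwich[OF _ _ tendsto_const V(3)[of m]])
      show "\<forall>\<^sub>F j in sequentially. set_nn_integral lborel K (\<lambda>x. e2ennreal \<bar>u (k j) x - ereal (V x)\<bar>)
         \<le> (\<integral>\<^sup>+x. ennreal \<bar>f j x - V x\<bar> * indicator (ball 0 (real m)) x \<partial>lborel)"
        using goodk[of m]
      proof (rule eventually_mono)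
        fix j assume g: "good m (k j)"
        show "set_nn_integral lborel K (\<lambda>x. e2ennreal \<bar>u (k j) x - ereal (V x)\<bar>)
         \<le> (\<integral>\<^sup>+x. ennreal \<bar>f j x - V x\<bar> * indicator (ball 0 (real m)) x \<partial>lborel)"
        proof (rule nn_integral_mono_AE)
          show "AE x in lborel. e2ennreal \<bar>u (k j) x - ereal (V x)\<bar> * indicator K x
            \<le> ennreal \<bar>f j x - V x\<bar> * indicator (ball 0 (real m)) x"
            using rel[OF g]
          proof (rule eventually_mono)
            fix x assume x: "x \<in> ball 0 (s m) \<longrightarrow> u (k j) x = ereal (N m - v m (k j) x)"
            show "e2ennreal \<bar>u (k j) x - ereal (V x)\<bar> * indicator K x
            \<le> ennreal \<bar>f j x - V x\<bar> * indicator (ball 0 (real m)) x"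
            proof (cases "x \<in> K")
              case True
              then have xm: "x \<in> ball 0 (real m)" using Km by blast
              then have "x \<in> ball 0 (s m)" by (simp add: s_def)
              then show ?thesis using True x xm by (simp add: f_def del: mem_ball)
            qed simp
          qed
        qed
      qed
    qed simp
  qed
  then show ?thesis using that[OF k V(1)] by blast
qed

section \<open>Existence of tangents\<close>

lemma subharmonic_on_imp_viscosity_subharmonic:
  assumes "subequation F" "cone F" "ST_invariant F" "convex F" and u: "subharmonic_on F X u"
  shows "viscosity_subharmonic X u"
  unfolding viscosity_subharmonic_def
proof (intro conjI ballI allI impI)
  fix x0 \<phi> g H S
  assume "x0 \<in> X" "open S \<and> x0 \<in> S \<and> S \<subseteq> X \<and> C2_on S \<phi> g H \<and> (\<forall>x\<in>S. u x \<le> ereal (\<phi> x)) \<and> u x0 = ereal (\<phi> x0)"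
  then have "H x0 \<in> F" using u unfolding subharmonic_on_def by blast
  then show "trace (H x0) \<ge> 0" by (rule trace_nonneg_of_convex_ST_invariant[OF assms(1-4)])
qed (use u in \<open>auto simp: subharmonic_on_def\<close>)

context riesz_subharmonic
begin

text \<open>Both definitions of the flow for \<open>p \<ge> 2\<close> have the form to which
\<open>viscosity_subharmonic_rescale\<close> applies.\<close>

lemma tangential_flow_affine:
  assumes "p \<ge> 2" "r > 0" "cball 0 r \<subseteq> X"
  shows "tangential_flow p u r = (\<lambda>x. ereal (r powr (p - 2)) * u (r *\<^sub>R x) + ereal (if p = 2 then - max_on_cball r else 0))"
proof (cases "p = 2")
  case True
  have "u (r *\<^sub>R x) - ereal c = u (r *\<^sub>R x) + ereal (- c)" for x c by (cases "u (r *\<^sub>R x)") auto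
  then show ?thesis using True assms SUP_eq_max_on_cball[OF assms(2,3)]
    by (simp add: fun_eq_iff tangential_flow_def one_ereal_def[symmetric])
next
  case False
  then show ?thesis using assms by (simp add: fun_eq_iff tangential_flow_def zero_ereal_def[symmetric])
qed

text \<open>For \<open>p = 2\<close> the value of the flow on the ball of radius \<open>R\<close> is at most the increment of the maximum
between the radii \<open>r\<close> and \<open>r * R\<close>, which \<open>max_on_cball_growth\<close> bounds by a multiple of \<open>ln R\<close>,
whatever \<open>r\<close> is. For \<open>p > 2\<close> the factor \<open>r powr (p - 2)\<close> is at most one.\<close>

lemma tangential_flow_bounded_above:
  assumes p2: "p \<ge> 2" and \<rho>: "\<rho> > 0" "cball 0 \<rho> \<subseteq> X" and R: "R > 0"
  obtains N where "N \<ge> 0" "\<forall>\<^sub>F r in at_right 0. \<forall>x\<in>cball 0 R. tangential_flow p u r x \<le> ereal N"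
proof -
  obtain D where D: "D \<ge> 0" "\<And>s t. 0 < s \<Longrightarrow> s < \<rho> / 2 \<Longrightarrow> s < t \<Longrightarrow> t < \<rho> \<Longrightarrow>
        max_on_cball t - max_on_cball s \<le> D * (riesz_kernel p t - riesz_kernel p s)"
    by (rule max_on_cball_growth[OF \<rho>]) (rule that)
  \<comment> \<open>Enlarging \<open>R\<close> makes \<open>r < r * R'\<close>, as the growth estimate requires.\<close>
  define R' where "R' = max R 2"
  have R': "R \<le> R'" "R' > 1" by (auto simp: R'_def)
  define N where "N = max \<bar>max_on_cball \<rho>\<bar> (D * ln R')"
  have N0: "N \<ge> 0" by (simp add: N_def)
  have bound: "tangential_flow p u r x \<le> ereal N" if r: "0 < r" "r < 1" "r < \<rho> / (2 * R')" and x: "x \<in> cball 0 R" for r x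
  proof -
    have rR: "r * R' < \<rho> / 2" using r R' by (simp add: field_simps)
    have "r * 1 < r * R'" using R' r by (intro mult_strict_left_mono) auto
    then have r2: "r < \<rho> / 2" "r < r * R'" using rR by auto
    have X: "cball 0 r \<subseteq> X" "cball 0 (r * R') \<subseteq> X" using \<rho> r2 rR by (auto simp: subset_iff)
    have "norm (r *\<^sub>R x) \<le> r * R'" using x r R' by (auto intro!: mult_left_mono)
    then have rx: "r *\<^sub>R x \<in> cball 0 (r * R')" by simp
    have rR0: "0 < r * R'" using r R' by simp
    show ?thesis
    proof (cases "p = 2")
      case True
      have "u (r *\<^sub>R x) \<le> ereal (max_on_cball (r * R'))" by (rule le_max_on_cball[OF rR0 X(2) rx])
      moreover have "max_on_cball (r * R') - max_on_cball r \<le> D * (riesz_kernel p (r * R') - riesz_kernel p r)"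
        using D(2)[of r "r * R'"] r r2 rR by simp
      moreover have "riesz_kernel p (r * R') - riesz_kernel p r = ln R'"
        using True r R' by (simp add: riesz_kernel_def ln_mult)
      ultimately have "u (r *\<^sub>R x) + ereal (- max_on_cball r) \<le> ereal (D * ln R')"
        by (cases "u (r *\<^sub>R x)") auto
      also have "\<dots> \<le> ereal N" by (simp add: N_def)
      finally show ?thesis unfolding tangential_flow_affine[OF p2 r(1) X(1)] using True r
        by (simp add: one_ereal_def[symmetric])
    next
      case False
      define a where "a = r powr (p - 2)"
      have a: "0 < a" "a \<le> 1" using r p2 False by (auto simp: a_def powr_le1)
      have "r *\<^sub>R x \<in> cball 0 \<rho>" using rx rR rR0 \<rho>(1) by auto
      then have "u (r *\<^sub>R x) \<le> ereal (max_on_cball \<rho>)" by (rule le_max_on_cball[OF \<rho>])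
      also have "\<dots> \<le> ereal \<bar>max_on_cball \<rho>\<bar>" by simp
      finally have "u (r *\<^sub>R x) \<le> ereal \<bar>max_on_cball \<rho>\<bar>" .
      then have "ereal a * u (r *\<^sub>R x) \<le> ereal (a * \<bar>max_on_cball \<rho>\<bar>)"
        using a by (cases "u (r *\<^sub>R x)") auto
      also have "\<dots> \<le> ereal N"
      proof -
        have "a * \<bar>max_on_cball \<rho>\<bar> \<le> \<bar>max_on_cball \<rho>\<bar>" using a by (intro mult_left_le_one_le) auto
        also have "\<dots> \<le> N" unfolding N_def by (rule max.cobounded1)
        finally show ?thesis by simp
      qed
      finally show ?thesis using False by (simp add: tangential_flow_affine[OF p2 r(1) X(1)] a_def zero_ereal_def[symmetric])
    qed
  qed
  have "\<forall>\<^sub>F r in at_right 0. 0 < r \<and> r < min 1 (\<rho> / (2 * R'))"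
    using \<rho> R' unfolding eventually_at_right_field by (intro exI[of _ "min 1 (\<rho> / (2 * R'))"]) auto
  then have "\<forall>\<^sub>F r in at_right 0. \<forall>x\<in>cball 0 R. tangential_flow p u r x \<le> ereal N"
    by (rule eventually_mono) (use bound in auto)
  then show ?thesis using that N0 by blast
qed

text \<open>For \<open>p = 2\<close> the flow is normalised so that its maximum over the unit ball is \<open>0\<close>. For \<open>p > 2\<close> the
maximum of \<open>u\<close> over the ball of radius \<open>r\<close> is at least \<open>B + D * riesz_kernel p r\<close>, and the factor
\<open>r powr (p - 2)\<close> compensates the growth of the kernel.\<close>

lemma tangential_flow_bounded_below:
  assumes p2: "p \<ge> 2" and \<rho>: "\<rho> > 0" "cball 0 \<rho> \<subseteq> X"
  obtains C where "C \<ge> 0" "\<forall>\<^sub>F r in at_right 0. \<exists>x\<in>cball 0 1. ereal (- C) \<le> tangential_flow p u r x"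
proof -
  obtain D where D: "D \<ge> 0"
    "\<And>s. 0 < s \<Longrightarrow> s < \<rho> / 2 \<Longrightarrow> max_on_cball \<rho> - max_on_cball s \<le> D * (riesz_kernel p \<rho> - riesz_kernel p s)"
    by (rule max_on_cball_growth[OF \<rho>]) (rule that)
  define B where "B = max_on_cball \<rho> - D * riesz_kernel p \<rho>"
  define C where "C = \<bar>B\<bar> + (if p = 2 then 0 else D / (p - 2))"
  have C0: "C \<ge> 0" using D p2 by (simp add: C_def)
  have bound: "\<exists>x\<in>cball 0 1. ereal (- C) \<le> tangential_flow p u r x" if r: "0 < r" "r < 1" "r < \<rho> / 2" for r
  proof -
    have X: "cball 0 r \<subseteq> X" using \<rho> r by (auto simp: subset_iff)
    obtain y where y: "y \<in> cball 0 r" "u y = ereal (max_on_cball r)" using max_on_cball_attained[OF r(1) X] by blast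
    define x where "x = (1/r) *\<^sub>R y"
    have x1: "x \<in> cball 0 1" using y(1) r by (simp add: x_def)
    have rx: "r *\<^sub>R x = y" using r by (simp add: x_def)
    have flow: "tangential_flow p u r x = ereal (r powr (p - 2) * max_on_cball r + (if p = 2 then - max_on_cball r else 0))"
      by (simp add: tangential_flow_affine[OF p2 r(1) X] rx y(2))
    have "- C \<le> r powr (p - 2) * max_on_cball r + (if p = 2 then - max_on_cball r else 0)"
    proof (cases "p = 2")
      case True
      then show ?thesis using r C0 by simp
    next
      case False
      define a where "a = r powr (p - 2)"
      have a: "0 < a" "a \<le> 1" using r p2 False by (auto simp: a_def powr_le1)
      have "a * r powr (2 - p) = 1" using r by (simp add: a_def powr_add[symmetric])
      then have K: "a * riesz_kernel p r = - 1 / (p - 2)"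
        using False p2 by (simp add: riesz_kernel_def divide_simps)
      have "B + D * riesz_kernel p r \<le> max_on_cball r" using D(2)[OF r(1,3)] by (simp add: B_def algebra_simps)
      then have "a * (B + D * riesz_kernel p r) \<le> a * max_on_cball r" using a by (intro mult_left_mono) auto
      moreover have "a * (B + D * riesz_kernel p r) = a * B + D * (a * riesz_kernel p r)" by (simp add: algebra_simps)
      moreover have "a * B \<ge> - \<bar>B\<bar>"
        using a mult_left_le_one_le[of "\<bar>B\<bar>" a] abs_le_iff[of "a * B" "a * \<bar>B\<bar>"] by (simp add: abs_mult)
      ultimately show ?thesis unfolding a_def[symmetric] C_def using False K by simp
    qed
    then have "ereal (- C) \<le> tangential_flow p u r x" unfolding flow by (simp only: ereal_less_eq)
    then show ?thesis using x1 by blast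
  qed
  have "\<forall>\<^sub>F r in at_right 0. 0 < r \<and> r < min 1 (\<rho> / 2)"
    using \<rho> unfolding eventually_at_right_field by (intro exI[of _ "min 1 (\<rho> / 2)"]) auto
  then have "\<forall>\<^sub>F r in at_right 0. \<exists>x\<in>cball 0 1. ereal (- C) \<le> tangential_flow p u r x"
    by (rule eventually_mono) (use bound in auto)
  then show ?thesis using that C0 by blast
qed

lemma tangent_exists_of_ge_2:
  assumes p2: "p \<ge> 2" and conv: "convex F" and X0: "0 \<in> X"
  obtains r V where "\<And>j. r j > 0" "decseq r" "r \<longlonglongrightarrow> 0" "V \<in> borel_measurable borel"
    "tendsto_L1_loc (\<lambda>j. tangential_flow p u (r j)) V"
proof -
  have visc: "viscosity_subharmonic X u"
    by (rule subharmonic_on_imp_viscosity_subharmonic[OF sub cone ST conv u])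
  obtain \<rho> where \<rho>: "\<rho> > 0" "cball 0 \<rho> \<subseteq> X" using open_contains_cball openX X0 by metis
  define r0 where "r0 j = 1 / real (Suc j)" for j
  have r0: "r0 j > 0" for j by (simp add: r0_def)
  have r0lim: "r0 \<longlonglongrightarrow> 0" unfolding r0_def using LIMSEQ_inverse_real_of_nat by (simp add: inverse_eq_divide)
  then have r0at: "filterlim r0 (at_right 0) sequentially"
    unfolding filterlim_at using r0 by (auto intro!: always_eventually simp: less_imp_neq[THEN not_sym])
  have above: "\<exists>N\<ge>0. \<forall>\<^sub>F j in sequentially. \<exists>Y. cball 0 R \<subseteq> Y \<and>
      viscosity_subharmonic Y (tangential_flow p u (r0 j)) \<and> (\<forall>x\<in>cball 0 R. tangential_flow p u (r0 j) x \<le> ereal N)"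
    if R: "R > 0" for R
  proof -
    obtain N where N: "N \<ge> 0" "\<forall>\<^sub>F r in at_right 0. \<forall>x\<in>cball 0 R. tangential_flow p u r x \<le> ereal N"
      using tangential_flow_bounded_above[OF p2 \<rho> R] by blast
    have "\<forall>\<^sub>F j in sequentially. \<forall>x\<in>cball 0 R. tangential_flow p u (r0 j) x \<le> ereal N"
      using r0at N(2) by (rule eventually_compose_filterlim[rotated])
    moreover have "\<forall>\<^sub>F j in sequentially. r0 j < \<rho> / (R + 1)"
      using \<rho> R by (intro order_tendstoD(2)[OF r0lim]) simp
    ultimately have "\<forall>\<^sub>F j in sequentially. \<exists>Y. cball 0 R \<subseteq> Y \<and>
      viscosity_subharmonic Y (tangential_flow p u (r0 j)) \<and> (\<forall>x\<in>cball 0 R. tangential_flow p u (r0 j) x \<le> ereal N)"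
    proof eventually_elim
      case (elim j)
      have small: "r0 j * (R + 1) < \<rho>" using elim(2) R by (simp add: field_simps)
      have inX: "r0 j *\<^sub>R x \<in> X" if "norm x \<le> R + 1" for x
      proof -
        have "norm (r0 j *\<^sub>R x) \<le> r0 j * (R + 1)" using that r0[of j] by simp
        then show ?thesis using small \<rho>(2) by auto
      qed
      have "cball 0 (r0 j) \<subseteq> X"
      proof
        fix y :: "real^'n" assume "y \<in> cball 0 (r0 j)"
        moreover have "r0 j * 1 \<le> r0 j * (R + 1)" using R r0[of j] by (intro mult_left_mono) auto
        ultimately show "y \<in> X" using small \<rho>(2) by auto
      qed
      then have "viscosity_subharmonic {x. r0 j *\<^sub>R x \<in> X} (tangential_flow p u (r0 j))"
        unfolding tangential_flow_affine[OF p2 r0 \<open>cball 0 (r0 j) \<subseteq> X\<close>]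
        by (intro viscosity_subharmonic_rescale[OF visc r0]) (use r0[of j] in simp)
      moreover have "cball 0 R \<subseteq> {x. r0 j *\<^sub>R x \<in> X}" using inX by auto
      ultimately show ?case using elim(1) by blast
    qed
    then show ?thesis using N(1) by blast
  qed
  obtain C where C: "C \<ge> 0" "\<forall>\<^sub>F r in at_right 0. \<exists>x\<in>cball 0 1. ereal (- C) \<le> tangential_flow p u r x"
    using tangential_flow_bounded_below[OF p2 \<rho>] by blast
  have below: "\<forall>\<^sub>F j in sequentially. \<exists>x\<in>cball 0 1. ereal (- C) \<le> tangential_flow p u (r0 j) x"
    using r0at C(2) by (rule eventually_compose_filterlim[rotated])
  obtain k V where k: "strict_mono (k :: nat \<Rightarrow> nat)" and V: "V \<in> borel_measurable borel"
    "tendsto_L1_loc (\<lambda>j. tangential_flow p u (r0 (k j))) V"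
    by (rule viscosity_subharmonic_compactness[OF above below C(1)])
  have dec: "decseq (\<lambda>j. r0 (k j))"
    using strict_mono_less_eq[OF k] by (auto simp: decseq_def r0_def intro!: divide_left_mono)
  have lim: "(\<lambda>j. r0 (k j)) \<longlonglongrightarrow> 0" using LIMSEQ_subseq_LIMSEQ[OF r0lim k] by (simp add: o_def)
  show ?thesis by (rule that[of "\<lambda>j. r0 (k j)" V]) (use r0 dec lim V in auto)
qed

end

theorem theorem1p1:
  fixes F :: "(real^'n^'n) set"
    and e :: "real^'n"
    and p :: real
    and X :: "(real^'n) set"
    and u :: "real^'n \<Rightarrow> ereal"
  assumes "CARD('n) \<ge> 2"
    and "subequation F" and "cone F" and "ST_invariant F"
    and "norm e = 1" and "riesz_characteristic F e = ereal p"
    and "convex F \<or> p < 2"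
    and "open X" and "0 \<in> X" and "subharmonic_on F X u"
  shows "tangents F p u \<noteq> {}"
proof -
  interpret riesz_subharmonic F e p X u by standard (use assms in auto)
  show ?thesis
  proof (cases "p < 2")
    case True
    obtain r V where r: "\<And>j. r j > 0" "decseq r" "r \<longlonglongrightarrow> 0"
      and V: "tendsto_locally_uniformly (\<lambda>j. tangential_flow p u (r j)) V" "continuous_on UNIV V"
      using tangent_exists_of_lt_2[OF True assms(9)] by blast
    have "(\<lambda>x. ereal (V x)) \<in> tangents F p u"
      unfolding tangents_def
      using True r V tendsto_L1_loc_of_locally_uniformly[OF V] usc_representative_continuous[OF V(2)] by blast
    then show ?thesis by blast
  next
    case False
    then have conv: "convex F" using assms(7) by blast
    obtain r V where r: "\<And>j. r j > 0" "decseq r" "r \<longlonglongrightarrow> 0"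
      and V: "V \<in> borel_measurable borel" "tendsto_L1_loc (\<lambda>j. tangential_flow p u (r j)) V"
      using tangent_exists_of_ge_2[OF _ conv assms(9)] False by (metis not_less)
    obtain U where "usc_representative V U" using usc_representative_exists V(1) by auto
    then have "U \<in> tangents F p u" unfolding tangents_def using False conv r V(2) by blast
    then show ?thesis by blast
  qed
qed

end
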